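(* If $\mathcal{E} \in \mathfrak{E}_1$ is non-resonant, then there exists a unique normal form $\mathcal{N} \in \mathfrak{D}_1$ such that $\mathrm{Hom}(\mathcal{N}, \mathcal{E}) \neq \emptyset$. Indeed, in that case, there is a unique normalizing transformation: $|\mathrm{Hom}(\mathcal{N}, \mathcal{E})| =1$. If $\mathcal{E}$ is convergent, so is $\mathcal{N}$ and the normalizing transformation.
   Context: Fix $m=1$. The category $\mathfrak{E}_1$ has as objects the (formal or holomorphic) singular second order ODEs $w''=w\,\Phi\left(z,w,\frac{w'}{w}\right)$, where $\Phi(z,w,\zeta)=\sum_{a,b\ge 0,\,c\ge 2}\Phi_{a,b,c}z^aw^b\zeta^c$ is a power series in $\mathbb C[[z,w,\zeta]]$ with $\Phi=O(\zeta^2)$ (such an ODE is called convergent if $\Phi$ is a convergent power series). For $\mathcal E_1,\mathcal E_2\in\mathfrak E_1$, a morphism $H\in\mathrm{Hom}(\mathcal E_1,\mathcal E_2)$ is an invertible formal map $H(z,w)=(F(z,w),G(z,w))$, $F,G\in\mathbb C[[z,w]]$, transforming graphs of solutions of $\mathcal E_1$ into graphs of solutions of $\mathcal E_2$ and of the form $F=z+f(z,w)$, $G=w+wg_0(w)+w\,g(z,w)$ with $f_z(0,0)=0$, $g_0(0)=0$, $g(z,w)=O(zw)$. The subcategory $\mathfrak{D}_1\subset\mathfrak E_1$ (ODEs in normal form) consists of those ODEs whose $\Phi$ satisfies in addition $\Phi_{0,j,2}=\Phi_{1,j,2}=\Phi_{0,j,3}=\Phi_{1,j,3}=0$ for all $j>0$.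 Non-resonance: write $\Phi(z,w,\zeta)=\sum_k\Phi_k(z,w)\zeta^k$, $\Phi_2=\sum_j A_j(w)z^j$, $\Phi_3=\sum_jB_j(w)z^j$, $\Phi_4=\sum_jC_j(w)z^j$, and $\alpha_j=A_j(0)$, $\beta_j=B_j(0)$, $\gamma_j=C_j(0)$. The ODE is non-resonant if the linearization matrix at the origin of the first order Briot–Bouquet system satisfied by the Cauchy data $(g_0,g_1,f_0,f_1)$ of a transformation (with $f_0(w)=f(0,w)$, $f_1(w)=f_z(0,w)$, $g_1(w)=g_z(0,w)/w$) has no positive integer eigenvalues; equivalently, for every integer $k\ge 1$ the linear system with matrix $\begin{pmatrix} k(k+1-\alpha_0) & -3\beta_0 & -\alpha_1 & -2k\\ \alpha_1k & 3k(k+1-\alpha_0)+3\beta_1 & 2\alpha_2 & \alpha_1\\ 2k\beta_0 & 4\gamma_0 & k(k-1+\alpha_0)+\beta_1 & -\beta_0\\ 2k\beta_1 & 2\beta_0(\alpha_0-1)+4\gamma_1 & k\alpha_1+2\beta_2 & k(k-1+\alpha_0)\end{pmatrix}h_k=0$ has only the trivial solution $h_k=0$. *)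

theory Defs
  imports "HOL-Analysis.Analysis"
begin

text \<open>A series in C[[z,w]] is given by its coefficient function: P a b is the
coefficient of z^a w^b.  A series in C[[z,w,zeta]] likewise: P a b c is the
coefficient of z^a w^b zeta^c.\<close>

type_synonym ps2 = "nat \<Rightarrow> nat \<Rightarrow> complex"
type_synonym ps3 = "nat \<Rightarrow> nat \<Rightarrow> nat \<Rightarrow> complex"

definition ps_zero :: ps3 where "ps_zero = (\<lambda>a b c. 0)"
definition ps_one :: ps3 where "ps_one = (\<lambda>a b c. if a = 0 \<and> b = 0 \<and> c = 0 then 1 else 0)"
definition ps_const :: "complex \<Rightarrow> ps3" where
  "ps_const x = (\<lambda>a b c. if a = 0 \<and> b = 0 \<and> c = 0 then x else 0)"

definition ps_Z :: ps3 where "ps_Z = (\<lambda>a b c. if a = 1 \<and> b = 0 \<and> c = 0 then 1 else 0)"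
definition ps_W :: ps3 where "ps_W = (\<lambda>a b c. if a = 0 \<and> b = 1 \<and> c = 0 then 1 else 0)"
definition ps_Zeta :: ps3 where "ps_Zeta = (\<lambda>a b c. if a = 0 \<and> b = 0 \<and> c = 1 then 1 else 0)"

definition ps_add :: "ps3 \<Rightarrow> ps3 \<Rightarrow> ps3" where
  "ps_add P Q = (\<lambda>a b c. P a b c + Q a b c)"
definition ps_sub :: "ps3 \<Rightarrow> ps3 \<Rightarrow> ps3" where
  "ps_sub P Q = (\<lambda>a b c. P a b c - Q a b c)"
definition ps_mult :: "ps3 \<Rightarrow> ps3 \<Rightarrow> ps3" where
  "ps_mult P Q = (\<lambda>a b c. \<Sum>i\<le>a. \<Sum>j\<le>b. \<Sum>k\<le>c. P i j k * Q (a - i) (b - j) (c - k))"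

fun ps_pow :: "ps3 \<Rightarrow> nat \<Rightarrow> ps3" where
  "ps_pow P 0 = ps_one"
| "ps_pow P (Suc n) = ps_mult P (ps_pow P n)"

text \<open>Quotient P / Q (used only when Q has non-zero constant term, where it is unique).\<close>
definition ps_div :: "ps3 \<Rightarrow> ps3 \<Rightarrow> ps3" where
  "ps_div P Q = (THE S. ps_mult S Q = P)"

text \<open>Substitution P(A,B,C) of series A, B, C without constant term into P.
Since A^i B^j C^k has order at least i+j+k, only the terms with
i+j+k \<le> a+b+c contribute to the coefficient of z^a w^b zeta^c.\<close>
definition ps_comp :: "ps3 \<Rightarrow> ps3 \<Rightarrow> ps3 \<Rightarrow> ps3 \<Rightarrow> ps3" where
  "ps_comp P A B C = (\<lambda>a b c.
     (\<Sum>i\<le>a+b+c. \<Sum>j\<le>a+b+c-i. \<Sum>k\<le>a+b+c-i-j.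
        P i j k * ps_mult (ps_mult (ps_pow A i) (ps_pow B j)) (ps_pow C k) a b c))"

definition lift :: "ps2 \<Rightarrow> ps3" where
  "lift F = (\<lambda>a b c. if c = 0 then F a b else 0)"

definition dz :: "ps2 \<Rightarrow> ps2" where "dz F = (\<lambda>a b. of_nat (Suc a) * F (Suc a) b)"
definition dw :: "ps2 \<Rightarrow> ps2" where "dw F = (\<lambda>a b. of_nat (Suc b) * F a (Suc b))"

definition convergent3 :: "ps3 \<Rightarrow> bool" where
  "convergent3 P \<longleftrightarrow> (\<exists>\<rho>::real. \<rho> > 0 \<and>
      (\<lambda>(a,b,c). norm (P a b c) * \<rho> ^ (a + b + c)) summable_on UNIV)"
definition convergent2 :: "ps2 \<Rightarrow> bool" where
  "convergent2 F \<longleftrightarrow> (\<exists>\<rho>::real. \<rho> > 0 \<and>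
      (\<lambda>(a,b). norm (F a b) * \<rho> ^ (a + b)) summable_on UNIV)"

text \<open>An object of E_1 is the ODE w'' = w Phi(z,w,w'/w), identified with Phi = O(zeta^2).\<close>
definition in_E1 :: "ps3 \<Rightarrow> bool" where
  "in_E1 \<Phi> \<longleftrightarrow> (\<forall>a b c. c < 2 \<longrightarrow> \<Phi> a b c = 0)"

definition in_D1 :: "ps3 \<Rightarrow> bool" where
  "in_D1 \<Phi> \<longleftrightarrow> in_E1 \<Phi> \<and>
     (\<forall>j>0. \<Phi> 0 j 2 = 0 \<and> \<Phi> 1 j 2 = 0 \<and> \<Phi> 0 j 3 = 0 \<and> \<Phi> 1 j 3 = 0)"

text \<open>Shape of a morphism H = (F,G): F = z + f with f(0,0) = 0 (formal map fixing the
origin) and f_z(0,0) = 0; G = w + w g0(w) + w g(z,w) with g0(0) = 0, g = O(zw).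
(The Jacobian at 0 is unipotent, so such a map is formally invertible.)\<close>
definition hom_shape :: "ps2 \<Rightarrow> ps2 \<Rightarrow> bool" where
  "hom_shape F G \<longleftrightarrow> F 0 0 = 0 \<and> F 1 0 = 1 \<and>
     (\<forall>a. G a 0 = 0) \<and> G 0 1 = 1 \<and> (\<forall>a\<ge>1. G a 1 = 0)"

text \<open>H = (F,G) transforms graphs of solutions of w'' = w Phi1(z,w,w'/w) into graphs of
solutions of W'' = W Phi2(Z,W,W'/W).  With p = w' = w zeta and the total derivative
D = d/dz + p d/dw + (w Phi1) d/dp, the image of a solution satisfies
dW/dZ = DG/DF and d^2W/dZ^2 = (D^2G DF - DG D^2F)/DF^3, so the condition is the
identity in C[[z,w,zeta]]:
  D^2G DF - DG D^2F = DF^3 G Phi2(F, G, DG/(G DF)),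
where DG/(G DF) = (Gt_z + zeta G_w)/(Gt DF), Gt = G/w.\<close>
definition transforms :: "ps3 \<Rightarrow> ps3 \<Rightarrow> ps2 \<Rightarrow> ps2 \<Rightarrow> bool" where
  "transforms \<Phi>1 \<Phi>2 F G \<longleftrightarrow>
    (let p = ps_mult ps_W ps_Zeta;
         Psi1 = ps_mult ps_W \<Phi>1;
         Gt = (\<lambda>a b. G a (Suc b));
         DF = ps_add (lift (dz F)) (ps_mult p (lift (dw F)));
         DG = ps_add (lift (dz G)) (ps_mult p (lift (dw G)));
         D2F = ps_add (ps_add (ps_add (lift (dz (dz F)))
                  (ps_mult (ps_const 2) (ps_mult p (lift (dz (dw F))))))
                  (ps_mult (ps_mult p p) (lift (dw (dw F)))))
                  (ps_mult Psi1 (lift (dw F)));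
         D2G = ps_add (ps_add (ps_add (lift (dz (dz G)))
                  (ps_mult (ps_const 2) (ps_mult p (lift (dz (dw G))))))
                  (ps_mult (ps_mult p p) (lift (dw (dw G)))))
                  (ps_mult Psi1 (lift (dw G)));
         Zeta' = ps_div (ps_add (lift (dz Gt)) (ps_mult ps_Zeta (lift (dw G))))
                        (ps_mult (lift Gt) DF)
     in ps_sub (ps_mult D2G DF) (ps_mult DG D2F) =
        ps_mult (ps_mult (ps_pow DF 3) (lift G)) (ps_comp \<Phi>2 (lift F) (lift G) Zeta'))"

definition Hom :: "ps3 \<Rightarrow> ps3 \<Rightarrow> (ps2 \<times> ps2) set" where
  "Hom \<Phi>1 \<Phi>2 = {(F, G). in_E1 \<Phi>1 \<and> in_E1 \<Phi>2 \<and> hom_shape F G \<and> transforms \<Phi>1 \<Phi>2 F G}"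

definition nonresonant :: "ps3 \<Rightarrow> bool" where
  "nonresonant \<Phi> \<longleftrightarrow>
    (let \<alpha> = (\<lambda>j. \<Phi> j 0 2); \<beta> = (\<lambda>j. \<Phi> j 0 3); \<gamma> = (\<lambda>j. \<Phi> j 0 4) in
     \<forall>k::nat. k \<ge> 1 \<longrightarrow> (\<forall>h1 h2 h3 h4 :: complex. let x = (of_nat k :: complex) in
       (x * (x + 1 - \<alpha> 0) * h1 - 3 * \<beta> 0 * h2 - \<alpha> 1 * h3 - 2 * x * h4 = 0 \<and>
        \<alpha> 1 * x * h1 + (3 * x * (x + 1 - \<alpha> 0) + 3 * \<beta> 1) * h2 + 2 * \<alpha> 2 * h3 + \<alpha> 1 * h4 = 0 \<and>
        2 * x * \<beta> 0 * h1 + 4 * \<gamma> 0 * h2 + (x * (x - 1 + \<alpha> 0) + \<beta> 1) * h3 - \<beta> 0 * h4 = 0 \<and>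
        2 * x * \<beta> 1 * h1 + (2 * \<beta> 0 * (\<alpha> 0 - 1) + 4 * \<gamma> 1) * h2 + (x * \<alpha> 1 + 2 * \<beta> 2) * h3
          + x * (x - 1 + \<alpha> 0) * h4 = 0)
       \<longrightarrow> h1 = 0 \<and> h2 = 0 \<and> h3 = 0 \<and> h4 = 0))"

end

theory Submission
  imports Defs "HOL-Computational_Algebra.Formal_Power_Series"
begin

text \<open>
With G = w \<gamma> the transformation law divides by w and becomes J N = K, where K and the unit J depend
on the second jets of F and \<gamma>, K also on \<Phi>, and J not on \<zeta>. So N is determined by (F, \<gamma>), and it is a normal
form exactly when the defect E = K - J \<Phi>(z,0,\<zeta>) lies in the ideal (z^2 \<zeta>^2, \<zeta>^4). The w^k coefficient of E
equals its value on the truncation of (F, \<gamma>) below order k plus an operator linear in the w^k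
coefficients of F and \<gamma>; the \<zeta>^0 and \<zeta>^1 parts are second order ODEs in z that express these
coefficients through their Cauchy data, and the remaining four conditions are the linear system of
the non-resonance condition. This gives existence and uniqueness order by order in w.

For convergence, w^k coefficients are measured with a weight that is \<epsilon> below order k and \<epsilon>^2 at
order k. This weight is submultiplicative, so the defect of a truncation is bounded by a constant
independent of k and \<epsilon>, which means a gain of a factor \<epsilon> at order k. It beats the
norm of the inverse of the linear operator, which is bounded uniformly in k. The binomial
weights make z-derivatives and w d/dw cost the same, as in the Cauchy-Kovalevskaya theorem.
\<close>

text \<open>Two features make the scheme close up. J is a unit and the ideal is stable under
  multiplication by units, so the condition on N turns into one on E, in which N no longer occurs.
  And the law contains second derivatives in both variables, so a plain majorant argument would lose
  two derivatives at each order; the linear operator gives back exactly two, since its solution at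
  z^a w^k is smaller than the data by (a+k+1)^-2. This factor is built into the smallness condition
  on F - z and \<gamma> - 1. The weight \<epsilon>^2 is natural at order k because a product of two
  factors of positive order in w has it. The variable w itself, whose coefficient is not small, is
  made small by a large r. The constants are therefore chosen in this order: s, t and d from the
  radius \<rho> of \<Phi>; the bound for the defect from the majorant of \<Phi>, and the bound for
  the inverse operator from \<Phi> and s; then \<epsilon>; finally r of size \<epsilon>^-2. No bound
  made earlier may involve r.\<close>

section \<open>Series in w, zeta and z, and the transformation law\<close>

unbundle no vec_syntax and fps_syntax

text \<open>w is the outermost variable, then \<zeta>, then z: X $ b $ c $ a is the coefficient of
z^a w^b \<zeta>^c.\<close>

type_synonym ser3 = "complex fps fps fps"

definition ser :: "ps3 \<Rightarrow> ser3" where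
  "ser P = Abs_fps (\<lambda>b. Abs_fps (\<lambda>c. Abs_fps (\<lambda>a. P a b c)))"

lemma ser_nth [simp]: "ser P $ b $ c $ a = P a b c"
  by (simp add: ser_def)

lemma ser3_eqI: "(\<And>a b c. X $ b $ c $ a = Y $ b $ c $ a) \<Longrightarrow> X = (Y :: ser3)"
  by (simp add: fps_eq_iff)

lemma ser_surj: "ser (\<lambda>a b c. X $ b $ c $ a) = X"
  by (rule ser3_eqI) simp

lemma ser_inj: "ser P = ser Q \<longleftrightarrow> P = Q"
  by (auto simp: fps_eq_iff intro!: ext)

lemma ser3_mult_nth:
  "(X * Y :: ser3) $ b $ c $ a =
    (\<Sum>i\<le>a. \<Sum>j\<le>b. \<Sum>k\<le>c. X $ j $ k $ i * Y $ (b - j) $ (c - k) $ (a - i))"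
  (is "_ = ?rhs")
proof -
  have "(X * Y) $ b $ c $ a =
      (\<Sum>j\<le>b. \<Sum>k\<le>c. \<Sum>i\<le>a. X $ j $ k $ i * Y $ (b - j) $ (c - k) $ (a - i))"
    by (simp add: fps_mult_nth fps_sum_nth atLeast0AtMost)
  also have "\<dots> = (\<Sum>j\<le>b. \<Sum>i\<le>a. \<Sum>k\<le>c. X $ j $ k $ i * Y $ (b - j) $ (c - k) $ (a - i))"
    by (intro sum.cong refl sum.swap)
  also have "\<dots> = ?rhs" by (rule sum.swap)
  finally show ?thesis .
qed

lemma ser_mult: "ser (ps_mult P Q) = ser P * ser Q"
  by (rule ser3_eqI) (simp add: ps_mult_def ser3_mult_nth)

lemma ser_add: "ser (ps_add P Q) = ser P + ser Q"
  by (rule ser3_eqI) (simp add: ps_add_def)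

lemma ser_sub: "ser (ps_sub P Q) = ser P - ser Q"
  by (rule ser3_eqI) (simp add: ps_sub_def)

lemma ser_one: "ser ps_one = 1"
  by (rule ser3_eqI) (auto simp: ps_one_def fps_one_nth)

lemma ser_pow: "ser (ps_pow P n) = ser P ^ n"
  by (induction n) (simp_all add: ser_one ser_mult)

lemma ser_const_2: "ser (ps_const 2) = 2"
  unfolding fps_numeral_fps_const
  by (rule ser3_eqI) (auto simp: ps_const_def)

definition wv :: ser3 where "wv = fps_X"
definition zet :: ser3 where "zet = fps_const fps_X"

lemma ser_W: "ser ps_W = wv"
  by (rule ser3_eqI) (auto simp: ps_W_def wv_def fps_X_def fps_one_nth)

lemma ser_Zeta: "ser ps_Zeta = zet"
  by (rule ser3_eqI) (auto simp: ps_Zeta_def zet_def fps_X_def fps_one_nth)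

lemma wv_mult_nth: "(wv * X) $ b = (if b = 0 then 0 else X $ (b - 1))"
  by (simp add: wv_def)

lemma wv_nonzero: "wv \<noteq> 0"
  by (simp add: wv_def)

definition emb :: "ps2 \<Rightarrow> ser3" where "emb u = ser (lift u)"

lemma emb_nth: "emb u $ b $ c $ a = (if c = 0 then u a b else 0)"
  by (simp add: emb_def lift_def)

definition th :: "ps2 \<Rightarrow> ps2" where "th u = (\<lambda>a b. of_nat b * u a b)"

definition subst3 :: "ps3 \<Rightarrow> ser3 \<Rightarrow> ser3 \<Rightarrow> ser3 \<Rightarrow> ser3" where
  "subst3 P A B C = ser (\<lambda>a b c.
     (\<Sum>i\<le>a+b+c. \<Sum>j\<le>a+b+c-i. \<Sum>k\<le>a+b+c-i-j. P i j k * (A ^ i * B ^ j * C ^ k) $ b $ c $ a))"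

lemma ser_comp: "ser (ps_comp P A B C) = subst3 P (ser A) (ser B) (ser C)"
  unfolding subst3_def ps_comp_def
  by (simp flip: ser_pow ser_mult)

text \<open>The coefficients in w and in \<zeta> lie in power series rings, not in a field, so
  \<open>inverse\<close> is available only at the innermost level; right inverses are lifted from
  the constant term one variable at a time.\<close>

lemma ser3_unit:
  assumes "X $ 0 $ 0 $ 0 \<noteq> 0"
  obtains Y :: ser3 where "X * Y = 1"
proof -
  have "X $ 0 $ 0 * inverse (X $ 0 $ 0) = 1"
    using assms by (metis inverse_mult_eq_1')
  then have "X $ 0 * fps_right_inverse (X $ 0) (inverse (X $ 0 $ 0)) = 1"
    by (rule fps_right_inverse)
  then show ?thesis using that fps_right_inverse by blast
qed

definition inv3 :: "ser3 \<Rightarrow> ser3" where "inv3 X = (SOME Y. X * Y = 1)"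

lemma inv3: "X $ 0 $ 0 $ 0 \<noteq> 0 \<Longrightarrow> X * inv3 X = 1"
  unfolding inv3_def by (rule someI_ex) (metis ser3_unit)

text \<open>\<open>ps_div\<close> is a definite description. It denotes the quotient because the
  divisor is a unit in a domain, so the equation has exactly one solution.\<close>

lemma ser_div:
  assumes "Q 0 0 0 \<noteq> 0"
  shows "ser (ps_div P Q) = ser P * inv3 (ser Q)"
proof -
  have u: "ser Q * inv3 (ser Q) = 1" using assms by (intro inv3) simp
  let ?S = "\<lambda>a b c. (ser P * inv3 (ser Q)) $ b $ c $ a"
  have nz: "ser Q \<noteq> 0" using u by auto
  have "ps_mult S Q = P \<longleftrightarrow> S = ?S" for S
  proof -
    have "ps_mult S Q = P \<longleftrightarrow> ser S * ser Q = ser P"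
      by (simp flip: ser_inj add: ser_mult)
    also have "\<dots> \<longleftrightarrow> ser S * ser Q = ser P * inv3 (ser Q) * ser Q"
    proof -
      have "ser P * inv3 (ser Q) * ser Q = ser P * (ser Q * inv3 (ser Q))" by (simp only: ac_simps)
      then show ?thesis by (simp only: u mult_1_right)
    qed
    also have "\<dots> \<longleftrightarrow> ser S = ser P * inv3 (ser Q)" using nz by simp
    also have "\<dots> \<longleftrightarrow> S = ?S" by (metis ser_inj ser_surj)
    finally show ?thesis .
  qed
  then have "ps_div P Q = ?S" unfolding ps_div_def by simp
  then show ?thesis by (simp add: ser_surj)
qed

text \<open>With G = w \<gamma> every w-derivative occurs as w d/dw, so one factor w splits off:
  \<open>DF\<close> is the total derivative of F, w \<open>num\<close> that of G, and
  \<open>sig\<close> the new value of W'/W.\<close>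

definition DF :: "ps2 \<Rightarrow> ser3" where "DF F = emb (dz F) + zet * emb (th F)"
definition num :: "ps2 \<Rightarrow> ser3" where
  "num \<gamma> = emb (dz \<gamma>) + zet * (emb \<gamma> + emb (th \<gamma>))"
definition sig :: "ps2 \<Rightarrow> ps2 \<Rightarrow> ser3" where "sig F \<gamma> = num \<gamma> * inv3 (emb \<gamma> * DF F)"
text \<open>The Jacobian determinant F_z G_w - F_w G_z. It multiplies N in the transformation law;
  \<open>sec\<close> collects the second derivatives of F and G that remain.\<close>

definition jac :: "ps2 \<Rightarrow> ps2 \<Rightarrow> ser3" where
  "jac F \<gamma> = (emb \<gamma> + emb (th \<gamma>)) * emb (dz F) - emb (dz \<gamma>) * emb (th F)"
definition sec :: "ps2 \<Rightarrow> ps2 \<Rightarrow> ser3" where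
  "sec F \<gamma> =
    (emb (dz (dz \<gamma>)) + 2 * zet * (emb (th (dz \<gamma>)) + emb (dz \<gamma>))
      + zet^2 * (emb (th (th \<gamma>)) + emb (th \<gamma>))) * DF F
    - num \<gamma> * (emb (dz (dz F)) + 2 * zet * emb (th (dz F)) + zet^2 * (emb (th (th F)) - emb (th F)))"
definition pull :: "ps3 \<Rightarrow> ps2 \<Rightarrow> ps2 \<Rightarrow> ser3" where
  "pull \<Phi> F \<gamma> = DF F ^ 3 * emb \<gamma> * subst3 \<Phi> (emb F) (wv * emb \<gamma>) (sig F \<gamma>) - sec F \<gamma>"

lemmas ps2_ops = dz_def dw_def th_def

lemma zet_mult_nth: "(zet * X) $ b $ c = (if c = 0 then 0 else X $ b $ (c - 1))"
  by (simp add: zet_def)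

text \<open>Both sides carry a factor w, which is cancelled in a domain. In the coefficient of N the
  \<zeta>-terms cancel, which leaves \<open>jac\<close>.\<close>

lemma transforms_iff:
  assumes G0: "\<And>a. G a 0 = 0" and unit: "G 0 1 \<noteq> 0" "F 1 0 \<noteq> 0"
  shows "transforms N \<Phi> F G \<longleftrightarrow>
    jac F (\<lambda>a b. G a (Suc b)) * ser N = pull \<Phi> F (\<lambda>a b. G a (Suc b))"
proof -
  define \<gamma> where "\<gamma> = (\<lambda>a b. G a (Suc b))"
  have G: "G a b = (if b = 0 then 0 else \<gamma> a (b - 1))" for a b
    using G0 by (cases b) (auto simp: \<gamma>_def)
  note E = ser3_eqI emb_nth wv_mult_nth ps2_ops
  have f1: "wv * emb (dw F) = emb (th F)"
    by (rule ser3_eqI) (auto simp: E(2-))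
  have f2: "wv * (wv * emb (dw (dw F))) = emb (th (th F)) - emb (th F)"
  proof (rule ser3_eqI)
    fix a b c
    show "(wv * (wv * emb (dw (dw F)))) $ b $ c $ a = (emb (th (th F)) - emb (th F)) $ b $ c $ a"
    proof (cases b)
      case (Suc m)
      then show ?thesis
        by (simp add: emb_nth wv_mult_nth ps2_ops) (cases m; simp add: algebra_simps)
    qed (simp add: emb_nth wv_mult_nth ps2_ops del: fps_mult_nth_0)
  qed
  have f3: "wv * emb (dz (dw F)) = emb (th (dz F))"
    by (rule ser3_eqI) (auto simp: E(2-) algebra_simps)
  have g0: "emb G = wv * emb \<gamma>"
    by (rule ser3_eqI) (auto simp: E(2-) G)
  have g1: "emb (dw G) = emb \<gamma> + emb (th \<gamma>)"
    by (rule ser3_eqI) (auto simp: E(2-) G algebra_simps)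
  have g2: "emb (th (th \<gamma>)) = wv * emb (dw (dw G)) - emb (th \<gamma>)"
    by (rule ser3_eqI) (auto simp: E(2-) G algebra_simps)
  have g3: "emb (dz (dw G)) = emb (dz \<gamma>) + emb (th (dz \<gamma>))"
    by (rule ser3_eqI) (auto simp: E(2-) G algebra_simps)
  have g4: "emb (dz G) = wv * emb (dz \<gamma>)"
    by (rule ser3_eqI) (auto simp: E(2-) G)
  have g5: "emb (dz (dz G)) = wv * emb (dz (dz \<gamma>))"
    by (rule ser3_eqI) (auto simp: E(2-) G)
  define Gt where "Gt = (\<lambda>a b. G a (Suc b))"
  define p where "p = ps_mult ps_W ps_Zeta"
  define Psi where "Psi = ps_mult ps_W N"
  define DF' where "DF' = ps_add (lift (dz F)) (ps_mult p (lift (dw F)))"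
  define DG where "DG = ps_add (lift (dz G)) (ps_mult p (lift (dw G)))"
  define D2F where "D2F = ps_add (ps_add (ps_add (lift (dz (dz F)))
                  (ps_mult (ps_const 2) (ps_mult p (lift (dz (dw F))))))
                  (ps_mult (ps_mult p p) (lift (dw (dw F)))))
                  (ps_mult Psi (lift (dw F)))"
  define D2G where "D2G = ps_add (ps_add (ps_add (lift (dz (dz G)))
                  (ps_mult (ps_const 2) (ps_mult p (lift (dz (dw G))))))
                  (ps_mult (ps_mult p p) (lift (dw (dw G)))))
                  (ps_mult Psi (lift (dw G)))"
  define Q where "Q = ps_mult (lift Gt) DF'"
  define Ze where "Ze = ps_div (ps_add (lift (dz Gt)) (ps_mult ps_Zeta (lift (dw G)))) Q"
  note sers = ser_add ser_mult ser_W ser_Zeta ser_const_2 emb_def[symmetric] ser_sub ser_pow ser_comp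
  have Gt: "Gt = \<gamma>" by (simp add: Gt_def \<gamma>_def)
  have a1: "ser DF' = DF F"
    unfolding DF'_def p_def sers DF_def f1[symmetric] by (simp add: algebra_simps)
  have a2: "ser DG = wv * num \<gamma>"
    unfolding DG_def p_def sers num_def g1 g4 by (simp add: algebra_simps)
  have a3: "ser D2F = emb (dz (dz F)) + 2 * zet * emb (th (dz F))
      + zet^2 * (emb (th (th F)) - emb (th F)) + ser N * emb (th F)"
    unfolding D2F_def p_def Psi_def sers f2[symmetric] f3[symmetric]
    by (simp add: algebra_simps power2_eq_square flip: f1)
  have a4: "ser D2G = wv * (emb (dz (dz \<gamma>)) + 2 * zet * (emb (th (dz \<gamma>)) + emb (dz \<gamma>))
      + zet^2 * (emb (th (th \<gamma>)) + emb (th \<gamma>)) + ser N * (emb \<gamma> + emb (th \<gamma>)))"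
    unfolding D2G_def p_def Psi_def sers g5 g3 g1
    by (simp add: algebra_simps power2_eq_square g2)
  have a5: "ser Q = emb \<gamma> * DF F" unfolding Q_def sers a1 Gt ..
  \<comment> \<open>A non-zero constant term of the divisor is what gives \<open>ps_div\<close> its
    meaning.\<close>
  have "ser Q $ 0 $ 0 $ 0 = G 0 1 * F 1 0"
    unfolding a5 DF_def by (simp add: emb_nth zet_mult_nth ps2_ops \<gamma>_def)
  then have "Q 0 0 0 \<noteq> 0" using unit by simp
  then have a6: "ser Ze = sig F \<gamma>"
    unfolding Ze_def by (simp add: ser_div a5 sig_def sers g1 Gt num_def)
  have "transforms N \<Phi> F G \<longleftrightarrow> ps_sub (ps_mult D2G DF') (ps_mult DG D2F) =
        ps_mult (ps_mult (ps_pow DF' 3) (lift G)) (ps_comp \<Phi> (lift F) (lift G) Ze)"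
    unfolding transforms_def Let_def Ze_def Q_def Gt_def D2G_def D2F_def DG_def DF'_def Psi_def p_def ..
  also have "\<dots> \<longleftrightarrow> ser D2G * ser DF' - ser DG * ser D2F =
      ser DF' ^ 3 * emb G * subst3 \<Phi> (emb F) (emb G) (ser Ze)"
    by (simp flip: ser_inj add: sers)
  also have "\<dots> \<longleftrightarrow> wv * (sec F \<gamma> + jac F \<gamma> * ser N) =
      wv * (DF F ^ 3 * emb \<gamma> * subst3 \<Phi> (emb F) (wv * emb \<gamma>) (sig F \<gamma>))"
  proof -
    have "ser D2G * ser DF' - ser DG * ser D2F = wv * (sec F \<gamma> + jac F \<gamma> * ser N)"
      unfolding a1 a2 a3 a4 sec_def jac_def
      by (simp add: DF_def num_def algebra_simps)
    then show ?thesis unfolding a1 a6 g0 by (simp add: algebra_simps)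
  qed
  also have "\<dots> \<longleftrightarrow> jac F \<gamma> * ser N = pull \<Phi> F \<gamma>"
    unfolding mult_left_cancel[OF wv_nonzero] pull_def eq_diff_eq by (simp only: add.commute)
  finally show ?thesis unfolding \<gamma>_def .
qed

section \<open>First-order expansions in w\<close>

text \<open>x and y agree below order k in w, p is the difference of their w^k coefficients, and c is the
value of y at w = 0. For k > 0 the pair (p, c) of an expression is computed from those of its
arguments as a derivative and a value are.\<close>

definition tay :: "nat \<Rightarrow> ser3 \<Rightarrow> ser3 \<Rightarrow> complex fps fps \<Rightarrow> complex fps fps \<Rightarrow> bool" where
  "tay k x y p c \<longleftrightarrow> (\<exists>q. x = y + fps_X ^ k * q \<and> q $ 0 = p \<and> y $ 0 = c)"

lemma tay_I:
  assumes "\<And>j. j < k \<Longrightarrow> x $ j = y $ j" "x $ k = y $ k + p" "y $ 0 = c"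
  shows "tay k x y p c"
  unfolding tay_def
proof (intro exI conjI)
  show "x = y + fps_X ^ k * fps_shift k (x - y)"
    using assms(1) by (auto simp: fps_eq_iff fps_X_power_mult_nth)
qed (use assms in auto)

lemma tay_nth: "tay k x y p c \<Longrightarrow> x $ k = y $ k + p"
  by (auto simp: tay_def fps_X_power_mult_nth)

lemma tay_nth_less: "tay k x y p c \<Longrightarrow> j < k \<Longrightarrow> x $ j = y $ j"
  by (auto simp: tay_def fps_X_power_mult_nth)

lemma tay_0: "tay k x y p c \<Longrightarrow> y $ 0 = c"
  by (auto simp: tay_def)

lemma tay_cong: "tay k x y p c \<Longrightarrow> p = p' \<Longrightarrow> c = c' \<Longrightarrow> tay k x y p' c'"
  by simp

lemma tay_refl: "tay k x x 0 (x $ 0)"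
  by (auto simp: tay_def intro!: exI[of _ 0])

lemma tay_add: "tay k x y p c \<Longrightarrow> tay k x' y' p' c' \<Longrightarrow> tay k (x + x') (y + y') (p + p') (c + c')"
  unfolding tay_def
  apply clarify
  subgoal for q q' by (rule exI[of _ "q + q'"]) (simp add: algebra_simps)
  done

lemma tay_diff: "tay k x y p c \<Longrightarrow> tay k x' y' p' c' \<Longrightarrow> tay k (x - x') (y - y') (p - p') (c - c')"
  unfolding tay_def
  apply clarify
  subgoal for q q' by (rule exI[of _ "q - q'"]) (simp add: algebra_simps)
  done

lemma tay_mult:
  assumes "0 < k" "tay k x y p c" "tay k x' y' p' c'"
  shows "tay k (x * x') (y * y') (p * c' + c * p') (c * c')"
proof -
  from assms obtain q q' where *: "x = y + fps_X ^ k * q" "q $ 0 = p" "y $ 0 = c"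
    "x' = y' + fps_X ^ k * q'" "q' $ 0 = p'" "y' $ 0 = c'"
    by (auto simp: tay_def)
  have "x * x' = y * y' + fps_X ^ k * (q * y' + y * q' + fps_X ^ k * (q * q'))"
    by (simp add: *(1,4) algebra_simps)
  moreover have "(q * y' + y * q' + fps_X ^ k * (q * q')) $ 0 = p * c' + c * p'"
    using * assms(1) by (simp add: fps_X_power_mult_nth)
  ultimately show ?thesis using * unfolding tay_def by (metis fps_mult_nth_0)
qed

lemma tay_power:
  assumes "0 < k" "tay k x y p c"
  shows "tay k (x ^ n) (y ^ n) (of_nat n * c ^ (n - 1) * p) (c ^ n)"
proof (induction n)
  case 0
  show ?case using tay_refl[of k 1] by simp
next
  case (Suc n)
  show ?case
    unfolding power_Suc[of x] power_Suc[of y]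
    using tay_mult[OF assms(1) assms(2) Suc.IH]
    by (rule tay_cong) (cases n; simp add: algebra_simps)+
qed

text \<open>The derivative of 1/x at x = 1. The value 1 is the relevant one, since the denominators
  are expanded around the identity map.\<close>

lemma tay_inv:
  assumes "0 < k" "tay k x y p 1"
  shows "tay k (inv3 x) (inv3 y) (- p) 1"
proof -
  from assms obtain q where q: "x = y + fps_X ^ k * q" "q $ 0 = p" "y $ 0 = 1"
    by (auto simp: tay_def)
  have x0: "x $ 0 = 1" using q assms(1) by (simp add: fps_X_power_mult_nth)
  have u: "x * inv3 x = 1" by (rule inv3) (simp add: x0)
  have v: "y * inv3 y = 1" by (rule inv3) (simp add: q(3))
  have "inv3 x $ 0 = 1" "inv3 y $ 0 = 1"
    using arg_cong[OF u, of "\<lambda>s. s $ 0"] arg_cong[OF v, of "\<lambda>s. s $ 0"] x0 q(3) by simp_all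
  moreover have "inv3 x = inv3 y + fps_X ^ k * (- q * inv3 x * inv3 y)"
  proof -
    have "inv3 x = inv3 x * (y * inv3 y)" by (simp add: v)
    also have "\<dots> = inv3 x * inv3 y * (x - fps_X ^ k * q)" by (simp add: q(1) algebra_simps)
    also have "\<dots> = (x * inv3 x) * inv3 y + fps_X ^ k * (- q * inv3 x * inv3 y)"
      by (simp add: algebra_simps)
    finally show ?thesis by (simp add: u)
  qed
  ultimately show ?thesis unfolding tay_def
    by (intro exI[of _ "- q * inv3 x * inv3 y"]) (simp add: q)
qed

lemma tay_zet: "tay k zet zet 0 fps_X"
  using tay_refl[of k zet] by (simp add: zet_def)

lemma tay_numeral: "tay k (numeral n) (numeral n) 0 (numeral n)"
  using tay_refl[of k "numeral n"] by (simp add: fps_numeral_nth)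

text \<open>The factor w pushes a difference of order k to order k + 1. Hence the dependence of
  \<Phi> on w never enters the linearization.\<close>

lemma tay_wv_mult: "0 < k \<Longrightarrow> tay k x y p c \<Longrightarrow> tay k (wv * x) (wv * y) 0 0"
  by (rule tay_I) (auto simp: wv_mult_nth tay_nth_less simp del: fps_mult_nth_0)

section \<open>Jets of series in z and w at a given order in w\<close>

definition col :: "ps2 \<Rightarrow> nat \<Rightarrow> complex fps" where "col u b = Abs_fps (\<lambda>a. u a b)"

lemma col_nth [simp]: "col u b $ a = u a b"
  by (simp add: col_def)

definition jet :: "nat \<Rightarrow> ps2 \<Rightarrow> ps2 \<Rightarrow> complex fps \<Rightarrow> complex fps \<Rightarrow> bool" where
  "jet k u v p c \<longleftrightarrow> (\<forall>j<k. col u j = col v j) \<and> col u k = col v k + p \<and> col v 0 = c"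

lemma col_dz: "col (dz u) b = fps_deriv (col u b)"
  by (simp add: fps_eq_iff dz_def)

lemma col_th: "col (th u) b = of_nat b * col u b"
  by (simp add: fps_eq_iff th_def fps_of_nat[symmetric] del: fps_of_nat)

lemma jet_dz: "jet k u v p c \<Longrightarrow> jet k (dz u) (dz v) (fps_deriv p) (fps_deriv c)"
  by (simp add: jet_def col_dz)

lemma jet_th: "jet k u v p c \<Longrightarrow> jet k (th u) (th v) (of_nat k * p) 0"
  by (simp add: jet_def col_th algebra_simps)

lemma emb_nth_col: "emb u $ b = fps_const (col u b)"
  by (simp add: fps_eq_iff emb_nth)

lemma tay_emb: "jet k u v p c \<Longrightarrow> tay k (emb u) (emb v) (fps_const p) (fps_const c)"
  by (intro tay_I) (auto simp: jet_def emb_nth_col)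

section \<open>Total order, and the chain rule for substitution\<close>

definition ord3 :: "nat \<Rightarrow> ser3 \<Rightarrow> bool" where
  "ord3 n X \<longleftrightarrow> (\<forall>a b c. a + b + c < n \<longrightarrow> X $ b $ c $ a = 0)"

lemma ord3_mult: "ord3 m X \<Longrightarrow> ord3 n Y \<Longrightarrow> ord3 (m + n) (X * Y)"
  unfolding ord3_def
proof (intro allI impI)
  fix a b c assume X: "\<forall>a b c. a + b + c < m \<longrightarrow> X $ b $ c $ a = 0"
    and Y: "\<forall>a b c. a + b + c < n \<longrightarrow> Y $ b $ c $ a = 0" and l: "a + b + c < m + n"
  have "X $ j $ k $ i * Y $ (b - j) $ (c - k) $ (a - i) = 0" if "i \<le> a" "j \<le> b" "k \<le> c" for i j k
  proof -
    have "i + j + k < m \<or> (a - i) + (b - j) + (c - k) < n" using that l by linarith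
    then show ?thesis using X Y by auto
  qed
  then show "(X * Y) $ b $ c $ a = 0" unfolding ser3_mult_nth by (intro sum.neutral ballI) auto
qed

lemma ord3_power: "X $ 0 $ 0 $ 0 = 0 \<Longrightarrow> ord3 n (X ^ n)"
proof (induction n)
  case (Suc n)
  have "ord3 1 X" using Suc.prems by (simp add: ord3_def)
  from ord3_mult[OF this Suc.IH[OF Suc.prems]] show ?case by simp
qed (simp add: ord3_def)

lemma sum_atMost_extend:
  assumes "m \<le> (n :: nat)" "\<And>k. m < k \<Longrightarrow> t k = (0 :: 'a :: comm_monoid_add)"
  shows "sum t {..m} = sum t {..n}"
  using assms by (intro sum.mono_neutral_left) (auto simp: not_le[symmetric])

text \<open>A term with i + j + k beyond the total degree vanishes by \<open>ord3_power\<close>, so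
  the sum may run over any large enough cube. Two substitutions can then be compared over the same
  indices.\<close>

lemma subst3_trunc:
  assumes z: "A $ 0 $ 0 $ 0 = 0" "B $ 0 $ 0 $ 0 = 0" "C $ 0 $ 0 $ 0 = 0" and n: "a + b + c \<le> n"
  shows "subst3 P A B C $ b $ c $ a =
    (\<Sum>i\<le>n. \<Sum>j\<le>n. \<Sum>k\<le>n. P i j k * (A ^ i * B ^ j * C ^ k) $ b $ c $ a)"
proof -
  define t where "t i j k = P i j k * (A ^ i * B ^ j * C ^ k) $ b $ c $ a" for i j k
  have "ord3 (i + j + k) (A ^ i * B ^ j * C ^ k)" for i j k
    by (intro ord3_mult ord3_power z)
  then have t0: "t i j k = 0" if "a + b + c < i + j + k" for i j k
    using that by (simp add: t_def ord3_def)
  have "subst3 P A B C $ b $ c $ a = (\<Sum>i\<le>a+b+c. \<Sum>j\<le>a+b+c-i. \<Sum>k\<le>a+b+c-i-j. t i j k)"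
    by (simp add: subst3_def t_def)
  also have "\<dots> = (\<Sum>i\<le>a+b+c. \<Sum>j\<le>a+b+c-i. \<Sum>k\<le>n. t i j k)"
    by (intro sum.cong refl sum_atMost_extend t0) (use n in auto)
  also have "\<dots> = (\<Sum>i\<le>a+b+c. \<Sum>j\<le>n. \<Sum>k\<le>n. t i j k)"
    by (intro sum.cong refl sum_atMost_extend sum.neutral ballI t0) (use n in auto)
  also have "\<dots> = (\<Sum>i\<le>n. \<Sum>j\<le>n. \<Sum>k\<le>n. t i j k)"
    by (intro sum_atMost_extend sum.neutral ballI t0) (use n in auto)
  finally show ?thesis by (simp add: t_def)
qed

definition restr :: "ps3 \<Rightarrow> complex fps fps" where
  "restr P = Abs_fps (\<lambda>c. Abs_fps (\<lambda>a. P a 0 c))"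
definition restr_z :: "ps3 \<Rightarrow> complex fps fps" where
  "restr_z P = Abs_fps (\<lambda>c. Abs_fps (\<lambda>a. of_nat (Suc a) * P (Suc a) 0 c))"

lemma restr_nth [simp]: "restr P $ c $ a = P a 0 c"
  by (simp add: restr_def)

lemma restr_z_nth: "restr_z P $ c = fps_deriv (restr P $ c)"
  by (simp add: restr_z_def fps_eq_iff)

abbreviation zv2 :: "complex fps fps" where "zv2 \<equiv> fps_const fps_X"

lemma mono2_mult_nth:
  "(zv2 ^ i * fps_X ^ l * p) $ c $ a = (if l \<le> c \<and> i \<le> a then p $ (c - l) $ (a - i) else 0)"
  by (simp add: mult.assoc fps_const_power fps_X_power_mult_nth)

text \<open>This turns the monomial sums produced by a substitution back into products; monomials
  beyond the exponents a and c do not reach the coefficient.\<close>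

lemma fps2_mult_expand:
  fixes p :: "complex fps fps"
  assumes "a \<le> m" "c \<le> n"
  shows "(\<Sum>i\<le>m. \<Sum>l\<le>n. G $ l $ i * (zv2 ^ i * fps_X ^ l * p) $ c $ a) = (G * p) $ c $ a"
proof -
  have "(\<Sum>i\<le>m. \<Sum>l\<le>n. G $ l $ i * (zv2 ^ i * fps_X ^ l * p) $ c $ a) =
      (\<Sum>i\<le>m. \<Sum>l\<le>c. G $ l $ i * (zv2 ^ i * fps_X ^ l * p) $ c $ a)"
    by (rule sum.cong[OF refl], rule sum_atMost_extend[symmetric]) (use assms in \<open>auto simp: mono2_mult_nth simp del: fps_const_power\<close>)
  also have "\<dots> = (\<Sum>i\<le>a. \<Sum>l\<le>c. G $ l $ i * (zv2 ^ i * fps_X ^ l * p) $ c $ a)"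
    by (intro sum_atMost_extend[symmetric]) (use assms in \<open>auto simp: mono2_mult_nth simp del: fps_const_power\<close>)
  also have "\<dots> = (\<Sum>l\<le>c. \<Sum>i\<le>a. G $ l $ i * p $ (c - l) $ (a - i))"
    by (subst sum.swap) (simp add: mono2_mult_nth del: fps_const_power)
  also have "\<dots> = (G * p) $ c $ a"
    by (simp add: fps_mult_nth fps_sum_nth atLeast0AtMost)
  finally show ?thesis .
qed

text \<open>The chain rule at order k. At w = 0 the three arguments are z, 0 and \<zeta>, and the
  second one does not vary at order k, so only monomials of P with j = 0 contribute.\<close>

lemma tay_subst3:
  assumes k: "0 < k" and A: "tay k A A' p zv2" and B: "tay k B B' 0 0" and C: "tay k C C' q fps_X"
  shows "tay k (subst3 P A B C) (subst3 P A' B' C')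
           (restr_z P * p + fps_deriv (restr P) * q) (restr P)"
proof -
  \<comment> \<open>\<open>M\<close> is the order k difference of the monomial A^i B^j C^l, and
    \<open>M0\<close> its value at w = 0.\<close>
  define M where "M i j l = (if j = 0 then of_nat i * zv2 ^ (i - 1) * p * fps_X ^ l
      + zv2 ^ i * (of_nat l * fps_X ^ (l - 1) * q) else 0)" for i j l :: nat
  define M0 where "M0 i j l = (if j = 0 then zv2 ^ i * fps_X ^ l else 0)" for i j l :: nat
  have T: "tay k (A ^ i * B ^ j * C ^ l) (A' ^ i * B' ^ j * C' ^ l) (M i j l) (M0 i j l)" for i j l
    using tay_mult[OF k tay_mult[OF k tay_power[OF k A] tay_power[OF k B]] tay_power[OF k C]]
    by (rule tay_cong) (auto simp: M_def M0_def algebra_simps power_0_left)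
  have 0: "A' $ 0 = zv2" "B' $ 0 = 0" "C' $ 0 = fps_X" using A B C tay_0 by blast+
  have A0: "A $ 0 = zv2" "B $ 0 = 0" "C $ 0 = fps_X"
    using tay_nth_less[OF A k] tay_nth_less[OF B k] tay_nth_less[OF C k] 0 by auto
  have z: "A $ 0 $ 0 $ 0 = 0" "B $ 0 $ 0 $ 0 = 0" "C $ 0 $ 0 $ 0 = 0" "A' $ 0 $ 0 $ 0 = 0" "B' $ 0 $ 0 $ 0 = 0" "C' $ 0 $ 0 $ 0 = 0"
    by (simp_all add: 0 A0)
  have j0: "(\<Sum>j\<le>N. \<Sum>l\<le>N. P i j l * t j l) = (\<Sum>l\<le>N. P i 0 l * t 0 l)"
    if "\<And>j l. j \<noteq> 0 \<Longrightarrow> t j l = 0" for N i and t :: "nat \<Rightarrow> nat \<Rightarrow> complex"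
    by (subst sum_atMost_extend[of 0 N, symmetric]) (auto simp: that)
  show ?thesis
  proof (rule tay_I)
    fix b assume b: "b < k"
    show "subst3 P A B C $ b = subst3 P A' B' C' $ b"
      unfolding fps_eq_iff
      by (intro allI) (simp add: subst3_trunc[OF z(1-3) order_refl] subst3_trunc[OF z(4-6) order_refl]
          tay_nth_less[OF T b])
  next
    show "subst3 P A' B' C' $ 0 = restr P"
      unfolding fps_eq_iff
    proof (intro allI)
      fix c a
      have "subst3 P A' B' C' $ 0 $ c $ a = (\<Sum>i\<le>a+c. \<Sum>l\<le>a+c. restr P $ l $ i * (zv2 ^ i * fps_X ^ l * 1) $ c $ a)"
      proof -
        have "subst3 P A' B' C' $ 0 $ c $ a = (\<Sum>i\<le>a+c. \<Sum>j\<le>a+c. \<Sum>l\<le>a+c. P i j l * M0 i j l $ c $ a)"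
          by (simp add: subst3_trunc[OF z(4-6), of _ _ _ "a + c"] tay_0[OF T] del: fps_mult_nth_0)
        also have "\<dots> = (\<Sum>i\<le>a+c. \<Sum>l\<le>a+c. P i 0 l * M0 i 0 l $ c $ a)"
          by (intro sum.cong refl j0) (simp add: M0_def)
        finally show ?thesis by (simp add: M0_def)
      qed
      then show "subst3 P A' B' C' $ 0 $ c $ a = restr P $ c $ a"
        by (subst (asm) fps2_mult_expand) auto
    qed
  next
    show "subst3 P A B C $ k = subst3 P A' B' C' $ k + (restr_z P * p + fps_deriv (restr P) * q)"
      unfolding fps_eq_iff
    proof (intro allI)
      fix c a
      \<comment> \<open>One more than the degree a + k + c: differentiation lowers an index by one,
        and the shifted sum must still reach a and c.\<close>
      define N where "N = Suc (a + k + c)"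
      define n where "n = a + k + c"
      have Nn: "N = Suc n" by (simp add: N_def n_def)
      have "subst3 P A B C $ k $ c $ a - subst3 P A' B' C' $ k $ c $ a =
          (\<Sum>i\<le>N. \<Sum>j\<le>N. \<Sum>l\<le>N. P i j l * M i j l $ c $ a)"
        by (simp add: subst3_trunc[OF z(1-3), of _ _ _ N] subst3_trunc[OF z(4-6), of _ _ _ N] N_def
            tay_nth[OF T] sum_subtractf[symmetric] right_diff_distrib[symmetric] del: sum.atMost_Suc)
      also have "\<dots> = (\<Sum>i\<le>N. \<Sum>l\<le>N. P i 0 l * M i 0 l $ c $ a)"
        by (intro sum.cong refl j0) (simp add: M_def)
      also have "\<dots> = (\<Sum>i\<le>N. \<Sum>l\<le>N. P i 0 l * (of_nat i * (zv2 ^ (i - 1) * fps_X ^ l * p) $ c $ a)) +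
          (\<Sum>i\<le>N. \<Sum>l\<le>N. P i 0 l * (of_nat l * (zv2 ^ i * fps_X ^ (l - 1) * q) $ c $ a))"
      proof -
        have n1: "(of_nat m * X) $ c $ a = of_nat m * X $ c $ a" for m and X :: "complex fps fps"
          by (simp flip: fps_of_nat)
        have "M i 0 l = of_nat i * (zv2 ^ (i - 1) * fps_X ^ l * p) + of_nat l * (zv2 ^ i * fps_X ^ (l - 1) * q)" for i l
          by (simp add: M_def algebra_simps)
        then show ?thesis by (simp only: n1 fps_add_nth distrib_left sum.distrib)
      qed
      also have "(\<Sum>i\<le>N. \<Sum>l\<le>N. P i 0 l * (of_nat i * (zv2 ^ (i - 1) * fps_X ^ l * p) $ c $ a)) =
          (\<Sum>i\<le>n. \<Sum>l\<le>N. restr_z P $ l $ i * (zv2 ^ i * fps_X ^ l * p) $ c $ a)"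
        unfolding Nn by (subst sum.atMost_Suc_shift) (simp add: restr_z_nth algebra_simps del: sum.atMost_Suc)
      also have "\<dots> = (restr_z P * p) $ c $ a"
        by (rule fps2_mult_expand) (simp_all add: N_def n_def)
      also have "(\<Sum>i\<le>N. \<Sum>l\<le>N. P i 0 l * (of_nat l * (zv2 ^ i * fps_X ^ (l - 1) * q) $ c $ a)) =
          (\<Sum>i\<le>N. \<Sum>l\<le>n. fps_deriv (restr P) $ l $ i * (zv2 ^ i * fps_X ^ l * q) $ c $ a)"
      proof (rule sum.cong[OF refl])
        fix i
        show "(\<Sum>l\<le>N. P i 0 l * (of_nat l * (zv2 ^ i * fps_X ^ (l - 1) * q) $ c $ a)) =
          (\<Sum>l\<le>n. fps_deriv (restr P) $ l $ i * (zv2 ^ i * fps_X ^ l * q) $ c $ a)"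
          unfolding Nn by (subst sum.atMost_Suc_shift) (simp flip: fps_of_nat add: algebra_simps del: sum.atMost_Suc)
      qed
      also have "\<dots> = (fps_deriv (restr P) * q) $ c $ a"
        by (rule fps2_mult_expand) (simp_all add: N_def n_def)
      finally show "subst3 P A B C $ k $ c $ a =
          (subst3 P A' B' C' $ k + (restr_z P * p + fps_deriv (restr P) * q)) $ c $ a"
        by (simp add: algebra_simps)
    qed
  qed
qed

section \<open>The defect and its linearization\<close>

definition defect :: "ps3 \<Rightarrow> ps2 \<Rightarrow> ps2 \<Rightarrow> ser3" where
  "defect \<Phi> F \<gamma> = pull \<Phi> F \<gamma> - jac F \<gamma> * fps_const (restr \<Phi>)"

text \<open>The variation at the identity, where w d/dw acts as the factor K on w^k coefficients and
  \<open>Z\<close> stands for \<zeta>. The factor of \<open>restr\<close> is the variation of DF^3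
  \<gamma> minus that of \<open>jac\<close>; the next two terms are the chain rule for \<Phi>, with
  the variation of \<open>sig\<close> in parentheses; the last bracket is the variation of
  \<open>sec\<close>.\<close>

definition lin_defect :: "ps3 \<Rightarrow> nat \<Rightarrow> complex fps \<Rightarrow> complex fps \<Rightarrow> complex fps fps" where
  "lin_defect \<Phi> k f g =
    (let f0 = fps_const f; f1 = fps_const (fps_deriv f); f2 = fps_const (fps_deriv (fps_deriv f));
         g0 = fps_const g; g1 = fps_const (fps_deriv g); g2 = fps_const (fps_deriv (fps_deriv g));
         Z = fps_X; K = of_nat k
     in (2 * f1 - K * g0 + 3 * Z * K * f0) * restr \<Phi> + restr_z \<Phi> * f0
        + fps_deriv (restr \<Phi>) * (g1 + Z * (K * g0 - f1) - Z\<^sup>2 * K * f0)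
        - (g2 + 2 * Z * (K * g1 + g1) - Z * f2 + Z\<^sup>2 * (K\<^sup>2 * g0 + K * g0 - 2 * K * f1)
           - Z ^ 3 * (K\<^sup>2 * f0 - K * f0)))"

text \<open>The jets fix the map at w = 0 to be the identity. All coefficients of the linearization
  are computed there and so do not depend on F and \<gamma>.\<close>

lemma tay_defect:
  assumes k: "0 < k" and F: "jet k F' F f fps_X" and \<gamma>: "jet k \<gamma>' \<gamma> g 1"
  shows "tay k (pull \<Phi> F' \<gamma>') (pull \<Phi> F \<gamma>) (lin_defect \<Phi> k f g + fps_const (g + of_nat k * g + fps_deriv f) * restr \<Phi>) (restr \<Phi>)"
    and "tay k (jac F' \<gamma>') (jac F \<gamma>) (fps_const (g + of_nat k * g + fps_deriv f)) 1"
    and "tay k (defect \<Phi> F' \<gamma>') (defect \<Phi> F \<gamma>) (lin_defect \<Phi> k f g) 0"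
proof -
  note M = tay_mult[OF k]
  have J': "jet k (dz F') (dz F) (fps_deriv f) 1" "jet k (dz \<gamma>') (dz \<gamma>) (fps_deriv g) 0"
    using jet_dz[OF F] jet_dz[OF \<gamma>] by auto
  have J'': "jet k (dz (dz F')) (dz (dz F)) (fps_deriv (fps_deriv f)) 0"
      "jet k (dz (dz \<gamma>')) (dz (dz \<gamma>)) (fps_deriv (fps_deriv g)) 0"
    using jet_dz[OF J'(1)] jet_dz[OF J'(2)] by auto
  note tF = tay_emb[OF F] and tg = tay_emb[OF \<gamma>] and tF1 = tay_emb[OF J'(1)] and tg1 = tay_emb[OF J'(2)]
    and tF2 = tay_emb[OF J''(1)] and tg2 = tay_emb[OF J''(2)]
    and thF = tay_emb[OF jet_th[OF F]] and thg = tay_emb[OF jet_th[OF \<gamma>]]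
    and thF1 = tay_emb[OF jet_th[OF J'(1)]] and thg1 = tay_emb[OF jet_th[OF J'(2)]]
    and thF2 = tay_emb[OF jet_th[OF jet_th[OF F]]] and thg2 = tay_emb[OF jet_th[OF jet_th[OF \<gamma>]]]
  define f0 where "f0 = fps_const f"
  define f1 where "f1 = fps_const (fps_deriv f)"
  define f2 where "f2 = fps_const (fps_deriv (fps_deriv f))"
  define g0 where "g0 = fps_const g"
  define g1 where "g1 = fps_const (fps_deriv g)"
  define g2 where "g2 = fps_const (fps_deriv (fps_deriv g))"
  define Z :: "complex fps fps" where "Z = fps_X"
  define K :: "complex fps fps" where "K = of_nat k"
  have cK: "fps_const (of_nat k * h) = K * fps_const h" for h
    by (simp add: K_def flip: fps_of_nat fps_const_mult)
  note S = f0_def[symmetric] f1_def[symmetric] f2_def[symmetric] g0_def[symmetric]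
    g1_def[symmetric] g2_def[symmetric] Z_def[symmetric] cK fps_const_0_eq_0 fps_const_1_eq_1
  note T = tF tg tF1 tg1 tF2 tg2 thF thg thF1 thg1 thF2 thg2
  note T' = T[unfolded S] and z = tay_zet[of k, unfolded S]
  have DF: "tay k (DF F') (DF F) (f1 + Z * (K * f0)) 1"
    unfolding DF_def
    by (rule tay_cong[OF tay_add[OF T'(3) M[OF z T'(7)]]]) simp_all
  have num: "tay k (num \<gamma>') (num \<gamma>) (g1 + Z * (g0 + K * g0)) Z"
    unfolding num_def
    by (rule tay_cong[OF tay_add[OF T'(4) M[OF z tay_add[OF T'(2) T'(8)]]]]) simp_all
  have i: "tay k (inv3 (emb \<gamma>' * DF F')) (inv3 (emb \<gamma> * DF F)) (- (g0 + f1 + Z * (K * f0))) 1"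
    by (rule tay_inv[OF k], rule tay_cong[OF M[OF T'(2) DF]]) simp_all
  have s: "tay k (sig F' \<gamma>') (sig F \<gamma>) (g1 + Z * (K * g0 - f1) - Z\<^sup>2 * K * f0) Z"
    unfolding sig_def
    by (rule tay_cong[OF M[OF num i]]) (simp_all add: algebra_simps power2_eq_square)
  have su: "tay k (subst3 \<Phi> (emb F') (wv * emb \<gamma>') (sig F' \<gamma>')) (subst3 \<Phi> (emb F) (wv * emb \<gamma>) (sig F \<gamma>))
     (restr_z \<Phi> * f0 + fps_deriv (restr \<Phi>) * (g1 + Z * (K * g0 - f1) - Z\<^sup>2 * K * f0)) (restr \<Phi>)"
    by (rule tay_subst3[OF k T(1)[unfolded f0_def[symmetric]] tay_wv_mult[OF k T(2)] s[unfolded Z_def], folded Z_def])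
  have two: "tay k 2 2 0 2" by (rule tay_numeral)
  have z2: "tay k (zet^2) (zet^2) 0 (Z^2)"
    by (rule tay_cong[OF tay_power[OF k z]]) simp_all
  have se: "tay k (sec F' \<gamma>') (sec F \<gamma>)
    (g2 + 2 * Z * (K * g1 + g1) - Z * f2 + Z\<^sup>2 * (K\<^sup>2 * g0 + K * g0 - 2 * K * f1)
           - Z ^ 3 * (K\<^sup>2 * f0 - K * f0)) 0"
    unfolding sec_def
    by (rule tay_cong[OF tay_diff[OF M[OF tay_add[OF tay_add[OF T'(6) M[OF M[OF two z] tay_add[OF T'(10) T'(4)]]]
            M[OF z2 tay_add[OF T'(12) T'(8)]]] DF]
          M[OF num tay_add[OF tay_add[OF T'(5) M[OF M[OF two z] T'(9)]] M[OF z2 tay_diff[OF T'(11) T'(7)]]]]]])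
      (simp_all add: algebra_simps power2_eq_square power3_eq_cube)
  have jac: "tay k (jac F' \<gamma>') (jac F \<gamma>) (g0 + K * g0 + f1) 1"
    unfolding jac_def
    by (rule tay_cong[OF tay_diff[OF M[OF tay_add[OF T'(2) T'(8)] T'(3)] M[OF T'(4) T'(7)]]]) simp_all
  have J0: "fps_const (g + of_nat k * g + fps_deriv f) = g0 + K * g0 + f1"
    unfolding g0_def f1_def by (simp add: cK[symmetric])
  have DF3: "tay k (DF F' ^ 3) (DF F ^ 3) (3 * (f1 + Z * (K * f0))) 1"
    by (rule tay_cong[OF tay_power[OF k DF]]) simp_all
  show pull: "tay k (pull \<Phi> F' \<gamma>') (pull \<Phi> F \<gamma>) (lin_defect \<Phi> k f g + fps_const (g + of_nat k * g + fps_deriv f) * restr \<Phi>) (restr \<Phi>)"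
    unfolding pull_def J0
    by (rule tay_cong[OF tay_diff[OF M[OF M[OF DF3 T'(2)] su] se]])
      (simp_all add: lin_defect_def Let_def S K_def[symmetric] algebra_simps)
  show jac': "tay k (jac F' \<gamma>') (jac F \<gamma>) (fps_const (g + of_nat k * g + fps_deriv f)) 1"
    using jac by (simp add: J0)
  show "tay k (defect \<Phi> F' \<gamma>') (defect \<Phi> F \<gamma>) (lin_defect \<Phi> k f g) 0"
    unfolding defect_def
    by (rule tay_cong[OF tay_diff[OF pull M[OF jac' tay_refl]]]) simp_all
qed

section \<open>The linearized equations\<close>

lemma in_E1_restr: "in_E1 \<Phi> \<Longrightarrow> c < 2 \<Longrightarrow> restr \<Phi> $ c = 0"
  by (simp add: in_E1_def fps_eq_iff)

text \<open>\<Phi> starts with \<zeta>^2, hence up to \<zeta>^3 only A, B and C enter, C through the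
  derivative in \<zeta>, which lowers the degree.\<close>

lemma lin_defect_nth:
  fixes f g :: "complex fps" and k :: nat
  assumes "in_E1 \<Phi>"
  defines "A \<equiv> restr \<Phi> $ 2" and "B \<equiv> restr \<Phi> $ 3" and "C \<equiv> restr \<Phi> $ 4"
  defines "K \<equiv> fps_const (of_nat k) :: complex fps"
  defines "f1 \<equiv> fps_deriv f" and "g1 \<equiv> fps_deriv g"
  shows "lin_defect \<Phi> k f g $ 0 = - fps_deriv g1"
    and "lin_defect \<Phi> k f g $ 1 = 2 * A * g1 - 2 * (K + 1) * g1 + fps_deriv f1"
    and "lin_defect \<Phi> k f g $ 2 = K * A * g + fps_deriv A * f + 3 * B * g1 - (K\<^sup>2 + K) * g + 2 * K * f1"
    and "lin_defect \<Phi> k f g $ 3 = 2 * K * B * g - B * f1 + K * A * f + fps_deriv B * f + 4 * C * g1 + (K\<^sup>2 - K) * f"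
proof -
  have r0: "restr \<Phi> $ 0 = 0" "restr \<Phi> $ Suc 0 = 0" using in_E1_restr[OF assms(1)] by auto
  have R: "restr \<Phi> $ Suc (Suc 0) = A" "restr \<Phi> $ Suc (Suc (Suc 0)) = B"
    "restr \<Phi> $ Suc (Suc (Suc (Suc 0))) = C"
    by (simp_all add: A_def B_def C_def eval_nat_numeral)
  define f0 where "f0 = fps_const f"
  define F1 where "F1 = fps_const f1"
  define F2 where "F2 = fps_const (fps_deriv f1)"
  define g0 where "g0 = fps_const g"
  define G1 where "G1 = fps_const g1"
  define G2 where "G2 = fps_const (fps_deriv g1)"
  define KK where "KK = fps_const K"
  define KK2 where "KK2 = fps_const (K\<^sup>2)"
  have K: "of_nat k = KK" by (simp add: KK_def K_def flip: fps_of_nat)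
  have K2: "KK\<^sup>2 = KK2" by (simp add: KK2_def KK_def)
  let ?R = "restr \<Phi>" and ?D = "fps_deriv (restr \<Phi>)"
  have *: "lin_defect \<Phi> k f g =
     2 * F1 * ?R - KK * g0 * ?R + 3 * fps_X * (KK * f0 * ?R) + f0 * restr_z \<Phi>
     + (G1 * ?D + fps_X * ((KK * g0 - F1) * ?D) - fps_X ^ 2 * (KK * f0 * ?D))
     - (G2 + fps_X * (2 * KK * G1 + 2 * G1 - F2) + fps_X ^ 2 * (KK2 * g0 + KK * g0 - 2 * KK * F1)
           - fps_X ^ 3 * (KK2 * f0 - KK * f0))"
    unfolding lin_defect_def Let_def F1_def[unfolded f1_def, symmetric] F2_def[unfolded f1_def, symmetric]
      f0_def[symmetric] g0_def[symmetric] G1_def[unfolded g1_def, symmetric] G2_def[unfolded g1_def, symmetric] K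
    by (simp add: K2 algebra_simps)
  note defs = KK_def KK2_def f0_def F1_def F2_def g0_def G1_def G2_def
  have two: "(2 :: complex fps fps) * F1 = fps_const (2 * f1)" "2 * KK = fps_const (2 * K)"
      "2 * G1 = fps_const (2 * g1)"  "3 * fps_X * (KK * f0 * restr \<Phi>) = fps_X * (fps_const (3 * K * f) * restr \<Phi>)"
    by (simp_all add: defs fps_numeral_fps_const mult.assoc mult.left_commute
        flip: fps_const_mult)
  show "lin_defect \<Phi> k f g $ 0 = - fps_deriv g1"
    unfolding * two by (simp add: defs r0 restr_z_nth numeral_2_eq_2 numeral_3_eq_3)
  show "lin_defect \<Phi> k f g $ 1 = 2 * A * g1 - 2 * (K + 1) * g1 + fps_deriv f1"
    unfolding * two
    by (simp add: defs r0 R restr_z_nth fps_X_power_mult_nth mult.assoc numeral_2_eq_2[symmetric]) (simp add: A_def algebra_simps)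
  show "lin_defect \<Phi> k f g $ 2 = K * A * g + fps_deriv A * f + 3 * B * g1 - (K\<^sup>2 + K) * g + 2 * K * f1"
    unfolding * two
    by (simp add: defs r0 R restr_z_nth fps_X_power_mult_nth mult.assoc numeral_2_eq_2) (simp add: algebra_simps eval_nat_numeral)
  show "lin_defect \<Phi> k f g $ 3 = 2 * K * B * g - B * f1 + K * A * f + fps_deriv B * f + 4 * C * g1 + (K\<^sup>2 - K) * f"
    unfolding * two
    by (simp add: defs r0 R restr_z_nth fps_X_power_mult_nth mult.assoc numeral_3_eq_3 numeral_2_eq_2) (simp add: algebra_simps eval_nat_numeral)
qed

text \<open>Membership in the ideal generated by z^2 zeta^2 and zeta^4.\<close>
definition in_ideal :: "complex fps fps \<Rightarrow> bool" where
  "in_ideal e \<longleftrightarrow> e $ 0 = 0 \<and> e $ 1 = 0 \<and> e $ 2 $ 0 = 0 \<and> e $ 2 $ 1 = 0 \<and> e $ 3 $ 0 = 0 \<and> e $ 3 $ 1 = 0"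

type_synonym c4 = "complex \<times> complex \<times> complex \<times> complex"

text \<open>The matrix of the non-resonance condition, to be applied to the Cauchy data g(0), g'(0),
  f(0), f'(0), where f and g are the w^k coefficients of F and \<gamma>.\<close>

definition res_map :: "ps3 \<Rightarrow> nat \<Rightarrow> c4 \<Rightarrow> c4" where
  "res_map \<Phi> k = (\<lambda>(h1, h2, h3, h4).
    let \<alpha> = (\<lambda>j. \<Phi> j 0 2); \<beta> = (\<lambda>j. \<Phi> j 0 3); \<gamma> = (\<lambda>j. \<Phi> j 0 4); x = of_nat k in
     (x * (x + 1 - \<alpha> 0) * h1 - 3 * \<beta> 0 * h2 - \<alpha> 1 * h3 - 2 * x * h4,
      \<alpha> 1 * x * h1 + (3 * x * (x + 1 - \<alpha> 0) + 3 * \<beta> 1) * h2 + 2 * \<alpha> 2 * h3 + \<alpha> 1 * h4,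
      2 * x * \<beta> 0 * h1 + 4 * \<gamma> 0 * h2 + (x * (x - 1 + \<alpha> 0) + \<beta> 1) * h3 - \<beta> 0 * h4,
      2 * x * \<beta> 1 * h1 + (2 * \<beta> 0 * (\<alpha> 0 - 1) + 4 * \<gamma> 1) * h2 + (x * \<alpha> 1 + 2 * \<beta> 2) * h3
          + x * (x - 1 + \<alpha> 0) * h4))"

text \<open>The entries of e at \<zeta>^0 and \<zeta>^1 come from eliminating the z^2 coefficients
  of g and f in the two conditions taken at z^1.\<close>

definition res_rhs :: "ps3 \<Rightarrow> nat \<Rightarrow> complex fps fps \<Rightarrow> c4" where
  "res_rhs \<Phi> k e = (e $ 2 $ 0,
     2 * of_nat k * e $ 1 $ 0 - 3 * \<Phi> 0 0 3 * e $ 0 $ 0 - e $ 2 $ 1,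
     - e $ 3 $ 0,
     - \<Phi> 0 0 3 * e $ 1 $ 0 - 4 * \<Phi> 0 0 4 * e $ 0 $ 0 - e $ 3 $ 1)"

text \<open>Real linearity suffices: injectivity then gives surjectivity, and later a lower bound,
  because \<open>c4\<close> is a finite-dimensional Euclidean space.\<close>

lemma linear_res_map: "linear (res_map \<Phi> k)"
proof (rule linearI)
  show "res_map \<Phi> k (x + y) = res_map \<Phi> k x + res_map \<Phi> k y" for x y
    by (cases x; cases y) (simp add: res_map_def Let_def plus_prod_def algebra_simps)
  show "res_map \<Phi> k (r *\<^sub>R x) = r *\<^sub>R res_map \<Phi> k x" for r x
    by (cases x) (simp add: res_map_def Let_def scaleR_prod_def scaleR_conv_of_real algebra_simps)
qed

lemma inj_res_map:
  assumes "nonresonant \<Phi>" "k \<ge> 1"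
  shows "inj (res_map \<Phi> k)"
proof -
  have "h = 0" if "res_map \<Phi> k h = 0" for h
  proof -
    obtain h1 h2 h3 h4 where h: "h = (h1, h2, h3, h4)" by (cases h)
    have "h1 = 0 \<and> h2 = 0 \<and> h3 = 0 \<and> h4 = 0"
      using that unfolding h res_map_def Let_def zero_prod_def prod.case prod.inject
      by (rule assms(1)[unfolded nonresonant_def Let_def, rule_format, OF assms(2)])
    then show ?thesis by (simp add: h zero_prod_def)
  qed
  then show ?thesis using linear_injective_0[OF linear_res_map] by blast
qed

lemma bij_res_map:
  assumes "nonresonant \<Phi>" "k \<ge> 1"
  shows "bij (res_map \<Phi> k)"
  using inj_res_map[OF assms] linear_injective_imp_surjective[OF linear_res_map]
  by (simp add: bij_def)

text \<open>The \<zeta>^0 and \<zeta>^1 parts determine g'' and f''. The other four conditions are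
  taken at z^0 and z^1; besides Cauchy data they contain only the z^2 coefficients of g and f, which
  the two equations eliminate.\<close>

lemma in_ideal_lin_defect_iff:
  assumes \<Phi>: "in_E1 \<Phi>"
  defines "A \<equiv> restr \<Phi> $ 2"
  shows "in_ideal (e + lin_defect \<Phi> k f g) \<longleftrightarrow>
     fps_deriv (fps_deriv g) = e $ 0 \<and>
     fps_deriv (fps_deriv f) = 2 * fps_const (of_nat k + 1) * fps_deriv g - 2 * A * fps_deriv g - e $ 1 \<and>
     res_map \<Phi> k (g $ 0, g $ 1, f $ 0, f $ 1) = res_rhs \<Phi> k e"
    (is "_ \<longleftrightarrow> ?G \<and> ?F \<and> ?R")
proof -
  note L = lin_defect_nth[OF \<Phi>, of k f g, folded A_def]
  have 0: "(e + lin_defect \<Phi> k f g) $ 0 = 0 \<longleftrightarrow> ?G" by (auto simp: L)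
  have K1: "2 * (fps_const (of_nat k) + 1) = 2 * fps_const (of_nat k + 1 :: complex)"
    by (simp flip: fps_const_add)
  have 1: "(e + lin_defect \<Phi> k f g) $ 1 = 0 \<longleftrightarrow> ?F"
    unfolding fps_add_nth L K1 by (auto simp: algebra_simps add_eq_0_iff)
  have "(e + lin_defect \<Phi> k f g) $ 2 $ 0 = 0 \<and> (e + lin_defect \<Phi> k f g) $ 2 $ 1 = 0 \<and>
      (e + lin_defect \<Phi> k f g) $ 3 $ 0 = 0 \<and> (e + lin_defect \<Phi> k f g) $ 3 $ 1 = 0 \<longleftrightarrow> ?R"
    if ?G ?F
  proof -
    have g2: "g $ 2 = e $ 0 $ 0 / 2"
      using arg_cong[OF \<open>?G\<close>, of "\<lambda>s. s $ 0"] by (simp add: numeral_2_eq_2 field_simps)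
    have f2: "2 * f $ 2 = 2 * (of_nat k + 1) * g $ 1 - 2 * \<Phi> 0 0 2 * g $ 1 - e $ 1 $ 0"
      using arg_cong[OF \<open>?F\<close>, of "\<lambda>s. s $ 0"]
      by (simp add: numeral_2_eq_2 field_simps A_def fps_numeral_fps_const mult.assoc del: fps_const_mult)
    define x :: complex where "x = of_nat k"
    define a0 a1 a2 where "a0 = \<Phi> 0 0 2" and "a1 = \<Phi> 1 0 2" and "a2 = \<Phi> 2 0 2"
    define b0 b1 b2 where "b0 = \<Phi> 0 0 3" and "b1 = \<Phi> 1 0 3" and "b2 = \<Phi> 2 0 3"
    define c0 c1 where "c0 = \<Phi> 0 0 4" and "c1 = \<Phi> 1 0 4"
    define h1 h2 h3 h4 where "h1 = g $ 0" and "h2 = g $ 1" and "h3 = f $ 0" and "h4 = f $ 1"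
    note ds = a0_def a1_def a2_def b0_def b1_def b2_def c0_def c1_def h1_def h2_def h3_def h4_def x_def A_def
    have F2: "2 * f $ 2 = 2 * (x + 1) * h2 - 2 * a0 * h2 - e $ 1 $ 0"
      using f2 by (simp add: ds)
    note S = fps_numeral_fps_const power2_eq_square fps_mult_nth_1 numeral_2_eq_2
    have E1: "(e + lin_defect \<Phi> k f g) $ 2 $ 0 = - (x * (x + 1 - a0) * h1 - 3 * b0 * h2 - a1 * h3 - 2 * x * h4 - e $ 2 $ 0)"
      unfolding fps_add_nth L by (simp add: ds S algebra_simps)
    have E3: "(e + lin_defect \<Phi> k f g) $ 3 $ 0 = e $ 3 $ 0 + (2 * x * b0 * h1 + 4 * c0 * h2 + (x * (x - 1 + a0) + b1) * h3 - b0 * h4)"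
      unfolding fps_add_nth L by (simp add: ds S algebra_simps)
    have "(e + lin_defect \<Phi> k f g) $ 2 $ 1 = e $ 2 $ 1 + (x * (a0 * h2 + a1 * h1) + (a1 * h4 + 2 * a2 * h3)
        + 3 * (b0 * (2 * g $ 2) + b1 * h2) - (x * x + x) * h2 + 2 * x * (2 * f $ 2))"
      unfolding fps_add_nth L by (simp add: ds S algebra_simps)
    also have "\<dots> = (a1 * x * h1 + (3 * x * (x + 1 - a0) + 3 * b1) * h2 + 2 * a2 * h3 + a1 * h4)
        - (2 * x * e $ 1 $ 0 - 3 * b0 * e $ 0 $ 0 - e $ 2 $ 1)"
      unfolding F2 g2 by (simp add: algebra_simps)
    finally have E2: "(e + lin_defect \<Phi> k f g) $ 2 $ 1 = \<dots>" .
    have "(e + lin_defect \<Phi> k f g) $ 3 $ 1 = e $ 3 $ 1 + (2 * x * (b0 * h2 + b1 * h1) - (b0 * (2 * f $ 2) + b1 * h4)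
       + x * (a0 * h4 + a1 * h3) + (b1 * h4 + 2 * b2 * h3) + 4 * (c0 * (2 * g $ 2) + c1 * h2) + (x * x - x) * h4)"
      unfolding fps_add_nth L by (simp add: ds S algebra_simps)
    also have "\<dots> = (2 * x * b1 * h1 + (2 * b0 * (a0 - 1) + 4 * c1) * h2 + (x * a1 + 2 * b2) * h3
          + x * (x - 1 + a0) * h4) - (- b0 * e $ 1 $ 0 - 4 * c0 * e $ 0 $ 0 - e $ 3 $ 1)"
      unfolding F2 g2 by (simp add: algebra_simps)
    finally have E4: "(e + lin_defect \<Phi> k f g) $ 3 $ 1 = \<dots>" .
    have "?R \<longleftrightarrow> x * (x + 1 - a0) * h1 - 3 * b0 * h2 - a1 * h3 - 2 * x * h4 = e $ 2 $ 0 \<and>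
       a1 * x * h1 + (3 * x * (x + 1 - a0) + 3 * b1) * h2 + 2 * a2 * h3 + a1 * h4 = 2 * x * e $ 1 $ 0 - 3 * b0 * e $ 0 $ 0 - e $ 2 $ 1 \<and>
       2 * x * b0 * h1 + 4 * c0 * h2 + (x * (x - 1 + a0) + b1) * h3 - b0 * h4 = - e $ 3 $ 0 \<and>
       2 * x * b1 * h1 + (2 * b0 * (a0 - 1) + 4 * c1) * h2 + (x * a1 + 2 * b2) * h3
          + x * (x - 1 + a0) * h4 = - b0 * e $ 1 $ 0 - 4 * c0 * e $ 0 $ 0 - e $ 3 $ 1"
      unfolding res_map_def res_rhs_def Let_def prod.case prod.inject ds ..
    then show ?thesis unfolding E1 E2 E3 E4 by (simp only: right_minus_eq add_eq_0_iff neg_equal_0_iff_equal fps_neg_nth)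
  qed
  then show ?thesis unfolding in_ideal_def using 0 1 by blast
qed

text \<open>The linear system fixes the Cauchy data. Two integrations give g, and two more give f,
  whose equation contains g' while that of g does not contain f.\<close>

lemma ex1_solution:
  assumes \<Phi>: "in_E1 \<Phi>" "nonresonant \<Phi>" and k: "k \<ge> 1"
  shows "\<exists>!fg. in_ideal (e + lin_defect \<Phi> k (fst fg) (snd fg))"
proof -
  define R where "R g = 2 * fps_const (of_nat k + 1) * fps_deriv g - 2 * (restr \<Phi> $ 2) * fps_deriv g - e $ 1" for g
  obtain h1 h2 h3 h4 where h: "res_map \<Phi> k (h1, h2, h3, h4) = res_rhs \<Phi> k e"
    using bij_res_map[OF \<Phi>(2) k] by (metis bij_pointE surj_pair)
  define g where "g = fps_integral (fps_integral (e $ 0) h2) h1"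
  define f where "f = fps_integral (fps_integral (R g) h4) h3"
  note iff = in_ideal_lin_defect_iff[OF \<Phi>(1), of e k, folded R_def]
  have int: "u = fps_integral (fps_deriv u) (u $ 0)" for u :: "complex fps"
    by (simp add: fps_eq_iff fps_integral_def)
  have int0: "fps_integral u a $ 0 = a" for u :: "complex fps" and a
    by (simp add: fps_integral_def)
  have "in_ideal (e + lin_defect \<Phi> k f g)"
  proof -
    have "fps_deriv g = fps_integral (e $ 0) h2" "fps_deriv f = fps_integral (R g) h4"
      by (simp_all add: g_def f_def fps_deriv_fps_integral)
    then have "fps_deriv (fps_deriv g) = e $ 0" "fps_deriv (fps_deriv f) = R g"
      "fps_deriv g $ 0 = h2" "fps_deriv f $ 0 = h4"
      by (simp_all add: fps_deriv_fps_integral int0 del: fps_deriv_nth)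
    moreover have "g $ 0 = h1" "f $ 0 = h3" by (simp_all add: g_def f_def int0)
    ultimately show ?thesis unfolding iff using h by auto
  qed
  moreover have "f' = f \<and> g' = g" if "in_ideal (e + lin_defect \<Phi> k f' g')" for f' g'
  proof -
    from that have *: "fps_deriv (fps_deriv g') = e $ 0" "fps_deriv (fps_deriv f') = R g'"
      "res_map \<Phi> k (g' $ 0, g' $ 1, f' $ 0, f' $ 1) = res_rhs \<Phi> k e" unfolding iff by auto
    have "(g' $ 0, g' $ 1, f' $ 0, f' $ 1) = (h1, h2, h3, h4)"
      using inj_res_map[OF \<Phi>(2) k] *(3) h by (metis injD)
    then have h': "g' $ 0 = h1" "fps_deriv g' $ 0 = h2" "f' $ 0 = h3" "fps_deriv f' $ 0 = h4" by auto
    have "g' = g" using int[of g'] int[of "fps_deriv g'"] by (simp only: *(1) h' g_def)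
    moreover have "f' = f" using int[of f'] int[of "fps_deriv f'"] by (simp only: *(2) h' f_def \<open>g' = g\<close>)
    ultimately show ?thesis by simp
  qed
  ultimately show ?thesis unfolding Ex1_def by (metis fst_conv snd_conv prod.collapse)
qed

section \<open>Uniform bounds for the linearized equations\<close>

text \<open>Diagonal dominance for large k. With the scaled unknowns k x1, x2, k x3, x4 and their
  sum S, each perturbation is at most k S / 24, once the second and fourth rows are divided by k.
  The only other off-diagonal term, 2 k x4, is controlled by the fourth row. Adding up gives k S
  \<le> 16/3 (y + k S / 24), hence k S \<le> 48/7 y \<le> 8 y.\<close>

lemma res_real_bound:
  fixes x1 x2 x3 x4 y c k :: real
  assumes pos: "0 \<le> x1" "0 \<le> x2" "0 \<le> x3" "0 \<le> x4" "0 \<le> y" "0 \<le> c" and k: "1 \<le> k" "24 * c \<le> k"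
    and 1: "k\<^sup>2 * x1 \<le> y + c * (k * x1 + x2 + x3) + 2 * k * x4"
    and 2: "3 * k\<^sup>2 * x2 \<le> k * y + c * (k * x1 + k * x2 + x3 + x4)"
    and 3: "k\<^sup>2 * x3 \<le> y + c * (k * x1 + x2 + k * x3 + x4)"
    and 4: "k\<^sup>2 * x4 \<le> k * y + c * (k * x1 + x2 + k * x3 + k * x4)"
  shows "k\<^sup>2 * x1 \<le> 8 * y" "k * x2 \<le> 8 * y" "k\<^sup>2 * x3 \<le> 8 * y" "k * x4 \<le> 8 * y"
proof -
  define u1 u2 u3 u4 where "u1 = k * x1" and "u2 = x2" and "u3 = k * x3" and "u4 = x4"
  have x3: "x3 \<le> u3" "x1 \<le> u1" using pos k by (auto simp: u1_def u3_def mult_le_cancel_right1)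
  have u0: "0 \<le> u1" "0 \<le> u2" "0 \<le> u3" "0 \<le> u4" using pos k by (auto simp: u1_def u2_def u3_def u4_def)
  define S where "S = u1 + u2 + u3 + u4"
  have S0: "0 \<le> S" using u0 by (simp add: S_def)
  have cS: "c * S \<le> k * S / 24" using k S0 by (intro order_trans[OF mult_right_mono[of c "k / 24"]]) auto
  have b: "c * t \<le> k * S / 24" if "t \<le> S" for t
    using mult_left_mono[OF that \<open>0 \<le> c\<close>] cS by linarith
  have E4: "k * (k * u4) \<le> k * (y + k * S / 24)"
  proof -
    have "c * (k * x1 + x2 + k * x3 + k * x4) \<le> c * (k * S)"
    proof (rule mult_left_mono)
      have "u1 \<le> k * u1" "u2 \<le> k * u2" "u3 \<le> k * u3" using u0 k by (auto simp: mult_le_cancel_right1)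
      then show "k * x1 + x2 + k * x3 + k * x4 \<le> k * S"
        by (simp add: S_def distrib_left u1_def[symmetric] u2_def[symmetric] u3_def[symmetric] u4_def[symmetric])
    qed (use pos in auto)
    also have "\<dots> \<le> k * (k * S / 24)" using mult_left_mono[OF cS, of k] k by (simp add: ac_simps)
    finally show ?thesis using 4 by (simp add: u4_def power2_eq_square distrib_left mult.assoc)
  qed
  have E2: "k * (3 * k * u2) \<le> k * (y + k * S / 24)"
  proof -
    have "c * (k * x1 + k * x2 + x3 + x4) \<le> c * (k * S)"
    proof (rule mult_left_mono)
      have "u1 \<le> k * u1" "u4 \<le> k * u4" "u3 \<le> k * u3" using u0 k by (auto simp: mult_le_cancel_right1)
      then show "k * x1 + k * x2 + x3 + x4 \<le> k * S" using x3
        by (simp add: S_def distrib_left u1_def[symmetric] u2_def[symmetric] u4_def[symmetric])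
    qed (use pos in auto)
    also have "\<dots> \<le> k * (k * S / 24)" using mult_left_mono[OF cS, of k] k by (simp add: ac_simps)
    finally show ?thesis using 2 by (simp add: u2_def power2_eq_square distrib_left mult.assoc)
  qed
  have F4: "k * u4 \<le> y + k * S / 24" and F2: "3 * (k * u2) \<le> y + k * S / 24"
    using E4 E2 k by (simp_all add: mult_le_cancel_left mult.assoc)
  have F3: "k * u3 \<le> y + k * S / 24"
  proof -
    have "c * (k * x1 + x2 + k * x3 + x4) \<le> k * S / 24"
      by (rule b) (simp add: S_def u1_def u2_def u3_def u4_def)
    then show ?thesis using 3 unfolding u3_def power2_eq_square mult.assoc by linarith
  qed
  have F1: "k * u1 \<le> y + k * S / 24 + 2 * (k * u4)"
  proof -
    have "c * (k * x1 + x2 + x3) \<le> k * S / 24"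
      using x3 u0 by (intro b) (simp add: S_def u1_def u2_def)
    then show ?thesis using 1 unfolding u1_def u4_def power2_eq_square mult.assoc by linarith
  qed
  have "k * S = k * u1 + k * u2 + k * u3 + k * u4" by (simp add: S_def distrib_left)
  moreover have "0 \<le> k * u1" "0 \<le> k * u2" "0 \<le> k * u3" "0 \<le> k * u4" using u0 k by auto
  ultimately have "k * u1 \<le> 8 * y" "k * u2 \<le> 8 * y" "k * u3 \<le> 8 * y" "k * u4 \<le> 8 * y"
    using F1 F2 F3 F4 \<open>0 \<le> y\<close> by linarith+
  then show "k\<^sup>2 * x1 \<le> 8 * y" "k * x2 \<le> 8 * y" "k\<^sup>2 * x3 \<le> 8 * y" "k * x4 \<le> 8 * y"
    by (simp_all add: u1_def u2_def u3_def u4_def power2_eq_square mult.assoc)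
qed

text \<open>The second and fourth entries belong to z^1, the others to z^0. Raising the power of z
  by one enlarges the weights used later by a factor of order k, hence the different powers of
  k.\<close>

definition res_bound :: "ps3 \<Rightarrow> real \<Rightarrow> nat \<Rightarrow> bool" where
  "res_bound \<Phi> C k \<longleftrightarrow> (\<forall>h1 h2 h3 h4 y1 y2 y3 y4. \<forall>y::real. res_map \<Phi> k (h1, h2, h3, h4) = (y1, y2, y3, y4) \<and>
     norm y1 \<le> y \<and> norm y2 \<le> k * y \<and> norm y3 \<le> y \<and> norm y4 \<le> k * y \<longrightarrow>
     real k ^ 2 * norm h1 \<le> C * y \<and> k * norm h2 \<le> C * y \<and> real k ^ 2 * norm h3 \<le> C * y \<and> k * norm h4 \<le> C * y)"

lemma res_bound_mono: "res_bound \<Phi> C k \<Longrightarrow> C \<le> C' \<Longrightarrow> res_bound \<Phi> C' k"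
  unfolding res_bound_def
  by (meson mult_right_mono norm_ge_zero order_trans)

text \<open>For a fixed k any constant will do, so the crude lower bound for an injective linear map
  is enough.\<close>

lemma res_bound_single:
  assumes "nonresonant \<Phi>" "k \<ge> 1"
  shows "\<exists>C. res_bound \<Phi> C k"
proof -
  obtain B where B: "B > 0" "\<And>h. B * norm h \<le> norm (res_map \<Phi> k h)"
    using linear_inj_bounded_below_pos[OF linear_res_map inj_res_map[OF assms]] by blast
  have "res_bound \<Phi> (real k ^ 2 * (4 * real k) / B) k"
    unfolding res_bound_def
  proof (intro allI impI, elim conjE)
    fix h1 h2 h3 h4 y1 y2 y3 y4 and y :: real
    assume *: "res_map \<Phi> k (h1, h2, h3, h4) = (y1, y2, y3, y4)"
      "norm y1 \<le> y" "norm y2 \<le> k * y" "norm y3 \<le> y" "norm y4 \<le> k * y"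
    define h where "h = (h1, h2, h3, h4)"
    have y0: "0 \<le> y" using *(2) norm_ge_zero order_trans by blast
    have yk: "y \<le> k * y" using assms(2) y0 by (simp add: mult_le_cancel_right1)
    have "norm (y1, y2, y3, y4) \<le> norm y1 + (norm y2 + (norm y3 + norm y4))"
      by (intro order_trans[OF norm_Pair_le] add_left_mono norm_Pair_le)
    also have "\<dots> \<le> 4 * (k * y)" using * yk by linarith
    finally have "B * norm h \<le> 4 * (k * y)" using B(2)[of h] * by (simp add: h_def)
    then have nh: "norm h \<le> 4 * real k / B * y" using B(1) by (simp add: field_simps)
    have n: "norm h1 \<le> norm h" "norm h2 \<le> norm h" "norm h3 \<le> norm h" "norm h4 \<le> norm h"
      unfolding h_def
      by (metis norm_fst_le norm_snd_le order_trans fst_conv snd_conv)+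
    have kk: "real k \<le> real k ^ 2" using assms(2) by (simp add: power2_eq_square)
    have g: "m * norm h' \<le> real k ^ 2 * (4 * real k) / B * y"
      if "0 \<le> m" "m \<le> real k ^ 2" "norm h' \<le> norm h" for m and h' :: complex
    proof -
      have "m * norm h' \<le> real k ^ 2 * (4 * real k / B * y)"
        using that nh by (intro mult_mono) auto
      then show ?thesis by (simp add: algebra_simps)
    qed
    show "real k ^ 2 * norm h1 \<le> real k ^ 2 * (4 * real k) / B * y \<and> k * norm h2 \<le> real k ^ 2 * (4 * real k) / B * y
      \<and> real k ^ 2 * norm h3 \<le> real k ^ 2 * (4 * real k) / B * y \<and> k * norm h4 \<le> real k ^ 2 * (4 * real k) / B * y"
      by (intro conjI g n kk) auto
  qed
  then show ?thesis by blast
qed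

text \<open>As k grows, only the k^2 parts of the diagonal and the entry 2 k of the first row
  matter; c collects the other coefficients.\<close>

lemma res_bound_large: "\<exists>c. \<forall>k. 1 \<le> k \<and> c \<le> real k \<longrightarrow> res_bound \<Phi> 8 k"
proof -
  define a0 a1 a2 where "a0 = \<Phi> 0 0 2" and "a1 = \<Phi> 1 0 2" and "a2 = \<Phi> 2 0 2"
  define b0 b1 b2 where "b0 = \<Phi> 0 0 3" and "b1 = \<Phi> 1 0 3" and "b2 = \<Phi> 2 0 3"
  define c0 c1 where "c0 = \<Phi> 0 0 4" and "c1 = \<Phi> 1 0 4"
  define d where "d = 2 * b0 * (a0 - 1) + 4 * c1"
  define c where "c = 3 * norm (1 - a0) + norm a1 + 2 * norm a2 + 3 * norm b0 + 3 * norm b1 + 2 * norm b2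
     + 4 * norm c0 + norm d"
  have c0': "0 \<le> c" by (simp add: c_def)
  have "res_bound \<Phi> 8 k" if k: "1 \<le> k" "24 * c \<le> real k" for k
    unfolding res_bound_def
  proof (intro allI impI, elim conjE)
    fix h1 h2 h3 h4 y1 y2 y3 y4 and y :: real
    assume *: "res_map \<Phi> k (h1, h2, h3, h4) = (y1, y2, y3, y4)" and
      y: "norm y1 \<le> y" "norm y2 \<le> k * y" "norm y3 \<le> y" "norm y4 \<le> k * y"
    define x :: complex where "x = of_nat k"
    define r where "r = real k"
    have nx: "norm x = r" by (simp add: x_def r_def)
    have r1: "1 \<le> r" using k by (simp add: r_def)
    have y0: "0 \<le> y" using y(1) norm_ge_zero order_trans by blast
    have R: "x * (x + 1 - a0) * h1 - 3 * b0 * h2 - a1 * h3 - 2 * x * h4 = y1"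
      "a1 * x * h1 + (3 * x * (x + 1 - a0) + 3 * b1) * h2 + 2 * a2 * h3 + a1 * h4 = y2"
      "2 * x * b0 * h1 + 4 * c0 * h2 + (x * (x - 1 + a0) + b1) * h3 - b0 * h4 = y3"
      "2 * x * b1 * h1 + d * h2 + (x * a1 + 2 * b2) * h3 + x * (x - 1 + a0) * h4 = y4"
      using * unfolding res_map_def Let_def prod.case prod.inject x_def
        a0_def a1_def a2_def b0_def b1_def b2_def c0_def c1_def d_def by auto
    have S1: "x\<^sup>2 * h1 = y1 + (- (1 - a0) * (x * h1) + 3 * b0 * h2 + a1 * h3) + 2 * (x * h4)"
      unfolding R(1)[symmetric] by (simp add: algebra_simps power2_eq_square)
    have S2: "3 * x\<^sup>2 * h2 = y2 + (- a1 * (x * h1) + - 3 * ((1 - a0) * (x * h2)) + - 3 * b1 * h2 + - 2 * a2 * h3 + - a1 * h4)"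
      unfolding R(2)[symmetric] by (simp add: algebra_simps power2_eq_square)
    have S3: "x\<^sup>2 * h3 = y3 + (- 2 * b0 * (x * h1) + - 4 * c0 * h2 + (1 - a0) * (x * h3) + - b1 * h3 + b0 * h4)"
      unfolding R(3)[symmetric] by (simp add: algebra_simps power2_eq_square)
    have S4: "x\<^sup>2 * h4 = y4 + (- 2 * b1 * (x * h1) + - d * h2 + - a1 * (x * h3) + - 2 * b2 * h3 + (1 - a0) * (x * h4))"
      unfolding R(4)[symmetric] by (simp add: algebra_simps power2_eq_square)
    have T: "norm (a + b) \<le> A + B" if "norm a \<le> A" "norm b \<le> B" for a b :: complex and A B
      using norm_triangle_mono that by blast
    have le: "norm (1 - a0) \<le> c" "3 * norm (1 - a0) + 3 * norm b1 \<le> c" "norm a1 \<le> c" "norm a1 + 2 * norm b2 \<le> c"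
        "3 * norm b0 \<le> c" "2 * norm b0 \<le> c" "norm b0 \<le> c" "norm (1 - a0) + norm b1 \<le> c" "4 * norm c0 \<le> c"
        "norm d \<le> c" "2 * norm b1 \<le> c" "2 * norm a2 \<le> c"
      unfolding c_def by simp_all
    have up: "p * norm v \<le> c * norm v" if "p \<le> c" for p and v :: complex
      using that by (simp add: mult_right_mono)
    \<comment> \<open>Since |x| = k \<ge> 1, the lower order term with v is absorbed into the one
      with x v.\<close>
    have up2: "p * norm (x * v) + q * norm v \<le> c * norm (x * v)" if "p + q \<le> c" "0 \<le> q" for p q and v :: complex
    proof -
      have "q * norm v \<le> q * norm (x * v)" using that(2) r1 by (intro mult_left_mono) (auto simp: norm_mult nx mult_le_cancel_right1)
      then show ?thesis using mult_right_mono[OF that(1) norm_ge_zero[of "x * v"]] by (simp add: distrib_right)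
    qed
    have N1: "norm (x\<^sup>2 * h1) \<le> y + (norm (1 - a0) * norm (x * h1) + 3 * norm b0 * norm h2 + norm a1 * norm h3) + 2 * norm (x * h4)"
      unfolding S1 by (intro T y) (simp_all add: norm_mult norm_minus_commute)
    have N2: "norm (3 * x\<^sup>2 * h2) \<le> r * y + (norm a1 * norm (x * h1) + 3 * norm (1 - a0) * norm (x * h2) + 3 * norm b1 * norm h2 + 2 * norm a2 * norm h3 + norm a1 * norm h4)"
      unfolding S2 by (intro T y[folded r_def]) (simp_all add: norm_mult norm_minus_commute)
    have N3: "norm (x\<^sup>2 * h3) \<le> y + (2 * norm b0 * norm (x * h1) + 4 * norm c0 * norm h2 + norm (1 - a0) * norm (x * h3) + norm b1 * norm h3 + norm b0 * norm h4)"
      unfolding S3 by (intro T y) (simp_all add: norm_mult norm_minus_commute)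
    have N4: "norm (x\<^sup>2 * h4) \<le> r * y + (2 * norm b1 * norm (x * h1) + norm d * norm h2 + norm a1 * norm (x * h3) + 2 * norm b2 * norm h3 + norm (1 - a0) * norm (x * h4))"
      unfolding S4 by (intro T y[folded r_def]) (simp_all add: norm_mult norm_minus_commute)
    have I1: "r\<^sup>2 * norm h1 \<le> y + c * (r * norm h1 + norm h2 + norm h3) + 2 * r * norm h4"
      using N1 up[OF le(1), of "x * h1"] up[OF le(5), of h2] up[OF le(3), of h3]
      by (simp add: norm_mult norm_power nx distrib_left)
    have I2: "3 * r\<^sup>2 * norm h2 \<le> r * y + c * (r * norm h1 + r * norm h2 + norm h3 + norm h4)"
      using N2 up[OF le(3), of "x * h1"] up2[OF le(2), of h2] up[OF le(12), of h3] up[OF le(3), of h4]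
      by (simp add: norm_mult norm_power nx distrib_left)
    have I3: "r\<^sup>2 * norm h3 \<le> y + c * (r * norm h1 + norm h2 + r * norm h3 + norm h4)"
      using N3 up[OF le(6), of "x * h1"] up[OF le(9), of h2] up2[OF le(8), of h3] up[OF le(7), of h4]
      by (simp add: norm_mult norm_power nx distrib_left)
    have I4: "r\<^sup>2 * norm h4 \<le> r * y + c * (r * norm h1 + norm h2 + r * norm h3 + r * norm h4)"
      using N4 up[OF le(11), of "x * h1"] up[OF le(10), of h2] up2[OF le(4), of h3] up[OF le(1), of "x * h4"]
      by (simp add: norm_mult norm_power nx distrib_left)
    show "real k ^ 2 * norm h1 \<le> 8 * y \<and> k * norm h2 \<le> 8 * y \<and> real k ^ 2 * norm h3 \<le> 8 * y \<and> k * norm h4 \<le> 8 * y"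
      using res_real_bound[OF _ _ _ _ y0 c0' r1 _ I1 I2 I3 I4] k(2) by (simp add: r_def)
  qed
  then show ?thesis by blast
qed

text \<open>Non-resonance settles the finitely many k below the threshold, diagonal dominance the
  others.\<close>

lemma res_bound_uniform:
  assumes "nonresonant \<Phi>"
  shows "\<exists>C\<ge>0. \<forall>k\<ge>1. res_bound \<Phi> C k"
proof -
  obtain c where c: "\<And>k. 1 \<le> k \<Longrightarrow> c \<le> real k \<Longrightarrow> res_bound \<Phi> 8 k"
    using res_bound_large by blast
  obtain D where D: "\<And>k. k \<ge> 1 \<Longrightarrow> res_bound \<Phi> (D k) k"
    using res_bound_single[OF assms] by metis
  define n where "n = nat \<lceil>c\<rceil>"
  define C where "C = 8 + (\<Sum>k\<le>n. \<bar>D k\<bar>)"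
  have s: "0 \<le> (\<Sum>k\<le>n. \<bar>D k\<bar>)" by (simp add: sum_nonneg)
  have "res_bound \<Phi> C k" if k: "k \<ge> 1" for k
  proof (cases "k \<le> n")
    case True
    then have "\<bar>D k\<bar> \<le> (\<Sum>k\<le>n. \<bar>D k\<bar>)" by (intro member_le_sum) auto
    then have "D k \<le> C" unfolding C_def by linarith
    then show ?thesis using res_bound_mono[OF D[OF k]] by blast
  next
    case False
    then have "c \<le> real k" unfolding n_def by linarith
    then show ?thesis using res_bound_mono[OF c[OF k]] s unfolding C_def by auto
  qed
  then show ?thesis using s unfolding C_def by (intro exI[of _ C]) (auto simp: C_def)
qed

text \<open>The weight w is abstract, with the properties that \<open>wt2\<close> will have at order
  k, and C is fixed before k and w, so it cannot depend on the parameters r and \<epsilon> chosen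
  from it. The gain (a+k+1)^-2 comes from \<open>res_bound\<close> for a < 2 and from two
  integrations for a \<ge> 2.\<close>

lemma solution_bound:
  assumes \<Phi>: "in_E1 \<Phi>" "nonresonant \<Phi>" and s: "1 \<le> s" and CA: "0 \<le> CA"
  shows "\<exists>C\<ge>0. \<forall>k\<ge>1. \<forall>e f g. \<forall>D\<ge>0. \<forall>w :: nat \<Rightarrow> real.
    in_ideal (e + lin_defect \<Phi> k f g) \<and> (\<forall>a. 0 < w a) \<and>
    (\<forall>a. real (a + 1) * w (a + 1) \<le> real (a + k + 1) * s * w a) \<and>
    (\<forall>a. real (a + k + 1) * w a \<le> 4 * real (a + 1) * w (a + 1)) \<and>
    (\<forall>a. (\<Sum>i\<le>a. norm (\<Phi> i 0 2) * w (a - i)) \<le> CA * w a) \<and>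
    (\<forall>a. \<forall>c\<le>3. norm (e $ c $ a) \<le> D * w a) \<longrightarrow>
    (\<forall>a. norm (f $ a) \<le> C * D * w a / real (a + k + 1) ^ 2 \<and>
         norm (g $ a) \<le> C * D * w a / real (a + k + 1) ^ 2)"
proof -
  obtain R where R: "R \<ge> 0" "\<And>k. k \<ge> 1 \<Longrightarrow> res_bound \<Phi> R k"
    using res_bound_uniform[OF \<Phi>(2)] by blast
  \<comment> \<open>q bounds the entries of \<open>res_rhs\<close> relative to D w(0), up to the
    factor k in the second and fourth; the summand 2 s stems from w(1) \<le> (k + 1) s w(0) \<le> 2
    k s w(0).\<close>
  define q where "q = 2 + 3 * norm (\<Phi> 0 0 3) + 4 * norm (\<Phi> 0 0 4) + 2 * s"
  \<comment> \<open>48 is the constant of \<open>second\<close>. The factor 20 = 5 * 4 arises for a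
    = 1 from (k + 2)^2 \<le> 5 k (k + 1) and from \<open>dn\<close>.\<close>
  define G where "G = 48 + 20 * R * q"
  \<comment> \<open>The parenthesis bounds f'': its summands stem from e at \<zeta>^1, from 2 (k +
    1) g' and from 2 A g'.\<close>
  define C where "C = 48 * (1 + 2 * G * s + 2 * G * s * CA) + G"
  have q: "2 \<le> q" using s by (simp add: q_def)
  have G: "48 \<le> G" using R q by (simp add: G_def)
  have C: "G \<le> C" using G s CA by (simp add: C_def)
  have main: "norm (f $ a) \<le> C * D * w a / real (a + k + 1) ^ 2 \<and> norm (g $ a) \<le> C * D * w a / real (a + k + 1) ^ 2"
    if k: "1 \<le> k" and D: "0 \<le> D" and id: "in_ideal (e + lin_defect \<Phi> k f g)" and w: "\<And>a. 0 < w a"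
      and up: "\<And>a. real (a + 1) * w (a + 1) \<le> real (a + k + 1) * s * w a"
      and dn: "\<And>a. real (a + k + 1) * w a \<le> 4 * real (a + 1) * w (a + 1)"
      and cv: "\<And>a. (\<Sum>i\<le>a. norm (\<Phi> i 0 2) * w (a - i)) \<le> CA * w a"
      and e: "\<And>c a. c \<le> 3 \<Longrightarrow> norm (e $ c $ a) \<le> D * w a"
    for k e f g D a and w :: "nat \<Rightarrow> real"
  proof -
    define A where "A = restr \<Phi> $ 2"
    have g2: "fps_deriv (fps_deriv g) = e $ 0"
      and f2: "fps_deriv (fps_deriv f) = 2 * fps_const (of_nat k + 1) * fps_deriv g - 2 * A * fps_deriv g - e $ 1"
      and r: "res_map \<Phi> k (g $ 0, g $ 1, f $ 0, f $ 1) = res_rhs \<Phi> k e"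
      using id in_ideal_lin_defect_iff[OF \<Phi>(1), of e k f g] by (simp_all add: A_def)
    have dn2: "real (a + k + 1) * real (a + k + 2) * w a \<le> 16 * (real (a + 1) * real (a + 2) * w (a + 2))" for a
    proof -
      have "real (a + k + 2) * (real (a + k + 1) * w a) \<le> real (a + k + 2) * (4 * real (a + 1) * w (a + 1))"
        by (intro mult_left_mono dn) auto
      also have "\<dots> = 4 * real (a + 1) * (real (a + 1 + k + 1) * w (a + 1))" by (simp add: algebra_simps)
      also have "\<dots> \<le> 4 * real (a + 1) * (4 * real (a + 1 + 1) * w (a + 1 + 1))"
        by (intro mult_left_mono dn) auto
      finally show ?thesis by (simp add: algebra_simps)
    qed
    \<comment> \<open>48 = 3 * 16: two uses of \<open>dn\<close> cost 16, and (n + 3)^2 \<le> 3 (n +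
      1) (n + 2) costs 3.\<close>
    have second: "norm (u $ (a + 2)) \<le> 48 * B * w (a + 2) / real (a + 2 + k + 1) ^ 2"
      if "norm (fps_deriv (fps_deriv u) $ a) \<le> B * w a" "0 \<le> B" for u :: "complex fps" and B a
    proof -
      define n where "n = real (a + k)"
      have n1: "1 \<le> n" using k by (simp add: n_def)
      have "fps_deriv (fps_deriv u) $ a = of_real (real (a + 1) * real (a + 2)) * u $ (a + 2)"
        by (simp add: algebra_simps)
      then have "real (a + 1) * real (a + 2) * norm (u $ (a + 2)) \<le> B * w a"
        using that(1) by (simp add: norm_mult del: of_nat_Suc of_nat_add)
      then have "(n + 1) * (n + 2) * (real (a + 1) * real (a + 2) * norm (u $ (a + 2))) \<le> (n + 1) * (n + 2) * (B * w a)"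
        using n1 by (intro mult_left_mono) auto
      also have "\<dots> = B * (real (a + k + 1) * real (a + k + 2) * w a)" by (simp add: n_def algebra_simps)
      also have "\<dots> \<le> B * (16 * (real (a + 1) * real (a + 2) * w (a + 2)))"
        by (intro mult_left_mono dn2 that)
      finally have "(real (a + 1) * real (a + 2)) * ((n + 1) * (n + 2) * norm (u $ (a + 2))) \<le>
          (real (a + 1) * real (a + 2)) * (16 * B * w (a + 2))"
        by (simp add: ac_simps)
      then have *: "(n + 1) * (n + 2) * norm (u $ (a + 2)) \<le> 16 * B * w (a + 2)"
        by (simp add: mult_le_cancel_left)
      have "(n + 3)\<^sup>2 \<le> 3 * ((n + 1) * (n + 2))"
      proof -
        have "3 * ((n + 1) * (n + 2)) - (n + 3)\<^sup>2 = 2 * (n * n) + 3 * n - 3"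
          by (simp add: power2_eq_square algebra_simps)
        moreover have "1 \<le> n * n" using n1 mult_mono[of 1 n 1 n] by simp
        ultimately show ?thesis using n1 by linarith
      qed
      then have "(n + 3)\<^sup>2 * norm (u $ (a + 2)) \<le> 3 * ((n + 1) * (n + 2)) * norm (u $ (a + 2))"
        by (rule mult_right_mono) simp
      also have "\<dots> \<le> 48 * B * w (a + 2)" using * by simp
      finally have "norm (u $ (a + 2)) * (n + 3)\<^sup>2 \<le> 48 * B * w (a + 2)" by (simp add: ac_simps)
      moreover have nn: "real (a + 2 + k + 1) = n + 3" by (simp add: n_def)
      moreover have "0 < (n + 3)\<^sup>2" using n1 by simp
      ultimately show ?thesis unfolding nn by (simp only: pos_le_divide_eq)
    qed
    define y where "y = q * D * w 0"
    have w0: "0 \<le> D * w 0" using D w[of 0] by simp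
    have h: "real k ^ 2 * norm (g $ 0) \<le> R * y \<and> k * norm (g $ 1) \<le> R * y \<and> real k ^ 2 * norm (f $ 0) \<le> R * y \<and> k * norm (f $ 1) \<le> R * y"
    proof -
      have k1: "1 \<le> real k" using k by simp
      have e1: "norm (e $ c $ 1) \<le> real k * (2 * s * (D * w 0))" if "c \<le> 3" for c
      proof -
        have "norm (e $ c $ 1) \<le> D * w 1" using e[OF that] .
        also have "\<dots> \<le> D * (real (k + 1) * s * w 0)" using up[of 0] D by (intro mult_left_mono) auto
        also have "\<dots> = real (k + 1) * (s * (D * w 0))" by simp
        also have "\<dots> \<le> (2 * real k) * (s * (D * w 0))"
          using k1 s w0 by (intro mult_right_mono) auto
        finally show ?thesis by (simp add: ac_simps)
      qed
      have ge: "v \<le> real k * v" if "0 \<le> v" for v using k1 that by (simp add: mult_le_cancel_right1)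
      have Y: "y = 2 * (D * w 0) + 3 * norm (\<Phi> 0 0 3) * (D * w 0) + 4 * norm (\<Phi> 0 0 4) * (D * w 0) + 2 * s * (D * w 0)"
        by (simp add: y_def q_def algebra_simps)
      have p: "0 \<le> norm (\<Phi> 0 0 3) * (D * w 0)" "0 \<le> norm (\<Phi> 0 0 4) * (D * w 0)" "0 \<le> s * (D * w 0)"
        using w0 s by auto
      have y1: "D * w 0 \<le> y" unfolding Y using p w0 by linarith
      have m: "norm (b * e $ c $ 0) \<le> norm b * (D * w 0)" if "c \<le> 3" for b c
        using e[OF that, of 0] by (simp add: norm_mult mult_left_mono)
      have n1: "norm (e $ 2 $ 0) \<le> y" "norm (- e $ 3 $ 0) \<le> y"
        using e[of 2 0] e[of 3 0] y1 by auto
      have n2: "norm (2 * of_nat k * e $ 1 $ 0 - 3 * \<Phi> 0 0 3 * e $ 0 $ 0 - e $ 2 $ 1) \<le> real k * y"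
      proof -
        have "norm (2 * of_nat k * e $ 1 $ 0 - 3 * \<Phi> 0 0 3 * e $ 0 $ 0 - e $ 2 $ 1) \<le>
            norm (2 * of_nat k :: complex) * (D * w 0) + norm (3 * \<Phi> 0 0 3) * (D * w 0) + real k * (2 * s * (D * w 0))"
          by (intro order_trans[OF norm_triangle_ineq4] add_mono m e1) auto
        also have "\<dots> \<le> real k * (2 * (D * w 0)) + real k * (3 * norm (\<Phi> 0 0 3) * (D * w 0)) + real k * (2 * s * (D * w 0))"
          using ge[OF p(1)] by (simp add: norm_mult)
        also have "\<dots> = real k * (2 * (D * w 0) + 3 * norm (\<Phi> 0 0 3) * (D * w 0) + 2 * s * (D * w 0))"
          by (simp add: algebra_simps)
        also have "\<dots> \<le> real k * y" unfolding Y
        proof (rule mult_left_mono)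
          show "2 * (D * w 0) + 3 * norm (\<Phi> 0 0 3) * (D * w 0) + 2 * s * (D * w 0) \<le> 2 * (D * w 0)
            + 3 * norm (\<Phi> 0 0 3) * (D * w 0) + 4 * norm (\<Phi> 0 0 4) * (D * w 0) + 2 * s * (D * w 0)"
            using p by linarith
        qed simp
        finally show ?thesis .
      qed
      have n4: "norm (- \<Phi> 0 0 3 * e $ 1 $ 0 - 4 * \<Phi> 0 0 4 * e $ 0 $ 0 - e $ 3 $ 1) \<le> real k * y"
      proof -
        have "norm (- \<Phi> 0 0 3 * e $ 1 $ 0 - 4 * \<Phi> 0 0 4 * e $ 0 $ 0 - e $ 3 $ 1) \<le>
            norm (- \<Phi> 0 0 3) * (D * w 0) + norm (4 * \<Phi> 0 0 4) * (D * w 0) + real k * (2 * s * (D * w 0))"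
          by (intro order_trans[OF norm_triangle_ineq4] add_mono m e1) auto
        also have "\<dots> \<le> real k * (norm (\<Phi> 0 0 3) * (D * w 0)) + real k * (4 * norm (\<Phi> 0 0 4) * (D * w 0)) + real k * (2 * s * (D * w 0))"
          using ge[OF p(1)] ge[OF p(2)] by (simp add: norm_mult)
        also have "\<dots> = real k * (norm (\<Phi> 0 0 3) * (D * w 0) + 4 * norm (\<Phi> 0 0 4) * (D * w 0) + 2 * s * (D * w 0))"
          by (simp add: algebra_simps)
        also have "\<dots> \<le> real k * y" unfolding Y
        proof (rule mult_left_mono)
          show "norm (\<Phi> 0 0 3) * (D * w 0) + 4 * norm (\<Phi> 0 0 4) * (D * w 0) + 2 * s * (D * w 0) \<le> 2 * (D * w 0)
            + 3 * norm (\<Phi> 0 0 3) * (D * w 0) + 4 * norm (\<Phi> 0 0 4) * (D * w 0) + 2 * s * (D * w 0)"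
            using p w0 by linarith
        qed simp
        finally show ?thesis .
      qed
      show ?thesis
        using R(2)[OF k, unfolded res_bound_def] r[unfolded res_rhs_def] n1 n2 n4 by blast
    qed
    have first: "norm (u $ a) \<le> G * D * w a / real (a + k + 1) ^ 2"
      if "a < 2" "real k ^ 2 * norm (u $ 0) \<le> R * y" "k * norm (u $ 1) \<le> R * y" for a and u :: "complex fps"
    proof (cases "a = 0")
      case True
      have "(real k + 1) ^ 2 \<le> (2 * real k) ^ 2" using k by (intro power_mono) auto
      then have "norm (u $ 0) * (real k + 1) ^ 2 \<le> 4 * (real k ^ 2 * norm (u $ 0))"
        using mult_left_mono[of "(real k + 1) ^ 2" "(2 * real k) ^ 2" "norm (u $ 0)"] by (simp add: power_mult_distrib ac_simps)
      also have "\<dots> \<le> 4 * (R * y)" using that by simp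
      also have "\<dots> = (4 * R * q) * (D * w 0)" by (simp add: y_def)
      also have "\<dots> \<le> G * (D * w 0)" unfolding G_def using R q w0 by (intro mult_right_mono) auto
      finally have *: "norm (u $ 0) * (real k + 1) ^ 2 \<le> G * D * w 0" by (simp add: mult.assoc)
      have "real (a + k + 1) = real k + 1" using True by simp
      moreover have "0 < (real k + 1)\<^sup>2" by simp
      ultimately show ?thesis using * True by (simp only: pos_le_divide_eq)
    next
      case False
      then have a: "a = 1" using that by simp
      define m where "m = real k"
      have m: "1 \<le> m" using k by (simp add: m_def)
      have "(m + 2)\<^sup>2 * norm (u $ 1) \<le> (5 * (m + 1)) * (m * norm (u $ 1))"
      proof -
        have "5 * (m + 1) * m - (m + 2)\<^sup>2 = 4 * (m * m) + m - 4" by (simp add: power2_eq_square algebra_simps)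
        moreover have "1 \<le> m * m" using m mult_mono[of 1 m 1 m] by simp
        ultimately have "(m + 2)\<^sup>2 \<le> 5 * (m + 1) * m" using m by linarith
        from mult_right_mono[OF this norm_ge_zero[of "u $ 1"]] show ?thesis by (simp add: mult.assoc)
      qed
      also have "\<dots> \<le> (5 * (m + 1)) * (R * y)" using that m by (intro mult_left_mono) (auto simp: m_def)
      also have "\<dots> = 5 * R * q * D * ((m + 1) * w 0)" by (simp add: y_def algebra_simps)
      also have "\<dots> \<le> 5 * R * q * D * (4 * w 1)"
        using dn[of 0] R q D by (intro mult_left_mono) (auto simp: m_def algebra_simps)
      also have "\<dots> = (20 * R * q) * (D * w 1)" by simp
      also have "\<dots> \<le> G * (D * w 1)" unfolding G_def using R q D w[of 1] by (intro mult_right_mono) auto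
      finally have "norm (u $ 1) * (m + 2)\<^sup>2 \<le> G * D * w 1" by (simp add: ac_simps)
      moreover have "real (a + k + 1) = m + 2" using a by (simp add: m_def)
      moreover have "0 < (m + 2)\<^sup>2" using m by simp
      ultimately show ?thesis using a by (simp only: pos_le_divide_eq)
    qed
    have gb: "norm (g $ a) \<le> G * D * w a / real (a + k + 1) ^ 2" for a
    proof (cases "a < 2")
      case True
      then show ?thesis using first h by blast
    next
      case False
      then obtain b where a: "a = b + 2" by (metis add.commute le_Suc_ex not_less)
      have "norm (g $ a) \<le> 48 * D * w a / real (a + k + 1) ^ 2"
        using second[of g b D] e[of 0 b] D by (simp add: g2 a)
      also have "\<dots> \<le> G * D * w a / real (a + k + 1) ^ 2"
        using G D w[of a] by (intro divide_right_mono mult_right_mono) auto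
      finally show ?thesis .
    qed
    have g1: "norm (fps_deriv g $ a) \<le> G * D * s * w a / real (a + k + 2)" for a
    proof -
      define n where "n = real (a + k + 2)"
      have n: "0 < n" by (simp add: n_def)
      have GD: "0 \<le> G * D" using G D by simp
      have "norm (fps_deriv g $ a) = real (a + 1) * norm (g $ (a + 1))"
        by (simp add: norm_mult del: of_nat_Suc)
      also have "\<dots> \<le> real (a + 1) * (G * D * w (a + 1) / n\<^sup>2)"
        using gb[of "a + 1"] by (intro mult_left_mono) (auto simp: n_def algebra_simps)
      also have "\<dots> = G * D * (real (a + 1) * w (a + 1)) / n\<^sup>2" by simp
      also have "\<dots> \<le> G * D * (real (a + k + 1) * s * w a) / n\<^sup>2"
        by (intro divide_right_mono mult_left_mono up GD) auto
      also have "\<dots> \<le> G * D * (n * s * w a) / n\<^sup>2"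
        using s w[of a] by (intro divide_right_mono mult_left_mono mult_right_mono GD) (auto simp: n_def)
      also have "\<dots> = G * D * s * w a / n" using n by (simp add: power2_eq_square)
      finally show ?thesis by (simp add: n_def)
    qed
    have GDs: "0 \<le> G * D * s" using G D s by simp
    have g1': "norm (fps_deriv g $ a) \<le> G * D * s * w a" for a
    proof (rule order_trans[OF g1])
      show "G * D * s * w a / real (a + k + 2) \<le> G * D * s * w a"
      proof -
        have "0 \<le> G * D * s * w a" using GDs w[of a] by simp
        then have "G * D * s * w a / real (a + k + 2) \<le> G * D * s * w a / 1"
          by (intro divide_left_mono) auto
        then show ?thesis by simp
      qed
    qed
    have fb: "norm (fps_deriv (fps_deriv f) $ a) \<le> (1 + 2 * G * s + 2 * G * s * CA) * D * w a" for a
    proof -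
      have "norm ((A * fps_deriv g) $ a) \<le> (\<Sum>i\<le>a. norm (\<Phi> i 0 2) * norm (fps_deriv g $ (a - i)))"
        unfolding fps_mult_nth atLeast0AtMost by (intro sum_norm_le) (simp add: A_def norm_mult)
      also have "\<dots> \<le> (\<Sum>i\<le>a. norm (\<Phi> i 0 2) * (G * D * s * w (a - i)))"
        by (intro sum_mono mult_left_mono g1') auto
      also have "\<dots> = G * D * s * (\<Sum>i\<le>a. norm (\<Phi> i 0 2) * w (a - i))"
        by (simp add: sum_distrib_left algebra_simps)
      also have "\<dots> \<le> G * D * s * (CA * w a)" by (intro mult_left_mono cv GDs)
      finally have Ag: "norm ((A * fps_deriv g) $ a) \<le> G * D * s * CA * w a" by (simp add: mult.assoc)
      \<comment> \<open>The factor k + 1 in the equation for f'' is absorbed by the denominator a +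
        k + 2 that g' still carries.\<close>
      have "real (k + 1) * norm (fps_deriv g $ a) \<le> real (a + k + 2) * (G * D * s * w a / real (a + k + 2))"
        by (intro mult_mono g1) auto
      then have kg: "real (k + 1) * norm (fps_deriv g $ a) \<le> G * D * s * w a"
        by (simp del: of_nat_add)
      have f2a: "fps_deriv (fps_deriv f) $ a = 2 * (of_nat (k + 1) * fps_deriv g $ a) - 2 * (A * fps_deriv g) $ a - e $ 1 $ a"
        unfolding f2 by (simp add: fps_numeral_fps_const mult.assoc del: fps_deriv_nth fps_const_mult)
      have "norm (fps_deriv (fps_deriv f) $ a) \<le>
          norm (2 * (of_nat (k + 1) * fps_deriv g $ a)) + norm (2 * (A * fps_deriv g) $ a) + norm (e $ 1 $ a)"
        unfolding f2a by (intro order_trans[OF norm_triangle_ineq4] add_right_mono norm_triangle_ineq4)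
      also have "\<dots> = 2 * (real (k + 1) * norm (fps_deriv g $ a)) + 2 * norm ((A * fps_deriv g) $ a) + norm (e $ 1 $ a)"
        by (simp only: norm_mult norm_numeral norm_of_nat)
      also have "\<dots> \<le> 2 * (G * D * s * w a) + 2 * (G * D * s * CA * w a) + D * w a"
        using kg Ag e[of 1 a] by linarith
      finally show ?thesis by (simp add: algebra_simps)
    qed
    have Cw: "G * D * w a / real (a + k + 1) ^ 2 \<le> C * D * w a / real (a + k + 1) ^ 2"
      using C D w[of a] by (intro divide_right_mono mult_right_mono) auto
    have "norm (f $ a) \<le> C * D * w a / real (a + k + 1) ^ 2"
    proof (cases "a < 2")
      case True
      then show ?thesis using first h Cw by (meson order_trans)
    next
      case False
      then obtain b where a: "a = b + 2" by (metis add.commute le_Suc_ex not_less)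
      have "norm (f $ a) \<le> 48 * ((1 + 2 * G * s + 2 * G * s * CA) * D) * w a / real (a + k + 1) ^ 2"
        using second[of f b "(1 + 2 * G * s + 2 * G * s * CA) * D"] fb[of b] D G s CA by (simp add: a)
      also have "\<dots> \<le> C * D * w a / real (a + k + 1) ^ 2"
      proof (intro divide_right_mono mult_right_mono)
        have "48 * (1 + 2 * G * s + 2 * G * s * CA) \<le> C" using G by (simp add: C_def)
        from mult_right_mono[OF this D] show "48 * ((1 + 2 * G * s + 2 * G * s * CA) * D) \<le> C * D" by (simp only: mult.assoc)
      qed (use w[of a] in auto)
      finally show ?thesis .
    qed
    then show ?thesis using gb[of a] Cw by linarith
  qed
  show ?thesis
    apply (intro exI[of _ C] conjI[of "0 \<le> C"])
    subgoal using C G by linarith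
    apply (intro allI impI)
    apply (elim conjE)
    apply (rule main; blast)
    done
qed

section \<open>The formal normal form\<close>

definition trunc_w :: "nat \<Rightarrow> ps2 \<Rightarrow> ps2" where "trunc_w k u = (\<lambda>a b. if b < k then u a b else 0)"

lemma col_trunc_w: "col (trunc_w k u) b = (if b < k then col u b else 0)"
  by (simp add: fps_eq_iff trunc_w_def)

lemma jet_trunc_w: "0 < k \<Longrightarrow> jet k u (trunc_w k u) (col u k) (col u 0)"
  by (auto simp: jet_def col_trunc_w)

lemma jet_refl: "jet k u u 0 (col u 0)"
  by (simp add: jet_def)

lemma ps2_eqI: "(\<And>b. col u b = col v b) \<Longrightarrow> u = v"
  by (auto simp: fps_eq_iff)

text \<open>Equivalently F = z + O(w) and G = w + O(w^2): the point at which the linearization is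
  taken.\<close>

definition unipotent :: "ps2 \<Rightarrow> ps2 \<Rightarrow> bool" where
  "unipotent F \<gamma> \<longleftrightarrow> col F 0 = fps_X \<and> col \<gamma> 0 = 1"

lemma defect_nth:
  assumes "unipotent F \<gamma>" "0 < k"
  shows "defect \<Phi> F \<gamma> $ k =
    defect \<Phi> (trunc_w k F) (trunc_w k \<gamma>) $ k + lin_defect \<Phi> k (col F k) (col \<gamma> k)"
proof -
  have "jet k F (trunc_w k F) (col F k) fps_X" "jet k \<gamma> (trunc_w k \<gamma>) (col \<gamma> k) 1"
    using jet_trunc_w[OF assms(2), of F] jet_trunc_w[OF assms(2), of \<gamma>] assms(1) by (simp_all add: unipotent_def)
  then show ?thesis by (rule tay_nth[OF tay_defect(3)[OF assms(2)]])
qed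

text \<open>Only the values at w = 0 carried by \<open>tay\<close> are read off, from the zero
  perturbation at order 1.\<close>

lemma unipotent_nth_0:
  assumes "unipotent F \<gamma>"
  shows "defect \<Phi> F \<gamma> $ 0 = 0" "jac F \<gamma> $ 0 = 1" "pull \<Phi> F \<gamma> $ 0 = restr \<Phi>"
proof -
  have "jet 1 F F 0 fps_X" "jet 1 \<gamma> \<gamma> 0 1"
    using assms jet_refl[of 1 F] jet_refl[of 1 \<gamma>] by (simp_all add: unipotent_def)
  note T = tay_defect[OF zero_less_one this]
  show "defect \<Phi> F \<gamma> $ 0 = 0" "jac F \<gamma> $ 0 = 1" "pull \<Phi> F \<gamma> $ 0 = restr \<Phi>"
    using tay_0[OF T(3)] tay_0[OF T(2)] tay_0[OF T(1)] by auto
qed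

text \<open>The unknown ODE N is eliminated here; \<open>normal_form\<close> recovers it from F and
  \<gamma>.\<close>

definition solves :: "ps3 \<Rightarrow> ps2 \<Rightarrow> ps2 \<Rightarrow> bool" where
  "solves \<Phi> F \<gamma> \<longleftrightarrow> unipotent F \<gamma> \<and> (\<forall>k. in_ideal (defect \<Phi> F \<gamma> $ k))"

lemma in_ideal_0: "in_ideal 0"
  by (simp add: in_ideal_def)

lemma solves_unique:
  assumes \<Phi>: "in_E1 \<Phi>" "nonresonant \<Phi>" and s: "solves \<Phi> F \<gamma>" "solves \<Phi> F' \<gamma>'"
  shows "F = F' \<and> \<gamma> = \<gamma>'"
proof -
  have "col F k = col F' k \<and> col \<gamma> k = col \<gamma>' k" for k
  proof (induction k rule: less_induct)
    case (less k)
    show ?case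
    proof (cases "k = 0")
      case True
      then show ?thesis using s by (simp add: solves_def unipotent_def)
    next
      case False
      then have k: "k \<ge> 1" by simp
      have "trunc_w k F = trunc_w k F'" "trunc_w k \<gamma> = trunc_w k \<gamma>'"
        using less by (auto intro!: ps2_eqI simp: col_trunc_w)
      then have "in_ideal (defect \<Phi> (trunc_w k F) (trunc_w k \<gamma>) $ k + lin_defect \<Phi> k (col F k) (col \<gamma> k))"
        "in_ideal (defect \<Phi> (trunc_w k F) (trunc_w k \<gamma>) $ k + lin_defect \<Phi> k (col F' k) (col \<gamma>' k))"
        using s defect_nth[of F \<gamma> k \<Phi>] defect_nth[of F' \<gamma>' k \<Phi>] k
        unfolding solves_def by (metis False neq0_conv)+
      then have "(col F k, col \<gamma> k) = (col F' k, col \<gamma>' k)"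
        using ex1_solution[OF \<Phi> k, of "defect \<Phi> (trunc_w k F) (trunc_w k \<gamma>) $ k"]
        by (metis (no_types, lifting) fst_conv snd_conv)
      then show ?thesis by simp
    qed
  qed
  then show ?thesis by (auto intro!: ps2_eqI)
qed

lemma solves_exists:
  assumes \<Phi>: "in_E1 \<Phi>" "nonresonant \<Phi>"
  shows "\<exists>F \<gamma>. solves \<Phi> F \<gamma>"
proof -
  define step where "step k u = (SOME fg. in_ideal (defect \<Phi> (fst u) (snd u) $ k + lin_defect \<Phi> k (fst fg) (snd fg)))"
    for k and u :: "ps2 \<times> ps2"
  define ext :: "nat \<Rightarrow> ps2 \<Rightarrow> complex fps \<Rightarrow> ps2" where "ext k u f = (\<lambda>a b. if b = k then f $ a else u a b)" for k u f
  \<comment> \<open>\<open>U n\<close> holds the columns 0 to n and zeros above, so it is the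
    truncation at n + 1 of the pair defined by the diagonal.\<close>
  define U where "U = rec_nat (ext 0 (\<lambda>a b. 0) fps_X, ext 0 (\<lambda>a b. 0) 1)
     (\<lambda>n u. (ext (Suc n) (fst u) (fst (step (Suc n) u)), ext (Suc n) (snd u) (snd (step (Suc n) u))))"
  have U0: "U 0 = (ext 0 (\<lambda>a b. 0) fps_X, ext 0 (\<lambda>a b. 0) 1)"
    and US: "U (Suc n) = (ext (Suc n) (fst (U n)) (fst (step (Suc n) (U n))), ext (Suc n) (snd (U n)) (snd (step (Suc n) (U n))))" for n
    by (simp_all add: U_def)
  have z: "b > n \<Longrightarrow> fst (U n) a b = 0 \<and> snd (U n) a b = 0" for n a b
    by (induction n) (auto simp: U0 US ext_def)
  have st: "b \<le> n \<Longrightarrow> fst (U n) a b = fst (U b) a b \<and> snd (U n) a b = snd (U b) a b" for n a b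
    by (induction n) (auto simp: U0 US ext_def le_Suc_eq)
  define F where "F = (\<lambda>a b. fst (U b) a b)"
  define \<gamma> where "\<gamma> = (\<lambda>a b. snd (U b) a b)"
  have c: "trunc_w (Suc n) F = fst (U n)" "trunc_w (Suc n) \<gamma> = snd (U n)" for n
  proof -
    have "trunc_w (Suc n) F a b = fst (U n) a b \<and> trunc_w (Suc n) \<gamma> a b = snd (U n) a b" for a b
      using st[of b n a] z[of n b a] by (cases "b \<le> n") (simp_all add: trunc_w_def F_def \<gamma>_def)
    then show "trunc_w (Suc n) F = fst (U n)" "trunc_w (Suc n) \<gamma> = snd (U n)" by (auto intro!: ext)
  qed
  have u: "unipotent F \<gamma>"
    by (simp add: unipotent_def fps_eq_iff F_def \<gamma>_def U0 ext_def)
  have "in_ideal (defect \<Phi> F \<gamma> $ k)" for k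
  proof (cases k)
    case 0
    then show ?thesis using unipotent_nth_0(1)[OF u] by (simp add: in_ideal_0)
  next
    case (Suc n)
    have "col F k = fst (step k (U n))" "col \<gamma> k = snd (step k (U n))"
      by (simp_all add: fps_eq_iff F_def \<gamma>_def Suc US ext_def)
    then have "defect \<Phi> F \<gamma> $ k = defect \<Phi> (fst (U n)) (snd (U n)) $ k +
        lin_defect \<Phi> k (fst (step k (U n))) (snd (step k (U n)))"
      using defect_nth[OF u, of k \<Phi>] c[of n] by (simp add: Suc)
    moreover have "in_ideal (defect \<Phi> (fst (U n)) (snd (U n)) $ k +
        lin_defect \<Phi> k (fst (step k (U n))) (snd (step k (U n))))"
      unfolding step_def
    proof (rule someI_ex)
      show "\<exists>fg. in_ideal (defect \<Phi> (fst (U n)) (snd (U n)) $ k + lin_defect \<Phi> k (fst fg) (snd fg))"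
        using ex1_solution[OF \<Phi>, of k "defect \<Phi> (fst (U n)) (snd (U n)) $ k"] Suc by (simp only: Ex1_def) auto
    qed
    ultimately show ?thesis by simp
  qed
  then show ?thesis using u unfolding solves_def by blast
qed

section \<open>Stability of the ideal, and passage between morphisms and solutions\<close>

lemma in_ideal_add: "in_ideal x \<Longrightarrow> in_ideal y \<Longrightarrow> in_ideal (x + y)"
  by (simp add: in_ideal_def)

lemma in_ideal_sum: "(\<And>i. i \<in> I \<Longrightarrow> in_ideal (f i)) \<Longrightarrow> in_ideal (sum f I)"
  by (induction I rule: infinite_finite_induct) (auto simp: in_ideal_0 in_ideal_add)

lemma in_ideal_mult: "in_ideal y \<Longrightarrow> in_ideal (x * y)"
  unfolding in_ideal_def
  by (simp add: fps_mult_nth numeral_2_eq_2 numeral_3_eq_3)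

text \<open>Multiplying by \<open>jac\<close> and by its inverse carries the normal form conditions
  to the defect and back.\<close>

lemma in_ideal_mult3: "(\<And>k. in_ideal (Y $ k)) \<Longrightarrow> in_ideal ((X * Y :: ser3) $ k)"
  unfolding fps_mult_nth by (intro in_ideal_sum in_ideal_mult)

text \<open>At w = 0 the series C is divisible by \<zeta>, and only powers of C with exponent at
  least 2 contribute. This much is known before F is shown to be the identity at w = 0.\<close>

lemma subst3_nth_0_low:
  assumes "in_E1 P" "C $ 0 $ 0 = 0" "c < 2"
  shows "subst3 P A B C $ 0 $ c = 0"
proof -
  obtain q where C: "C $ 0 = fps_X * q"
  proof
    show "C $ 0 = fps_X * fps_shift 1 (C $ 0)"
      using assms(2) by (auto simp: fps_eq_iff)
  qed
  have Z: "P i j k * (A ^ i * B ^ j * C ^ k) $ 0 $ c $ a = 0" for i j k a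
  proof (cases "k < 2")
    case True
    then show ?thesis using assms(1) by (simp add: in_E1_def)
  next
    case False
    have "(A ^ i * B ^ j * C ^ k) $ 0 = (A $ 0) ^ i * (B $ 0) ^ j * (fps_X * q) ^ k"
      by (simp add: fps_power_zeroth C)
    also have "\<dots> = fps_X ^ k * ((A $ 0) ^ i * (B $ 0) ^ j * q ^ k)"
      by (simp add: power_mult_distrib ac_simps)
    finally show ?thesis using False assms(3) by (simp add: fps_X_power_mult_nth)
  qed
  then show ?thesis unfolding fps_eq_iff subst3_def by (simp add: Z del: fps_mult_nth_0 mult_eq_0_iff)
qed

lemma emb_dz_nth_0: "emb (dz u) $ 0 = fps_const (fps_deriv (col u 0))"
  by (simp add: emb_nth_col col_dz)

lemma emb_th_nth_0: "emb (th u) $ 0 = 0"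
  by (simp add: emb_nth_col col_th)

text \<open>A morphism prescribes F only to first order at the origin. At w = 0 the \<zeta>^1
  coefficient of the law reads F_zz(z,0) = 0, because \<Phi> and N start with \<zeta>^2; hence
  F(z,0) is affine, and the normalization makes it z.\<close>

lemma transform_unipotent:
  assumes \<Phi>: "in_E1 \<Phi>" "in_E1 N" and F: "F 0 0 = 0" "F 1 0 = 1" and \<gamma>: "col \<gamma> 0 = 1"
    and eq: "jac F \<gamma> * ser N = pull \<Phi> F \<gamma>"
  shows "unipotent F \<gamma>"
proof -
  define f1 where "f1 = fps_deriv (col F 0)"
  have f10: "f1 $ 0 = 1" using F by (simp add: f1_def)
  then have f1: "f1 \<noteq> 0" by auto
  note 0 = emb_th_nth_0 emb_dz_nth_0
  have DF: "DF F $ 0 = fps_const f1" by (simp add: DF_def 0 f1_def)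
  have e: "emb \<gamma> $ 0 = 1" by (simp add: emb_nth_col \<gamma>)
  have num: "num \<gamma> $ 0 = fps_X" by (simp add: num_def 0 \<gamma> zet_def e)
  have "(emb \<gamma> * DF F) * inv3 (emb \<gamma> * DF F) = 1"
    by (rule inv3) (simp add: DF e f10)
  then have "sig F \<gamma> * (emb \<gamma> * DF F) = num \<gamma>"
    unfolding sig_def by (metis mult.assoc mult.commute mult.right_neutral)
  then have "sig F \<gamma> $ 0 * fps_const f1 = fps_X"
    by (metis DF e fps_mult_nth_0 mult_1 num)
  then have "(sig F \<gamma> $ 0 * fps_const f1) $ 0 = 0" by simp
  then have s: "sig F \<gamma> $ 0 $ 0 = 0" using f1 by simp
  note low = subst3_nth_0_low[OF \<Phi>(1) s, of _ "emb F" "wv * emb \<gamma>"]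
  have "sec F \<gamma> $ 0 = - (fps_X * fps_const (fps_deriv f1))"
    unfolding sec_def by (simp add: 0 num \<gamma> col_dz f1_def)
  then have "pull \<Phi> F \<gamma> $ 0 $ 1 = fps_deriv f1"
    unfolding pull_def using low[of 0] low[of 1] by (simp add: fps_mult_nth_1)
  moreover have "(jac F \<gamma> * ser N) $ 0 $ 1 = 0"
  proof -
    have "ser N $ 0 $ 0 = 0" "ser N $ 0 $ 1 = 0"
      using \<Phi>(2) by (auto simp: fps_eq_iff in_E1_def)
    then show ?thesis by (simp add: fps_mult_nth_1)
  qed
  ultimately have "fps_deriv f1 = 0" using eq by simp
  then have *: "of_nat (Suc (Suc n)) * of_nat (Suc n) * F (Suc (Suc n)) 0 = 0" for n
    by (simp add: f1_def fps_eq_iff del: of_nat_Suc)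
  have "F n 0 = (if n = 1 then 1 else 0)" for n
  proof (cases n)
    case (Suc m)
    then show ?thesis using F *[of "m - 1"] by (cases m) (simp_all del: of_nat_Suc)
  qed (simp add: F)
  then have "col F 0 = fps_X" by (simp add: fps_eq_iff fps_X_def)
  then show ?thesis using \<gamma> by (simp add: unipotent_def)
qed

definition shift_w :: "ps2 \<Rightarrow> ps2" where "shift_w G = (\<lambda>a b. G a (Suc b))"
definition times_w :: "ps2 \<Rightarrow> ps2" where "times_w \<gamma> = (\<lambda>a b. if b = 0 then 0 else \<gamma> a (b - 1))"

text \<open>The law turns the defect into \<open>jac\<close> times N - \<Phi>(z,0,\<zeta>), and the
  second factor has its coefficients in the ideal.\<close>

lemma Hom_solves:
  assumes \<Phi>: "in_E1 \<Phi>" and N: "in_D1 N" and H: "(F, G) \<in> Hom N \<Phi>"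
  shows "solves \<Phi> F (shift_w G)" "G = times_w (shift_w G)"
    "jac F (shift_w G) * ser N = pull \<Phi> F (shift_w G)"
proof -
  define \<gamma> where "\<gamma> = shift_w G"
  have sh: "hom_shape F G" and tr: "transforms N \<Phi> F G" and E: "in_E1 N"
    using H by (auto simp: Hom_def)
  show "G = times_w (shift_w G)"
    using sh by (auto simp: times_w_def shift_w_def hom_shape_def fun_eq_iff gr0_conv_Suc)
  show eq: "jac F (shift_w G) * ser N = pull \<Phi> F (shift_w G)"
    using transforms_iff[of G F N \<Phi>] tr sh by (simp add: shift_w_def hom_shape_def)
  have \<gamma>0: "col \<gamma> 0 = 1"
    using sh by (auto simp: fps_eq_iff \<gamma>_def shift_w_def hom_shape_def fps_one_nth)
  have u: "unipotent F \<gamma>"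
    by (rule transform_unipotent[OF \<Phi> E _ _ \<gamma>0]) (use sh eq in \<open>auto simp: hom_shape_def \<gamma>_def\<close>)
  note n0 = unipotent_nth_0[OF u]
  \<comment> \<open>At w = 0 both ODEs agree. This settles the order w^0, where \<open>in_D1\<close>
    only gives the conditions of \<open>in_E1\<close>.\<close>
  have "ser N $ 0 = restr \<Phi>"
    using arg_cong[OF eq, of "\<lambda>x. x $ 0"] n0 by (simp add: \<gamma>_def)
  then have "in_ideal ((ser N - fps_const (restr \<Phi>)) $ k)" for k
    using N by (cases "k = 0") (auto simp: in_ideal_0 in_ideal_def in_D1_def in_E1_def fps_eq_iff)
  then have "in_ideal ((jac F \<gamma> * (ser N - fps_const (restr \<Phi>))) $ k)" for k
    by (rule in_ideal_mult3)
  moreover have "defect \<Phi> F \<gamma> = jac F \<gamma> * (ser N - fps_const (restr \<Phi>))"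
    unfolding defect_def using eq by (simp add: \<gamma>_def algebra_simps)
  ultimately show "solves \<Phi> F (shift_w G)" using u by (simp add: solves_def \<gamma>_def)
qed

definition normal_form :: "ps3 \<Rightarrow> ps2 \<Rightarrow> ps2 \<Rightarrow> ps3" where
  "normal_form \<Phi> F \<gamma> = (\<lambda>a b c. (inv3 (jac F \<gamma>) * pull \<Phi> F \<gamma>) $ b $ c $ a)"

lemma jac_inv3: "unipotent F \<gamma> \<Longrightarrow> jac F \<gamma> * inv3 (jac F \<gamma>) = 1"
  by (rule inv3) (simp add: unipotent_nth_0)

lemma normal_form_unique:
  assumes "unipotent F \<gamma>" "jac F \<gamma> * ser N = pull \<Phi> F \<gamma>"
  shows "N = normal_form \<Phi> F \<gamma>"
proof -
  have "ser N = (jac F \<gamma> * inv3 (jac F \<gamma>)) * ser N"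
    using jac_inv3[OF assms(1)] by simp
  also have "\<dots> = inv3 (jac F \<gamma>) * pull \<Phi> F \<gamma>"
    unfolding assms(2)[symmetric] by (simp only: ac_simps)
  finally have "ser N = ser (normal_form \<Phi> F \<gamma>)" unfolding normal_form_def ser_surj .
  then show ?thesis by (simp only: ser_inj)
qed

text \<open>Dividing the defect by the unit \<open>jac\<close> gives N - \<Phi>(z,0,\<zeta>), so the
  ideal conditions pass to N; those at \<zeta>^0 and \<zeta>^1 yield \<open>in_E1\<close>.\<close>

lemma solves_Hom:
  assumes \<Phi>: "in_E1 \<Phi>" and s: "solves \<Phi> F \<gamma>"
  shows "in_D1 (normal_form \<Phi> F \<gamma>)" "(F, times_w \<gamma>) \<in> Hom (normal_form \<Phi> F \<gamma>) \<Phi>"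
proof -
  define N where "N = normal_form \<Phi> F \<gamma>"
  define J where "J = inv3 (jac F \<gamma>)"
  have u: "unipotent F \<gamma>" and id: "\<And>k. in_ideal (defect \<Phi> F \<gamma> $ k)" using s by (auto simp: solves_def)
  have J: "jac F \<gamma> * J = 1" unfolding J_def by (rule jac_inv3[OF u])
  have N: "ser N = J * pull \<Phi> F \<gamma>" unfolding N_def normal_form_def J_def by (rule ser_surj)
  have eq: "jac F \<gamma> * ser N = pull \<Phi> F \<gamma>"
  proof -
    have "jac F \<gamma> * ser N = (jac F \<gamma> * J) * pull \<Phi> F \<gamma>" unfolding N by (simp only: ac_simps)
    then show ?thesis by (simp add: J)
  qed
  have "J * defect \<Phi> F \<gamma> = ser N - (jac F \<gamma> * J) * fps_const (restr \<Phi>)"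
    unfolding defect_def N by (simp add: algebra_simps)
  then have "ser N = J * defect \<Phi> F \<gamma> + fps_const (restr \<Phi>)" by (simp add: J)
  then have id': "in_ideal ((ser N - fps_const (restr \<Phi>)) $ k)" for k
    using in_ideal_mult3[OF id, where X = J] by simp
  have E: "in_E1 N"
    unfolding in_E1_def
  proof (intro allI impI)
    fix a b c :: nat assume "c < 2"
    then have "c = 0 \<or> c = 1" by auto
    then have "(ser N - fps_const (restr \<Phi>)) $ b $ c = 0" "restr \<Phi> $ c = 0"
      using id'[of b] in_E1_restr[OF \<Phi> \<open>c < 2\<close>] by (auto simp: in_ideal_def)
    then have "ser N $ b $ c = 0" by (cases "b = 0") auto
    then have "ser N $ b $ c $ a = 0" by simp
    then show "N a b c = 0" by simp
  qed
  show D: "in_D1 (normal_form \<Phi> F \<gamma>)"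
    unfolding N_def[symmetric] in_D1_def
  proof (intro conjI allI impI E)
    fix j :: nat assume "0 < j"
    then have "in_ideal (ser N $ j)" using id'[of j] by simp
    then show "N 0 j 2 = 0" "N 1 j 2 = 0" "N 0 j 3 = 0" "N 1 j 3 = 0"
      by (simp_all add: in_ideal_def)
  qed
  have c: "F a 0 = (if a = 1 then 1 else 0)" "\<gamma> a 0 = (if a = 0 then 1 else 0)" for a
    using u col_nth[of F 0 a] col_nth[of \<gamma> 0 a] by (auto simp: unipotent_def)
  have sh: "hom_shape F (times_w \<gamma>)"
    unfolding hom_shape_def times_w_def by (auto simp: c)
  have sw: "(\<lambda>a b. times_w \<gamma> a (Suc b)) = \<gamma>" by (simp add: times_w_def)
  have "transforms N \<Phi> F (times_w \<gamma>)"
    by (subst transforms_iff) (auto simp: sw eq times_w_def c)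
  then show "(F, times_w \<gamma>) \<in> Hom (normal_form \<Phi> F \<gamma>) \<Phi>"
    using E \<Phi> sh by (simp add: Hom_def N_def)
qed

lemma formal_normal_form:
  assumes \<Phi>: "in_E1 \<Phi>" "nonresonant \<Phi>"
  obtains F \<gamma> where "solves \<Phi> F \<gamma>"
    "\<And>N. in_D1 N \<Longrightarrow> Hom N \<Phi> = (if N = normal_form \<Phi> F \<gamma> then {(F, times_w \<gamma>)} else {})"
    "in_D1 (normal_form \<Phi> F \<gamma>)"
proof -
  obtain F \<gamma> where s: "solves \<Phi> F \<gamma>" using solves_exists[OF \<Phi>] by blast
  have H: "F' = F \<and> G' = times_w \<gamma> \<and> N = normal_form \<Phi> F \<gamma>" if N: "in_D1 N" and h: "(F', G') \<in> Hom N \<Phi>" for N F' G'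
  proof -
    note h = Hom_solves[OF \<Phi>(1) N h]
    have e: "F' = F" "shift_w G' = \<gamma>" using solves_unique[OF \<Phi> h(1) s] by auto
    moreover have "N = normal_form \<Phi> F \<gamma>"
      by (rule normal_form_unique) (use s h(3) e in \<open>auto simp: solves_def\<close>)
    ultimately show ?thesis using h(2) by simp
  qed
  note S = solves_Hom[OF \<Phi>(1) s]
  have "Hom N \<Phi> = (if N = normal_form \<Phi> F \<gamma> then {(F, times_w \<gamma>)} else {})" if "in_D1 N" for N
  proof (cases "N = normal_form \<Phi> F \<gamma>")
    case True
    then have "Hom N \<Phi> = {(F, times_w \<gamma>)}" using H[OF that] S(2) by fast
    then show ?thesis using True by simp
  next
    case False
    then have "Hom N \<Phi> = {}" using H[OF that] by fast
    then show ?thesis using False by simp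
  qed
  then show ?thesis using that s S(1) by blast
qed

section \<open>Weighted majorants\<close>

text \<open>The convolution square of 1/(n+1)^2 is at most 8 times the sequence itself; the factor
  1/8 turns this into a bound with constant 1.\<close>

definition tau :: "nat \<Rightarrow> real" where "tau n = 1 / (8 * (real n + 1)\<^sup>2)"

lemma tau_pos: "0 < tau n" by (simp add: tau_def)

text \<open>With p + q = n + 2, the inequality (p + q)^2 \<le> 2 (p^2 + q^2) splits 1/(p^2 q^2) into
  two sums of inverse squares, each at most 2 by telescoping.\<close>

lemma tau_conv: "(\<Sum>i\<le>n. tau i * tau (n - i)) \<le> tau n"
proof -
  have sq: "(\<Sum>i\<le>n. 1 / (real i + 1)\<^sup>2) \<le> 2 - 1 / (real n + 1)" for n
  proof (induction n)
    case (Suc n)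
    define x where "x = real n + 1"
    have x: "1 \<le> x" by (simp add: x_def)
    have "1 / (x + 1)\<^sup>2 \<le> 1 / (x * (x + 1))"
      using x by (intro divide_left_mono) (auto simp: power2_eq_square)
    also have "\<dots> = 1 / x - 1 / (x + 1)" using x by (simp add: field_simps)
    finally show ?case using Suc by (simp add: x_def add_ac)
  qed simp
  have "(\<Sum>i\<le>n. 1 / ((real i + 1)\<^sup>2 * (real (n - i) + 1)\<^sup>2)) \<le> 8 / (real n + 1)\<^sup>2"
  proof -
    define N where "N = real n + 2"
    have N: "0 < N" by (simp add: N_def)
    have "1 / ((real i + 1)\<^sup>2 * (real (n - i) + 1)\<^sup>2) \<le>
        2 / N\<^sup>2 * (1 / (real i + 1)\<^sup>2 + 1 / (real (n - i) + 1)\<^sup>2)" if "i \<le> n" for i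
    proof -
      define p q where "p = real i + 1" and "q = real (n - i) + 1"
      have pq: "0 < p" "0 < q" "p + q = N" using that by (auto simp: p_def q_def N_def of_nat_diff)
      have "2 * (p\<^sup>2 + q\<^sup>2) - (p + q)\<^sup>2 = (p - q)\<^sup>2" by (simp add: power2_eq_square algebra_simps)
      then have "N\<^sup>2 \<le> 2 * (p\<^sup>2 + q\<^sup>2)" using zero_le_power2[of "p - q"] unfolding pq(3) by linarith
      then have "N\<^sup>2 / (N\<^sup>2 * (p\<^sup>2 * q\<^sup>2)) \<le> 2 * (p\<^sup>2 + q\<^sup>2) / (N\<^sup>2 * (p\<^sup>2 * q\<^sup>2))"
        by (intro divide_right_mono) auto
      moreover have "2 / N\<^sup>2 * (1 / p\<^sup>2 + 1 / q\<^sup>2) = 2 * (p\<^sup>2 + q\<^sup>2) / (N\<^sup>2 * (p\<^sup>2 * q\<^sup>2))"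
        using pq(1,2) N by (simp add: field_simps)
      moreover have "N\<^sup>2 / (N\<^sup>2 * (p\<^sup>2 * q\<^sup>2)) = 1 / (p\<^sup>2 * q\<^sup>2)" using N by simp
      ultimately show ?thesis by (simp add: p_def q_def)
    qed
    then have "(\<Sum>i\<le>n. 1 / ((real i + 1)\<^sup>2 * (real (n - i) + 1)\<^sup>2)) \<le>
       (\<Sum>i\<le>n. 2 / N\<^sup>2 * (1 / (real i + 1)\<^sup>2 + 1 / (real (n - i) + 1)\<^sup>2))"
      by (intro sum_mono) auto
    also have "\<dots> = 2 / N\<^sup>2 * ((\<Sum>i\<le>n. 1 / (real i + 1)\<^sup>2) + (\<Sum>i\<le>n. 1 / (real (n - i) + 1)\<^sup>2))"
      by (simp only: sum_distrib_left sum.distrib distrib_left)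
    also have "(\<Sum>i\<le>n. 1 / (real (n - i) + 1)\<^sup>2) = (\<Sum>i\<le>n. 1 / (real i + 1)\<^sup>2)"
      by (rule sum.reindex_bij_witness[of _ "\<lambda>i. n - i" "\<lambda>i. n - i"]) auto
    also have "2 / N\<^sup>2 * ((\<Sum>i\<le>n. 1 / (real i + 1)\<^sup>2) + (\<Sum>i\<le>n. 1 / (real i + 1)\<^sup>2)) \<le> 2 / N\<^sup>2 * (2 + 2)"
    proof (intro mult_left_mono add_mono)
      have "0 \<le> 1 / (real n + 1)" by simp
      then show "(\<Sum>i\<le>n. 1 / (real i + 1)\<^sup>2) \<le> 2" using sq[of n] by linarith
      then show "(\<Sum>i\<le>n. 1 / (real i + 1)\<^sup>2) \<le> 2" .
    qed simp
    also have "\<dots> \<le> 8 / (real n + 1)\<^sup>2"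
    proof -
      have "(real n + 1)\<^sup>2 \<le> N\<^sup>2" by (intro power_mono) (auto simp: N_def)
      then have "8 / N\<^sup>2 \<le> 8 / (real n + 1)\<^sup>2" using N by (intro divide_left_mono) auto
      then show ?thesis by simp
    qed
    finally show ?thesis .
  qed
  then have "1 / 64 * (\<Sum>i\<le>n. 1 / ((real i + 1)\<^sup>2 * (real (n - i) + 1)\<^sup>2)) \<le> 1 / 64 * (8 / (real n + 1)\<^sup>2)"
    by (intro mult_left_mono) auto
  then show ?thesis by (simp add: tau_def sum_distrib_left)
qed

lemma tau_Suc_le: "tau (Suc n) \<le> tau n"
proof -
  have "(real n + 1)\<^sup>2 \<le> (real n + 2)\<^sup>2" by (intro power_mono) auto
  then show ?thesis unfolding tau_def by (intro divide_left_mono) (auto simp: add_ac)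
qed

lemma tau_le_Suc: "tau n \<le> 4 * tau (Suc n)"
proof -
  have "(real n + 2)\<^sup>2 \<le> (2 * (real n + 1))\<^sup>2" by (intro power_mono) auto
  also have "\<dots> = 4 * (real n + 1)\<^sup>2" unfolding power_mult_distrib by simp
  finally have "(real n + 2)\<^sup>2 \<le> 4 * (real n + 1)\<^sup>2" .
  then have "(real n + 2)\<^sup>2 / (8 * (real n + 1)\<^sup>2 * (real n + 2)\<^sup>2) \<le> 4 * (real n + 1)\<^sup>2 / (8 * (real n + 1)\<^sup>2 * (real n + 2)\<^sup>2)"
    by (intro divide_right_mono) auto
  then have "1 / (8 * (real n + 1)\<^sup>2) \<le> 4 / (8 * (real n + 2)\<^sup>2)"
    by simp
  then show ?thesis by (simp add: tau_def add_ac)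
qed

text \<open>The factor e weighs the powers of w only through its submultiplicativity. Lowering it at
a single order k below its values at smaller orders turns a bound on a nonlinear expression into
a gain at order k.\<close>

locale weights =
  fixes s r t :: real and e :: "nat \<Rightarrow> real"
  assumes s: "1 \<le> s" and r: "0 < r" and t: "256 \<le> t"
    and e0: "e 0 = 1" and e_pos: "\<And>b. 0 < e b" and e_sub: "\<And>i j. e i * e j \<le> e (i + j)"
begin

text \<open>Without \<open>tau\<close> and \<open>e\<close> these are the coefficients of 1/(1 - s z
  - r w). F and \<gamma> do not depend on \<zeta>, so \<open>wt\<close> gives that variable a
  separate factor.\<close>

definition wt2 :: "nat \<Rightarrow> nat \<Rightarrow> real" where
  "wt2 a b = tau (a + b) * real ((a + b) choose a) * s ^ a * r ^ b * e b"
definition wt :: "nat \<Rightarrow> nat \<Rightarrow> nat \<Rightarrow> real" where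
  "wt a b c = wt2 a b * (tau c * t ^ c)"

lemma wt2_pos: "0 < wt2 a b"
  using tau_pos[of "a + b"] s r e_pos[of b] by (simp add: wt2_def)

lemma wt_pos: "0 < wt a b c"
  using wt2_pos[of a b] tau_pos[of c] t by (simp add: wt_def)

text \<open>Sorting by the total degree m = i + j lets Vandermonde's identity sum the binomials over
  i; \<open>tau_conv\<close> then sums over m.\<close>

lemma wt2_conv: "(\<Sum>i\<le>a. \<Sum>j\<le>b. wt2 i j * wt2 (a - i) (b - j)) \<le> wt2 a b"
proof -
  define N where "N = a + b"
  define h where "h i m = tau m * tau (N - m) * (real (m choose i) * real ((N - m) choose (a - i)))" for i m
  have h0: "0 \<le> h i m" for i m
    using tau_pos[of m] tau_pos[of "N - m"] by (simp add: h_def)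
  have step: "wt2 i j * wt2 (a - i) (b - j) \<le> s ^ a * r ^ b * e b * h i (i + j)" if "i \<le> a" "j \<le> b" for i j
  proof -
    have N1: "a - i + (b - j) = N - (i + j)" using that by (simp add: N_def)
    have "wt2 i j * wt2 (a - i) (b - j) = (s ^ i * s ^ (a - i)) * (r ^ j * r ^ (b - j)) * (e j * e (b - j)) * h i (i + j)"
      unfolding wt2_def N1 h_def by (simp add: ac_simps)
    also have "\<dots> = s ^ a * r ^ b * (e j * e (b - j)) * h i (i + j)"
      using that by (simp flip: power_add)
    also have "\<dots> \<le> s ^ a * r ^ b * e b * h i (i + j)"
      using e_sub[of j "b - j"] that s r by (intro mult_right_mono mult_left_mono h0) auto
    finally show ?thesis .
  qed
  have "(\<Sum>i\<le>a. \<Sum>j\<le>b. wt2 i j * wt2 (a - i) (b - j)) \<le> (\<Sum>i\<le>a. \<Sum>j\<le>b. s ^ a * r ^ b * e b * h i (i + j))"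
    by (intro sum_mono step) auto
  also have "\<dots> = s ^ a * r ^ b * e b * (\<Sum>i\<le>a. \<Sum>j\<le>b. h i (i + j))"
    by (simp add: sum_distrib_left)
  also have "\<dots> \<le> s ^ a * r ^ b * e b * (tau N * real (N choose a))"
  proof (rule mult_left_mono)
    \<comment> \<open>The range of j is enlarged to all total degrees m, so that for each m the
      whole Vandermonde sum over i appears.\<close>
    have "(\<Sum>i\<le>a. \<Sum>j\<le>b. h i (i + j)) \<le> (\<Sum>i\<le>a. \<Sum>m\<le>N. h i m)"
    proof (rule sum_mono)
      fix i assume i: "i \<in> {..a}"
      have "(\<Sum>j\<le>b. h i (i + j)) = sum (h i) ((+) i ` {..b})"
        by (subst sum.reindex) auto
      also have "\<dots> \<le> sum (h i) {..N}"
        using i by (intro sum_mono2) (auto simp: N_def h0)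
      finally show "(\<Sum>j\<le>b. h i (i + j)) \<le> (\<Sum>m\<le>N. h i m)" .
    qed
    also have "\<dots> = (\<Sum>m\<le>N. tau m * tau (N - m) * real (\<Sum>i\<le>a. (m choose i) * ((N - m) choose (a - i))))"
      by (subst sum.swap) (simp add: h_def sum_distrib_left)
    also have "\<dots> = (\<Sum>m\<le>N. tau m * tau (N - m) * real (N choose a))"
      by (intro sum.cong refl) (simp add: vandermonde)
    also have "\<dots> = (\<Sum>m\<le>N. tau m * tau (N - m)) * real (N choose a)"
      by (simp add: sum_distrib_right)
    also have "\<dots> \<le> tau N * real (N choose a)"
      by (intro mult_right_mono tau_conv) auto
    finally show "(\<Sum>i\<le>a. \<Sum>j\<le>b. h i (i + j)) \<le> tau N * real (N choose a)" .
  qed (use s r e_pos[of b] in auto)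
  also have "\<dots> = wt2 a b" by (simp add: wt2_def N_def)
  finally show ?thesis .
qed

lemma wt_conv: "(\<Sum>i\<le>a. \<Sum>j\<le>b. \<Sum>k\<le>c. wt i j k * wt (a - i) (b - j) (c - k)) \<le> wt a b c"
proof -
  have k: "(\<Sum>k\<le>c. (tau k * t ^ k) * (tau (c - k) * t ^ (c - k))) \<le> tau c * t ^ c"
  proof -
    have "(\<Sum>k\<le>c. (tau k * t ^ k) * (tau (c - k) * t ^ (c - k))) = (\<Sum>k\<le>c. (tau k * tau (c - k)) * t ^ c)"
    proof (intro sum.cong refl)
      fix k assume "k \<in> {..c}"
      then have "t ^ c = t ^ k * t ^ (c - k)" by (simp flip: power_add)
      then show "(tau k * t ^ k) * (tau (c - k) * t ^ (c - k)) = (tau k * tau (c - k)) * t ^ c" by simp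
    qed
    also have "\<dots> = (\<Sum>k\<le>c. tau k * tau (c - k)) * t ^ c" by (simp add: sum_distrib_right)
    also have "\<dots> \<le> tau c * t ^ c" using t by (intro mult_right_mono tau_conv) auto
    finally show ?thesis .
  qed
  have "(\<Sum>i\<le>a. \<Sum>j\<le>b. \<Sum>k\<le>c. wt i j k * wt (a - i) (b - j) (c - k)) =
     (\<Sum>i\<le>a. \<Sum>j\<le>b. wt2 i j * wt2 (a - i) (b - j) * (\<Sum>k\<le>c. (tau k * t ^ k) * (tau (c - k) * t ^ (c - k))))"
    by (simp add: wt_def sum_distrib_left ac_simps)
  also have "\<dots> = (\<Sum>i\<le>a. \<Sum>j\<le>b. wt2 i j * wt2 (a - i) (b - j)) * (\<Sum>k\<le>c. (tau k * t ^ k) * (tau (c - k) * t ^ (c - k)))"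
    by (simp only: sum_distrib_right)
  also have "\<dots> \<le> wt2 a b * (tau c * t ^ c)"
  proof (intro mult_mono wt2_conv k)
    show "0 \<le> wt2 a b" using wt2_pos[of a b] by simp
    show "0 \<le> (\<Sum>k\<le>c. (tau k * t ^ k) * (tau (c - k) * t ^ (c - k)))"
      using t tau_pos by (intro sum_nonneg mult_nonneg_nonneg) (auto simp: less_imp_le)
  qed
  finally show ?thesis by (simp add: wt_def)
qed

definition bnd :: "real \<Rightarrow> ser3 \<Rightarrow> bool" where
  "bnd C X \<longleftrightarrow> (\<forall>a b c. norm (X $ b $ c $ a) \<le> C * wt a b c)"

lemma bnd_nonneg: "bnd C X \<Longrightarrow> 0 \<le> C"
  unfolding bnd_def using wt_pos[of 0 0 0] norm_ge_zero
  by (meson mult_le_0_iff not_le order_trans zero_le_mult_iff less_imp_le)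

lemma bnd_mono: "bnd C X \<Longrightarrow> C \<le> D \<Longrightarrow> bnd D X"
  unfolding bnd_def using wt_pos by (meson less_imp_le mult_right_mono order_trans)

lemma bnd_add: "bnd C X \<Longrightarrow> bnd D Y \<Longrightarrow> bnd (C + D) (X + Y)"
  unfolding bnd_def by (simp add: distrib_right norm_triangle_mono)

lemma bnd_diff: "bnd C X \<Longrightarrow> bnd D Y \<Longrightarrow> bnd (C + D) (X - Y)"
  unfolding bnd_def
  by (auto simp: distrib_right intro: order_trans[OF norm_triangle_ineq4 add_mono])

lemma bnd_mult: assumes X: "bnd C X" and Y: "bnd D Y" shows "bnd (C * D) (X * Y)"
  unfolding bnd_def
proof (intro allI)
  fix a b c
  have CD: "0 \<le> C" "0 \<le> D" using assms bnd_nonneg by auto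
  have "norm ((X * Y) $ b $ c $ a) \<le>
      (\<Sum>i\<le>a. \<Sum>j\<le>b. \<Sum>k\<le>c. (C * wt i j k) * (D * wt (a - i) (b - j) (c - k)))"
    unfolding ser3_mult_nth
    by (intro order_trans[OF norm_sum] sum_mono)
      (use X Y CD wt_pos in \<open>auto simp: norm_mult bnd_def less_imp_le intro!: mult_mono\<close>)
  also have "\<dots> = C * D * (\<Sum>i\<le>a. \<Sum>j\<le>b. \<Sum>k\<le>c. wt i j k * wt (a - i) (b - j) (c - k))"
    by (simp add: sum_distrib_left ac_simps)
  also have "\<dots> \<le> C * D * wt a b c"
    using CD by (intro mult_left_mono wt_conv) auto
  finally show "norm ((X * Y) $ b $ c $ a) \<le> C * D * wt a b c" .
qed

lemma bnd_single:
  assumes "\<And>a b c. (a, b, c) \<noteq> (a0, b0, c0) \<Longrightarrow> X $ b $ c $ a = 0" "norm (X $ b0 $ c0 $ a0) \<le> C * wt a0 b0 c0" "0 \<le> C"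
  shows "bnd C X"
  unfolding bnd_def
proof (intro allI)
  fix a b c
  show "norm (X $ b $ c $ a) \<le> C * wt a b c"
    using assms wt_pos[of a b c] by (cases "(a, b, c) = (a0, b0, c0)") auto
qed

text \<open>\<open>wt 0 0 0\<close> is the square of \<open>tau 0\<close> = 1/8, so the constant 1
  has norm 64. The 256 = 8 * 32 below is 1 / (\<open>tau 0\<close> \<open>tau 1\<close>).\<close>

lemma bnd_1: "bnd 64 1"
  by (rule bnd_single[of 0 0 0]) (auto simp: fps_one_nth wt_def wt2_def tau_def e0)

lemma bnd_zet: "bnd (256 / t) zet"
  using t
  by (intro bnd_single[of 0 0 1]) (auto simp: zet_def fps_X_nth wt_def wt2_def tau_def e0 power2_eq_square)

lemma bnd_wv: "bnd (256 / (r * e 1)) wv"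
  using r e_pos[of 1]
  by (intro bnd_single[of 0 1 0]) (auto simp: wv_def fps_X_def fps_one_nth wt_def wt2_def tau_def power2_eq_square)

lemma bnd_power: "bnd C X \<Longrightarrow> bnd (C ^ Suc n) (X ^ Suc n)"
  by (induction n) (auto intro: bnd_mult)

lemma bnd_power': "bnd C X \<Longrightarrow> bnd (64 * C ^ n) (X ^ n)"
proof (cases n)
  case (Suc m)
  assume "bnd C X"
  then have "bnd (C ^ n) (X ^ n)" "0 \<le> C ^ n" using bnd_power bnd_nonneg unfolding Suc by fastforce+
  then show ?thesis by (elim bnd_mono) auto
qed (simp add: bnd_1)

text \<open>Neumann series. As y has no constant term, each coefficient of Y is already that of a
  partial sum, so no limit is taken. 65 is 64 for the zeroth power plus at most 1 for the geometric
  sum.\<close>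

lemma bnd_inverse:
  assumes y: "bnd (1/2) y" "y $ 0 $ 0 $ 0 = 0" and Y: "(1 + y) * Y = 1"
  shows "bnd 65 Y"
  unfolding bnd_def
proof (intro allI)
  fix a b c :: nat
  define S where "S M = (\<Sum>m\<le>M. (- y) ^ m)" for M :: nat
  have ny: "bnd (1/2) (- y)" using y by (simp add: bnd_def)
  have S: "bnd (65 - (1/2) ^ M) (S M)" for M
  proof (induction M)
    case (Suc M)
    have "bnd (65 - (1/2) ^ M + (1/2) ^ Suc M) (S M + (- y) ^ Suc M)"
      by (intro bnd_add Suc bnd_power ny)
    then show ?case by (simp add: S_def)
  qed (use bnd_1 in \<open>simp add: S_def\<close>)
  define M where "M = a + b + c"
  have g: "(1 + y) * S M = 1 - (- y) ^ Suc M" for M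
    by (induction M) (auto simp: S_def algebra_simps)
  have "((1 + y) * Y) * S M = ((1 + y) * S M) * Y" by (simp only: ac_simps)
  then have "((1 + y) * Y) * S M = Y - (- y) ^ Suc M * Y"
    unfolding g by (simp only: left_diff_distrib mult_1_left)
  then have e: "Y = S M + (- y) ^ Suc M * Y" by (simp add: Y)
  have "ord3 (Suc M + 0) ((- y) ^ Suc M * Y)"
    by (intro ord3_mult ord3_power) (use y in \<open>auto simp: ord3_def\<close>)
  then have "((- y) ^ Suc M * Y) $ b $ c $ a = 0" by (simp add: ord3_def M_def)
  then have "Y $ b $ c $ a = S M $ b $ c $ a" by (subst e) simp
  also have "norm \<dots> \<le> (65 - (1/2) ^ M) * wt a b c" using S[of M] by (simp add: bnd_def)
  also have "\<dots> \<le> 65 * wt a b c" using wt_pos[of a b c] by (intro mult_right_mono) auto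
  finally show "norm (Y $ b $ c $ a) \<le> 65 * wt a b c" .
qed

text \<open>Arguments of norm at most \<rho> may be inserted into a series that converges at \<rho>.
  The bound for powers carries a factor 64 because of the zeroth power, hence 64^3 for three
  arguments.\<close>

lemma bnd_subst3:
  assumes ABC: "bnd \<rho> A" "bnd \<rho> B" "bnd \<rho> C"
    and M: "\<And>n. (\<Sum>i\<le>n. \<Sum>j\<le>n. \<Sum>k\<le>n. norm (P i j k) * \<rho> ^ (i + j + k)) \<le> M"
  shows "bnd (64 ^ 3 * M) (subst3 P A B C)"
  unfolding bnd_def
proof (intro allI)
  fix a b c :: nat
  have \<rho>: "0 \<le> \<rho>" using ABC bnd_nonneg by blast
  define n where "n = a + b + c"
  define T where "T i j k = norm (P i j k) * \<rho> ^ (i + j + k)" for i j k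
  have T0: "0 \<le> T i j k" for i j k using \<rho> by (simp add: T_def)
  have one: "norm (P i j k * (A ^ i * B ^ j * C ^ k) $ b $ c $ a) \<le> 64 ^ 3 * wt a b c * T i j k" for i j k
  proof -
    have "bnd ((64 * \<rho> ^ i) * (64 * \<rho> ^ j) * (64 * \<rho> ^ k)) (A ^ i * B ^ j * C ^ k)"
      by (intro bnd_mult bnd_power' ABC)
    then have "norm ((A ^ i * B ^ j * C ^ k) $ b $ c $ a) \<le> (64 * \<rho> ^ i) * (64 * \<rho> ^ j) * (64 * \<rho> ^ k) * wt a b c"
      by (simp add: bnd_def)
    then have "norm (P i j k) * norm ((A ^ i * B ^ j * C ^ k) $ b $ c $ a) \<le>
        norm (P i j k) * ((64 * \<rho> ^ i) * (64 * \<rho> ^ j) * (64 * \<rho> ^ k) * wt a b c)"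
      by (intro mult_left_mono) auto
    then show ?thesis by (simp add: T_def norm_mult power_add algebra_simps)
  qed
  have "norm (subst3 P A B C $ b $ c $ a) \<le>
      (\<Sum>i\<le>n. \<Sum>j\<le>n-i. \<Sum>k\<le>n-i-j. 64 ^ 3 * wt a b c * T i j k)"
    unfolding subst3_def ser_nth n_def[symmetric]
    by (intro order_trans[OF norm_sum] sum_mono one)
  also have "\<dots> \<le> (\<Sum>i\<le>n. \<Sum>j\<le>n. \<Sum>k\<le>n. 64 ^ 3 * wt a b c * T i j k)"
  proof (intro sum_mono)
    fix i
    have "(\<Sum>j\<le>n-i. \<Sum>k\<le>n-i-j. 64 ^ 3 * wt a b c * T i j k) \<le> (\<Sum>j\<le>n-i. \<Sum>k\<le>n. 64 ^ 3 * wt a b c * T i j k)"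
      using wt_pos[of a b c] T0 by (intro sum_mono sum_mono2) (auto simp: less_imp_le)
    also have "\<dots> \<le> (\<Sum>j\<le>n. \<Sum>k\<le>n. 64 ^ 3 * wt a b c * T i j k)"
      using wt_pos[of a b c] T0 by (intro sum_mono2 sum_nonneg) (auto simp: less_imp_le)
    finally show "(\<Sum>j\<le>n-i. \<Sum>k\<le>n-i-j. 64 ^ 3 * wt a b c * T i j k) \<le> (\<Sum>j\<le>n. \<Sum>k\<le>n. 64 ^ 3 * wt a b c * T i j k)" .
  qed
  also have "\<dots> = 64 ^ 3 * wt a b c * (\<Sum>i\<le>n. \<Sum>j\<le>n. \<Sum>k\<le>n. T i j k)"
    by (simp add: sum_distrib_left)
  also have "\<dots> \<le> 64 ^ 3 * wt a b c * M"
    using M[of n] wt_pos[of a b c] by (intro mult_left_mono) (auto simp: T_def)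
  finally show "norm (subst3 P A B C $ b $ c $ a) \<le> 64 ^ 3 * M * wt a b c" by (simp add: ac_simps)
qed

text \<open>The absorption identity (a+1) binom(a+b+1, a+1) = (a+b+1) binom(a+b, a): a z-derivative
  costs a+b+1, the scale on which w d/dw is measured too. The 4 in the converse estimate is that of
  \<open>tau_le_Suc\<close>.\<close>

lemma wt2_Suc: "real (a + 1) * wt2 (a + 1) b \<le> real (a + b + 1) * s * wt2 a b"
    and wt2_le_Suc: "real (a + b + 1) * wt2 a b \<le> 4 * real (a + 1) * wt2 (a + 1) b"
proof -
  have "Suc a * (Suc (a + b) choose Suc a) = Suc (a + b) * (a + b choose a)"
    by (rule Suc_times_binomial)
  then have ch: "real (a + 1) * real ((a + 1 + b) choose (a + 1)) = real (a + b + 1) * real (a + b choose a)"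
    unfolding of_nat_mult[symmetric] of_nat_eq_iff by (simp only: Suc_eq_plus1 add_ac)
  define X where "X = real (a + b + 1) * real (a + b choose a) * s ^ a * r ^ b * e b"
  have X: "0 \<le> X" using s r e_pos[of b] by (simp add: X_def)
  have 1: "real (a + 1) * wt2 (a + 1) b = s * tau (Suc (a + b)) * X"
  proof -
    have "real (a + 1) * wt2 (a + 1) b =
        (real (a + 1) * real ((a + 1 + b) choose (a + 1))) * tau (a + 1 + b) * s ^ (a + 1) * r ^ b * e b"
      unfolding wt2_def by (simp only: ac_simps)
    then show ?thesis unfolding ch X_def by (simp add: ac_simps)
  qed
  have 2: "real (a + b + 1) * wt2 a b = tau (a + b) * X"
    by (simp add: X_def wt2_def)
  have "s * (tau (Suc (a + b)) * X) \<le> s * (tau (a + b) * X)"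
    using X s tau_Suc_le[of "a + b"] by (intro mult_left_mono mult_right_mono) auto
  then show "real (a + 1) * wt2 (a + 1) b \<le> real (a + b + 1) * s * wt2 a b"
    using 1 2 by (simp add: ac_simps)
  have "tau (a + b) * X \<le> 4 * tau (Suc (a + b)) * X"
    by (intro mult_right_mono tau_le_Suc X)
  also have "\<dots> \<le> s * (4 * tau (Suc (a + b)) * X)"
  proof -
    have "0 \<le> 4 * tau (Suc (a + b)) * X" using X tau_pos[of "Suc (a + b)"] by simp
    from mult_right_mono[OF s this] show ?thesis by simp
  qed
  also have "\<dots> = 4 * (real (a + 1) * wt2 (a + 1) b)" unfolding 1 by (simp only: ac_simps)
  finally show "real (a + b + 1) * wt2 a b \<le> 4 * real (a + 1) * wt2 (a + 1) b"
    unfolding 2 by (simp only: mult.assoc)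
qed

text \<open>The decay (a+b+1)^-2 is the gain provided by \<open>solution_bound\<close>; it pays for
  the two derivatives taken in the transformation law.\<close>

definition small :: "real \<Rightarrow> ps2 \<Rightarrow> bool" where
  "small d u \<longleftrightarrow> (\<forall>a b. norm (u a b) \<le> d * wt2 a b / (real (a + b + 1))\<^sup>2)"

lemma bnd_emb:
  assumes "0 \<le> d" "\<And>a b. norm (u a b) \<le> d * wt2 a b"
  shows "bnd (8 * d) (emb u)"
  unfolding bnd_def
proof (intro allI)
  fix a b c
  show "norm (emb u $ b $ c $ a) \<le> 8 * d * wt a b c"
  proof (cases "c = 0")
    case True
    then show ?thesis using assms(2)[of a b] by (simp add: emb_nth wt_def tau_def)
  next
    case False
    then show ?thesis using assms(1) wt_pos[of a b c] by (simp add: emb_nth)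
  qed
qed

text \<open>Any two derivatives are absorbed by (a+b+1)^2; each z-derivative costs a further factor
  s by \<open>wt2_Suc\<close>.\<close>

lemma small_jets:
  assumes u: "small d u" and d: "0 \<le> d"
  shows "bnd (8 * d) (emb u)" "bnd (8 * d) (emb (th u))" "bnd (8 * d) (emb (th (th u)))"
    "bnd (8 * (d * s)) (emb (dz u))" "bnd (8 * (d * s)) (emb (th (dz u)))"
    "bnd (8 * (d * s\<^sup>2)) (emb (dz (dz u)))"
proof -
  have key: "m * norm (u a b) \<le> d * wt2 a b" if "0 \<le> m" "m \<le> (real (a + b + 1))\<^sup>2" for m a b
  proof -
    have N: "0 < (real (a + b + 1))\<^sup>2" by simp
    have "m * norm (u a b) \<le> (real (a + b + 1))\<^sup>2 * (d * wt2 a b / (real (a + b + 1))\<^sup>2)"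
      using u that unfolding small_def by (intro mult_mono) auto
    then show ?thesis using N by simp
  qed
  have sq: "real i * real j \<le> (real n)\<^sup>2" if "i \<le> n" "j \<le> n" for i j n :: nat
    using that by (auto simp: power2_eq_square intro: mult_mono)
  have ds: "0 \<le> d * s" "0 \<le> d * s\<^sup>2" using d s by auto
  have up1: "d * wt2 (a + 1) b * real (a + 1) \<le> d * s * wt2 a b * real (a + b + 1)" for a b
    using mult_left_mono[OF wt2_Suc[of a b] d] by (simp add: ac_simps)
  have one: "m * norm (dz u a b) \<le> d * s * wt2 a b" if "0 \<le> m" "m \<le> real (a + b)" for m a b
  proof -
    define n where "n = real (a + b + 1)"
    have n: "1 \<le> n" "m \<le> n" using that by (auto simp: n_def)
    have "norm (dz u a b) = real (a + 1) * norm (u (a + 1) b)"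
      by (simp add: dz_def norm_mult del: of_nat_Suc)
    then have "n * (m * norm (dz u a b)) = real (a + 1) * ((n * m) * norm (u (a + 1) b))"
      by (simp only: ac_simps)
    also have "\<dots> \<le> real (a + 1) * (d * wt2 (a + 1) b)"
    proof (intro mult_left_mono key)
      have "n * m \<le> n * n" using n by (intro mult_left_mono) auto
      also have "\<dots> \<le> (real (a + 1 + b + 1))\<^sup>2"
        unfolding n_def by (rule sq) auto
      finally show "n * m \<le> (real (a + 1 + b + 1))\<^sup>2" .
    qed (use n that in auto)
    also have "\<dots> \<le> n * (d * s * wt2 a b)" using up1[of a b] by (simp add: n_def ac_simps)
    finally show ?thesis using n by (simp add: mult_le_cancel_left)
  qed
  show "bnd (8 * d) (emb u)"
    using key[of 1] by (intro bnd_emb d) (simp add: one_le_power)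
  show "bnd (8 * d) (emb (th u))"
  proof (intro bnd_emb d)
    fix a b
    have "real b * real 1 \<le> (real (a + b + 1))\<^sup>2" by (rule sq) auto
    then show "norm (th u a b) \<le> d * wt2 a b"
      using key[of "real b" a b] by (simp add: th_def norm_mult)
  qed
  show "bnd (8 * d) (emb (th (th u)))"
  proof (intro bnd_emb d)
    fix a b
    have "real b * real b \<le> (real (a + b + 1))\<^sup>2" by (rule sq) auto
    then show "norm (th (th u) a b) \<le> d * wt2 a b"
      using key[of "real b * real b" a b] by (simp add: th_def norm_mult mult.assoc)
  qed
  show "bnd (8 * (d * s)) (emb (th (dz u)))"
  proof (intro bnd_emb ds)
    show "norm (th (dz u) a b) \<le> d * s * wt2 a b" for a b
      using one[of "real b" a b] by (simp add: th_def norm_mult)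
  qed
  show "bnd (8 * (d * s)) (emb (dz u))"
  proof (intro bnd_emb ds)
    fix a b
    define n where "n = real (a + b + 1)"
    have n: "1 \<le> n" by (simp add: n_def)
    have "n * norm (dz u a b) = real (a + 1) * (n * norm (u (a + 1) b))"
      by (simp add: dz_def norm_mult del: of_nat_Suc)
    also have "\<dots> \<le> real (a + 1) * (d * wt2 (a + 1) b)"
    proof (intro mult_left_mono key)
      have "real (a + b + 1) * real 1 \<le> (real (a + 1 + b + 1))\<^sup>2" by (rule sq) auto
      then show "n \<le> (real (a + 1 + b + 1))\<^sup>2" by (simp add: n_def)
    qed (use n in auto)
    also have "\<dots> \<le> n * (d * s * wt2 a b)" using up1[of a b] by (simp add: n_def ac_simps)
    finally show "norm (dz u a b) \<le> d * s * wt2 a b" using n by (simp add: mult_le_cancel_left)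
  qed
  show "bnd (8 * (d * s\<^sup>2)) (emb (dz (dz u)))"
  proof (intro bnd_emb ds)
    fix a b
    define n where "n = real (a + b + 1)"
    have n: "1 \<le> n" by (simp add: n_def)
    have np: "real (a + 1 + b + 1) = n + 1" by (simp add: n_def)
    have "(n * (n + 1)) * norm (dz (dz u) a b) = real (a + 1) * real (a + 2) * ((n * (n + 1)) * norm (u (a + 2) b))"
      by (simp add: dz_def norm_mult del: of_nat_Suc)
    also have "\<dots> \<le> real (a + 1) * real (a + 2) * (d * wt2 (a + 2) b)"
    proof (intro mult_left_mono key)
      have "real (a + b + 1) * real (a + b + 2) \<le> (real (a + 2 + b + 1))\<^sup>2" by (rule sq) auto
      then show "n * (n + 1) \<le> (real (a + 2 + b + 1))\<^sup>2" by (simp add: n_def ac_simps)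
    qed (use n in auto)
    also have "\<dots> = real (a + 1) * (d * wt2 (a + 1 + 1) b * real (a + 1 + 1))" by simp
    also have "\<dots> \<le> real (a + 1) * (d * s * wt2 (a + 1) b * real (a + 1 + b + 1))"
      by (intro mult_left_mono up1) simp
    also have "\<dots> = s * (n + 1) * (d * wt2 (a + 1) b * real (a + 1))"
      unfolding np by (simp add: ac_simps)
    also have "\<dots> \<le> s * (n + 1) * (d * s * wt2 a b * real (a + b + 1))"
      using s n by (intro mult_left_mono up1) auto
    also have "\<dots> = (n * (n + 1)) * (d * s\<^sup>2 * wt2 a b)" by (simp add: n_def power2_eq_square ac_simps)
    finally show "norm (dz (dz u) a b) \<le> d * s\<^sup>2 * wt2 a b" using n by (simp add: mult_le_cancel_left)
  qed
qed

end

section \<open>Bounds for the transformation law near the identity\<close>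

definition id_z :: ps2 where "id_z = (\<lambda>a b. if a = 1 \<and> b = 0 then 1 else 0)"
definition one2 :: ps2 where "one2 = (\<lambda>a b. if a = 0 \<and> b = 0 then 1 else 0)"

definition sub2 :: "ps2 \<Rightarrow> ps2 \<Rightarrow> ps2" where "sub2 u v = (\<lambda>a b. u a b - v a b)"

lemma square_le_4_power: "(real n + 1)\<^sup>2 \<le> 4 ^ n"
proof -
  have "real n + 1 \<le> 2 ^ n" by (induction n) auto
  then have "(real n + 1)\<^sup>2 \<le> (2 ^ n)\<^sup>2" by (intro power_mono) auto
  then show ?thesis by (simp add: power_mult[symmetric] mult.commute[of n] power_mult)
qed

text \<open>Geometric growth beats \<open>tau\<close>, so coefficient bounds of the form M /
  \<rho>^n fit under the weights.\<close>

lemma tau_power_ge: "512 \<le> x \<Longrightarrow> 1 / 8 \<le> tau n * x ^ n"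
proof -
  assume x: "512 \<le> x"
  have "(real n + 1)\<^sup>2 \<le> x ^ n"
    by (rule order_trans[OF square_le_4_power power_mono]) (use x in auto)
  then have "1 * (8 * (real n + 1)\<^sup>2) \<le> 8 * x ^ n" by simp
  then show ?thesis by (simp add: tau_def field_simps)
qed

lemma tau_le_1: "tau n \<le> 1"
proof -
  have "1 \<le> (real n + 1)\<^sup>2" by (rule one_le_power) simp
  then have "1 \<le> 8 * (real n + 1)\<^sup>2" by linarith
  moreover have "0 < 8 * (real n + 1)\<^sup>2" by simp
  ultimately show ?thesis unfolding tau_def by (simp only: divide_le_eq_1_pos)
qed

lemma cube_single:
  assumes "\<And>n :: nat. (\<Sum>i\<le>n. \<Sum>j\<le>n. \<Sum>k\<le>n. (f i j k :: real)) \<le> M" and "\<And>i j k. 0 \<le> f i j k"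
  shows "f i j k \<le> M"
proof -
  define n where "n = i + j + k"
  have "f i j k \<le> (\<Sum>k\<le>n. f i j k)"
    by (rule member_le_sum) (use assms in \<open>auto simp: n_def\<close>)
  also have "\<dots> \<le> (\<Sum>j\<le>n. \<Sum>k\<le>n. f i j k)"
    by (rule member_le_sum) (use assms in \<open>auto simp: n_def intro!: sum_nonneg\<close>)
  also have "\<dots> \<le> (\<Sum>i\<le>n. \<Sum>j\<le>n. \<Sum>k\<le>n. f i j k)"
    by (rule member_le_sum) (use assms in \<open>auto simp: n_def intro!: sum_nonneg\<close>)
  finally show ?thesis using assms(1)[of n] by linarith
qed

text \<open>Convergence of P in the finite form that \<open>bnd_subst3\<close> consumes.\<close>

definition majorised :: "ps3 \<Rightarrow> real \<Rightarrow> real \<Rightarrow> bool" where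
  "majorised P \<rho> M \<longleftrightarrow> 0 < \<rho> \<and> \<rho> \<le> 1 \<and>
     (\<forall>n. (\<Sum>i\<le>n. \<Sum>j\<le>n. \<Sum>k\<le>n. norm (P i j k) * \<rho> ^ (i + j + k)) \<le> M)"

lemma majorised_coeff: "majorised P \<rho> M \<Longrightarrow> norm (P i j k) * \<rho> ^ (i + j + k) \<le> M"
  unfolding majorised_def by (rule cube_single[of "\<lambda>i j k. norm (P i j k) * \<rho> ^ (i + j + k)"]) auto

lemma majorised_nonneg: "majorised P \<rho> M \<Longrightarrow> 0 \<le> M"
  using majorised_coeff[of P \<rho> M 0 0 0] by (auto intro: order_trans[OF norm_ge_zero])

context weights
begin

lemma bnd_restr:
  assumes P: "majorised P \<rho> M" and s\<rho>: "512 \<le> s * \<rho>" and t\<rho>: "512 \<le> t * \<rho>"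
  shows "bnd (64 * M) (fps_const (restr P))"
  unfolding bnd_def
proof (intro allI)
  fix a b c
  have \<rho>: "0 < \<rho>" using P by (simp add: majorised_def)
  have M: "0 \<le> M" using majorised_nonneg[OF P] .
  show "norm (fps_const (restr P) $ b $ c $ a) \<le> 64 * M * wt a b c"
  proof (cases "b = 0")
    case True
    have "1 / 8 * (1 / 8) \<le> (tau a * (s * \<rho>) ^ a) * (tau c * (t * \<rho>) ^ c)"
      using tau_power_ge[OF s\<rho>, of a] tau_power_ge[OF t\<rho>, of c] by (intro mult_mono) auto
    also have "\<dots> = wt a 0 c * \<rho> ^ (a + c)"
      by (simp add: wt_def wt2_def e0 power_mult_distrib power_add)
    finally have w: "1 \<le> 64 * (wt a 0 c * \<rho> ^ (a + c))" by simp
    have "norm (P a 0 c) * \<rho> ^ (a + c) \<le> M * 1" using majorised_coeff[OF P, of a 0 c] by simp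
    also have "\<dots> \<le> M * (64 * (wt a 0 c * \<rho> ^ (a + c)))" by (intro mult_left_mono w M)
    finally have "norm (P a 0 c) * \<rho> ^ (a + c) \<le> (64 * M * wt a 0 c) * \<rho> ^ (a + c)" by (simp add: ac_simps)
    then have "norm (P a 0 c) \<le> 64 * M * wt a 0 c" using \<rho> by simp
    then show ?thesis using True by simp
  next
    case False
    then show ?thesis using M wt_pos[of a b c] by simp
  qed
qed

text \<open>Multiplication by a \<zeta>-coefficient of P at w = 0 preserves the weights at order k.
  The constant is free of k, r and \<open>e\<close>, since at order 0 in w neither r nor a value of
  \<open>e\<close> other than 1 occurs.\<close>

lemma conv_coeff:
  assumes P: "majorised P \<rho> M" and s\<rho>: "512 \<le> s * \<rho>"
  shows "(\<Sum>i\<le>a. norm (P i 0 c) * wt2 (a - i) k) \<le> 8 * M / \<rho> ^ c * wt2 a k"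
proof -
  have \<rho>: "0 < \<rho>" using P by (simp add: majorised_def)
  have M: "0 \<le> M" using majorised_nonneg[OF P] .
  have P': "norm (P i 0 c) \<le> 8 * M / \<rho> ^ c * wt2 i 0" for i
  proof -
    have "1 \<le> 8 * (tau i * (s * \<rho>) ^ i)" using tau_power_ge[OF s\<rho>, of i] by simp
    also have "\<dots> = 8 * wt2 i 0 * \<rho> ^ i" by (simp add: wt2_def e0 power_mult_distrib)
    finally have w: "1 \<le> 8 * wt2 i 0 * \<rho> ^ i" .
    have "norm (P i 0 c) * \<rho> ^ (i + c) \<le> M * 1" using majorised_coeff[OF P, of i 0 c] by simp
    also have "\<dots> \<le> M * (8 * wt2 i 0 * \<rho> ^ i)" by (intro mult_left_mono w M)
    finally have "\<rho> ^ i * (norm (P i 0 c) * \<rho> ^ c) \<le> \<rho> ^ i * (8 * M * wt2 i 0)" by (simp add: power_add ac_simps)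
    then have "norm (P i 0 c) * \<rho> ^ c \<le> 8 * M * wt2 i 0" using \<rho> by (simp add: mult_le_cancel_left)
    then show ?thesis using \<rho> by (simp add: field_simps)
  qed
  have "(\<Sum>i\<le>a. norm (P i 0 c) * wt2 (a - i) k) \<le> (\<Sum>i\<le>a. 8 * M / \<rho> ^ c * (wt2 i 0 * wt2 (a - i) k))"
    using mult_right_mono[OF P' less_imp_le[OF wt2_pos]] by (intro sum_mono) (simp only: mult.assoc)
  also have "\<dots> = 8 * M / \<rho> ^ c * (\<Sum>i\<le>a. wt2 i 0 * wt2 (a - i) k)"
    by (simp only: sum_distrib_left)
  also have "\<dots> \<le> 8 * M / \<rho> ^ c * wt2 a k"
  proof (rule mult_left_mono)
    have "wt2 i 0 * wt2 (a - i) k \<le> (\<Sum>j\<le>k. wt2 i j * wt2 (a - i) (k - j))" for i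
      using member_le_sum[of 0 "{..k}" "\<lambda>j. wt2 i j * wt2 (a - i) (k - j)"] wt2_pos
      by (simp add: less_imp_le)
    then show "(\<Sum>i\<le>a. wt2 i 0 * wt2 (a - i) k) \<le> wt2 a k"
      by (intro order_trans[OF sum_mono wt2_conv])
  qed (use M \<rho> in auto)
  finally show ?thesis .
qed

text \<open>The parameter conditions give F, G and \<open>sig\<close>, the three arguments of
  \<Phi>, norm at most \<rho>: z contributes 256/s, \<zeta> contributes 256/t, w contributes 256/(r
  e 1), and d controls the deviation from the identity. The resulting bounds contain only M, so they
  are the same for every admissible \<open>e\<close>.\<close>

lemma bnd_nonlinear:
  assumes u: "unipotent F \<gamma>" and small: "small d (sub2 F id_z)" "small d (sub2 \<gamma> one2)" and d: "0 \<le> d"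
    and P: "majorised \<Phi> \<rho> M" and s\<rho>: "512 \<le> s * \<rho>" and t\<rho>: "2196480 \<le> t * \<rho>"
    and d\<rho>: "8 * (d * s\<^sup>2) \<le> \<rho> / 200" and r\<rho>: "256 * 65 \<le> \<rho> * (r * e 1)"
  shows "bnd (66 ^ 3 * 65 * (64 ^ 3 * M) + 797) (pull \<Phi> F \<gamma>)"
    and "bnd (66 ^ 3 * 65 * (64 ^ 3 * M) + 797 + 4291 * (64 * M)) (defect \<Phi> F \<gamma>)"
    and "bnd 65 (inv3 (jac F \<gamma>))"
proof -
  define f where "f = sub2 F id_z"
  define g where "g = sub2 \<gamma> one2"
  have \<rho>: "0 < \<rho>" "\<rho> \<le> 1" using P by (auto simp: majorised_def)
  \<comment> \<open>A common bound for all jets up to second order of F - z and \<gamma> -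
    1.\<close>
  define \<eta> where "\<eta> = \<rho> / 200"
  have \<eta>: "0 < \<eta>" "\<eta> \<le> 1 / 200" using \<rho> by (auto simp: \<eta>_def)
  have s2: "1 \<le> s\<^sup>2" "s \<le> s\<^sup>2" using s by (auto simp: power2_eq_square intro: mult_mono[of 1 s 1 s, simplified])
  have dd: "8 * (d * s\<^sup>2) \<le> \<eta>" using d\<rho> by (simp add: \<eta>_def)
  moreover have "d * 1 \<le> d * s\<^sup>2" "d * s \<le> d * s\<^sup>2" using d s2 by (intro mult_left_mono; simp)+
  ultimately have le: "8 * d \<le> \<eta>" "8 * (d * s) \<le> \<eta>" by auto
  note F = small_jets[OF small(1) d, folded f_def] and G = small_jets[OF small(2) d, folded g_def]
  have f: "bnd \<eta> (emb f)" "bnd \<eta> (emb (th f))" "bnd \<eta> (emb (th (th f)))" "bnd \<eta> (emb (dz f))"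
    "bnd \<eta> (emb (th (dz f)))" "bnd \<eta> (emb (dz (dz f)))"
    using F[THEN bnd_mono] le dd by blast+
  have g: "bnd \<eta> (emb g)" "bnd \<eta> (emb (th g))" "bnd \<eta> (emb (th (th g)))" "bnd \<eta> (emb (dz g))"
    "bnd \<eta> (emb (th (dz g)))" "bnd \<eta> (emb (dz (dz g)))"
    using G[THEN bnd_mono] le dd by blast+
  have eqs: "th F = th f" "dz \<gamma> = dz g" "th \<gamma> = th g" "dz (dz F) = dz (dz f)" "th (dz F) = th (dz f)"
    by (auto simp: th_def dz_def f_def g_def sub2_def id_z_def one2_def fun_eq_iff)
  have eF: "emb F = emb id_z + emb f" and e\<gamma>: "emb \<gamma> = 1 + emb g" and edF: "emb (dz F) = 1 + emb (dz f)"
    by (rule ser3_eqI; auto simp: emb_nth f_def g_def sub2_def id_z_def one2_def dz_def fps_one_nth)+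
  have one: "bnd \<eta> X \<Longrightarrow> bnd 1 X" for X by (erule bnd_mono) (use \<eta> in auto)
  define \<zeta> where "\<zeta> = 256 / t"
  have \<zeta>: "bnd \<zeta> zet" unfolding \<zeta>_def by (rule bnd_zet)
  have \<zeta>0: "0 < \<zeta>" "\<zeta> \<le> \<rho> / 8580"
  proof -
    show "0 < \<zeta>" using t by (simp add: \<zeta>_def)
    show "\<zeta> \<le> \<rho> / 8580" using t t\<rho> by (simp add: \<zeta>_def field_simps)
  qed
  have \<zeta>1: "\<zeta> \<le> 1" using \<zeta>0 \<rho> by linarith
  have z1: "bnd 1 zet" using bnd_mono[OF \<zeta> \<zeta>1] .
  have mm: "x * y \<le> x" if "0 \<le> x" "y \<le> 1" for x y :: real using that mult_left_mono[of y 1 x] by simp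
  have \<eta>\<eta>: "\<eta> * \<eta> \<le> \<eta>" "\<zeta> * \<eta> \<le> \<eta>" using mm[of \<eta> \<eta>] mm[of \<eta> \<zeta>] \<eta> \<zeta>1 by (auto simp: mult.commute)
  have b\<gamma>: "bnd 65 (emb \<gamma>)" unfolding e\<gamma> by (rule bnd_mono[OF bnd_add[OF bnd_1 g(1)]]) (use \<eta> in auto)
  have b\<gamma>': "bnd 65 (emb \<gamma> + emb (th \<gamma>))" unfolding e\<gamma> eqs
    by (rule bnd_mono[OF bnd_add[OF bnd_add[OF bnd_1 g(1)] g(2)]]) (use \<eta> in auto)
  define x where "x = emb (dz f) + zet * emb (th f)"
  have bx: "bnd (2 * \<eta>) x" unfolding x_def
    by (rule bnd_mono[OF bnd_add[OF f(4) bnd_mult[OF \<zeta> f(2)]]]) (use \<eta>\<eta> in auto)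
  have DF: "DF F = 1 + x" unfolding DF_def edF eqs x_def by simp
  have bDF: "bnd 66 (DF F)" unfolding DF by (rule bnd_mono[OF bnd_add[OF bnd_1 bx]]) (use \<eta> in auto)
  have half: "\<eta> + 2 * \<eta> + \<eta> * (2 * \<eta>) \<le> 1 / 2"
  proof -
    have "\<eta> * (2 * \<eta>) \<le> 1 * (2 * \<eta>)" using \<eta> by (intro mult_right_mono) auto
    then show ?thesis using \<eta> by linarith
  qed
  have half2: "\<eta> + \<eta> + \<eta> + (\<eta> + \<eta>) * \<eta> + \<eta> * \<eta> \<le> 1 / 2"
    using \<eta> \<eta>\<eta>(1) unfolding distrib_right by linarith
  define y where "y = emb g + x + emb g * x"
  have yb: "bnd (1 / 2) y" unfolding y_def
    by (rule bnd_mono[OF bnd_add[OF bnd_add[OF g(1) bx] bnd_mult[OF g(1) bx]]]) (rule half)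
  have \<gamma>DF: "emb \<gamma> * DF F = 1 + y" unfolding DF e\<gamma> y_def by (simp add: algebra_simps)
  have c: "F a 0 = (if a = 1 then 1 else 0)" "\<gamma> a 0 = (if a = 0 then 1 else 0)" for a
    using u col_nth[of F 0 a] col_nth[of \<gamma> 0 a] by (auto simp: unipotent_def)
  have fg0: "f a 0 = 0" "g a 0 = 0" for a
    by (auto simp: f_def g_def sub2_def id_z_def one2_def c)
  have y0: "y $ 0 $ 0 $ 0 = 0" by (simp add: y_def x_def emb_nth fg0 dz_def th_def)
  have "(1 + y) * inv3 (1 + y) = 1" by (rule inv3) (simp add: y0)
  then have bY: "bnd 65 (inv3 (emb \<gamma> * DF F))" unfolding \<gamma>DF by (rule bnd_inverse[OF yb y0])
  have bnum: "bnd (\<eta> + \<zeta> * 65) (num \<gamma>)" unfolding num_def eqs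
    by (intro bnd_add bnd_mult g \<zeta> b\<gamma>'[unfolded eqs])
  have num67: "bnd 67 (num \<gamma>)" by (rule bnd_mono[OF bnum]) (use \<eta> \<zeta>1 in auto)
  \<comment> \<open>(\<eta> + 65 \<zeta>) 65 is at most (65/200 + 4225/8580) \<rho> < \<rho>; this
    is the origin of 2196480 = 256 * 8580.\<close>
  have bsig: "bnd \<rho> (sig F \<gamma>)" unfolding sig_def
  proof (rule bnd_mono[OF bnd_mult[OF bnum bY]])
    show "(\<eta> + \<zeta> * 65) * 65 \<le> \<rho>" using \<zeta>0 \<rho> by (simp add: \<eta>_def)
  qed
  have bF: "bnd \<rho> (emb F)" unfolding eF
  proof (rule bnd_mono[OF bnd_add[OF _ f(1)]])
    show "bnd (256 / s) (emb id_z)"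
      using s by (intro bnd_single[of 1 0 0]) (auto simp: emb_nth id_z_def wt_def wt2_def tau_def e0 power2_eq_square)
    have "256 / s \<le> \<rho> / 2" using s s\<rho> by (simp add: field_simps)
    then show "256 / s + \<eta> \<le> \<rho>" using \<rho> by (simp add: \<eta>_def)
  qed
  have bw: "bnd \<rho> (wv * emb \<gamma>)"
  proof (rule bnd_mono[OF bnd_mult[OF bnd_wv b\<gamma>]])
    have "0 < r * e 1" using r e_pos[of 1] by simp
    then show "256 / (r * e 1) * 65 \<le> \<rho>" using r\<rho> by (simp add: field_simps)
  qed
  have bsub: "bnd (64 ^ 3 * M) (subst3 \<Phi> (emb F) (wv * emb \<gamma>) (sig F \<gamma>))"
    by (rule bnd_subst3[OF bF bw bsig]) (use P in \<open>auto simp: majorised_def\<close>)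
  have z2: "2 * zet = zet + zet" "zet\<^sup>2 = zet * zet" by (simp_all add: power2_eq_square)
  \<comment> \<open>797 = 66 * 7 + 67 * 5, with every jet of the deviation and \<zeta> bounded by
    1.\<close>
  have bsec: "bnd 797 (sec F \<gamma>)" unfolding sec_def eqs z2
    by (rule bnd_mono[OF bnd_diff[OF bnd_mult[OF bnd_add[OF bnd_add[OF one[OF g(6)] bnd_mult[OF bnd_add[OF z1 z1] bnd_add[OF one[OF g(5)] one[OF g(4)]]]]
            bnd_mult[OF bnd_mult[OF z1 z1] bnd_add[OF one[OF g(3)] one[OF g(2)]]]] bDF]
          bnd_mult[OF num67 bnd_add[OF bnd_add[OF one[OF f(6)] bnd_mult[OF bnd_add[OF z1 z1] one[OF f(5)]]]
            bnd_mult[OF bnd_mult[OF z1 z1] bnd_diff[OF one[OF f(3)] one[OF f(2)]]]]]]]) simp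
  have DF3: "DF F ^ 3 = DF F * DF F * DF F" by (simp add: power3_eq_cube)
  show pull: "bnd (66 ^ 3 * 65 * (64 ^ 3 * M) + 797) (pull \<Phi> F \<gamma>)"
    unfolding pull_def DF3
    by (rule bnd_mono[OF bnd_diff[OF bnd_mult[OF bnd_mult[OF bnd_mult[OF bnd_mult[OF bDF bDF] bDF] b\<gamma>] bsub] bsec]]) simp
  have edF': "bnd 66 (emb (dz F))" unfolding edF by (rule bnd_mono[OF bnd_add[OF bnd_1 f(4)]]) (use \<eta> in auto)
  have bjac: "bnd 4291 (jac F \<gamma>)" unfolding jac_def
    by (rule bnd_mono[OF bnd_diff[OF bnd_mult[OF b\<gamma>' edF'] bnd_mult[OF one[OF g(4)] one[OF f(2)], folded eqs]]]) simp
  have "512 \<le> t * \<rho>" using t\<rho> by simp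
  then show "bnd (66 ^ 3 * 65 * (64 ^ 3 * M) + 797 + 4291 * (64 * M)) (defect \<Phi> F \<gamma>)"
    unfolding defect_def by (intro bnd_diff pull bnd_mult bjac bnd_restr[OF P s\<rho>])
  define v where "v = emb g + emb (th g) + emb (dz f) + (emb g + emb (th g)) * emb (dz f) - emb (dz g) * emb (th f)"
  have jac: "jac F \<gamma> = 1 + v" unfolding jac_def e\<gamma> eqs edF v_def by (simp add: algebra_simps)
  have bv: "bnd (1 / 2) v" unfolding v_def
    by (rule bnd_mono[OF bnd_diff[OF bnd_add[OF bnd_add[OF bnd_add[OF g(1) g(2)] f(4)]
            bnd_mult[OF bnd_add[OF g(1) g(2)] f(4)]] bnd_mult[OF g(4) f(2)]]]) (rule half2)
  have v0: "v $ 0 $ 0 $ 0 = 0" by (simp add: v_def emb_nth fg0 dz_def th_def)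
  show "bnd 65 (inv3 (jac F \<gamma>))"
    by (rule bnd_inverse[OF bv v0]) (use jac_inv3[OF u] in \<open>simp add: jac\<close>)
qed

end

section \<open>Convergence and geometric bounds on coefficients\<close>

lemma half_powers: "(\<Sum>i\<le>n. (1/2::real) ^ i) \<le> 2"
proof -
  have "(\<Sum>i\<le>n. (1/2::real) ^ i) = 2 - (1/2) ^ n"
    by (induction n) auto
  then show ?thesis by simp
qed

lemma convergent3I:
  assumes K: "1 \<le> K" and P: "\<And>a b c. norm (P a b c) \<le> C * K ^ (a + b + c)"
  shows "convergent3 P"
  unfolding convergent3_def
proof (intro exI conjI)
  define \<rho> where "\<rho> = 1 / (2 * K)"
  show "0 < 1 / (2 * K)" using K by simp
  have C: "0 \<le> C" using order_trans[OF norm_ge_zero P[of 0 0 0]] by simp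
  have half: "norm (P a b c) * \<rho> ^ (a + b + c) \<le> C * ((1/2) ^ a * (1/2) ^ b * (1/2) ^ c)" for a b c
  proof -
    have "norm (P a b c) * \<rho> ^ (a + b + c) \<le> C * K ^ (a + b + c) * \<rho> ^ (a + b + c)"
      using K by (intro mult_right_mono P) (simp add: \<rho>_def)
    also have "\<dots> = C * (K * \<rho>) ^ (a + b + c)" by (simp add: power_mult_distrib)
    also have "K * \<rho> = 1/2" using K by (simp add: \<rho>_def)
    finally show ?thesis by (simp add: power_add)
  qed
  show "(\<lambda>(a, b, c). norm (P a b c) * (1 / (2 * K)) ^ (a + b + c)) summable_on UNIV"
    unfolding \<rho>_def[symmetric]
  proof (rule nonneg_bdd_above_summable_on)
    show "bdd_above (sum (\<lambda>(a, b, c). norm (P a b c) * \<rho> ^ (a + b + c)) ` {F. F \<subseteq> UNIV \<and> finite F})"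
    proof (rule bdd_aboveI2)
      fix S :: "(nat \<times> nat \<times> nat) set" assume "S \<in> {F. F \<subseteq> UNIV \<and> finite F}"
      then have S: "finite S" by simp
      define n where "n = Max (insert 0 ((\<lambda>(a, b, c). a + b + c) ` S))"
      have "S \<subseteq> {..n} \<times> {..n} \<times> {..n}"
      proof
        fix x assume x: "x \<in> S"
        obtain a b c where abc: "x = (a, b, c)" by (cases x)
        have "a + b + c \<le> n" unfolding n_def using x S abc by (intro Max_ge) force+
        then show "x \<in> {..n} \<times> {..n} \<times> {..n}" by (simp add: abc)
      qed
      then have "sum (\<lambda>(a, b, c). norm (P a b c) * \<rho> ^ (a + b + c)) S \<le>
          sum (\<lambda>(a, b, c). norm (P a b c) * \<rho> ^ (a + b + c)) ({..n} \<times> {..n} \<times> {..n})"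
        using K by (intro sum_mono2) (auto simp: \<rho>_def)
      also have "\<dots> = (\<Sum>a\<le>n. \<Sum>b\<le>n. \<Sum>c\<le>n. norm (P a b c) * \<rho> ^ (a + b + c))"
        by (simp add: sum.cartesian_product)
      also have "\<dots> \<le> (\<Sum>a\<le>n. \<Sum>b\<le>n. \<Sum>c\<le>n. C * ((1/2) ^ a * (1/2) ^ b * (1/2) ^ c))"
        by (intro sum_mono half)
      also have "\<dots> = C * ((\<Sum>a\<le>n. (1/2) ^ a) * (\<Sum>b\<le>n. (1/2) ^ b) * (\<Sum>c\<le>n. (1/2) ^ c))"
        by (simp only: sum_distrib_left[symmetric] sum_distrib_right[symmetric])
      also have "\<dots> \<le> C * (2 * 2 * 2)"
        by (intro mult_left_mono mult_mono half_powers C mult_nonneg_nonneg sum_nonneg) auto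
      finally show "sum (\<lambda>(a, b, c). norm (P a b c) * \<rho> ^ (a + b + c)) S \<le> C * (2 * 2 * 2)" .
    qed
  qed (use K in \<open>auto simp: \<rho>_def\<close>)
qed

lemma convergent2_lift: "convergent3 (lift u) \<Longrightarrow> convergent2 u"
proof -
  assume "convergent3 (lift u)"
  then obtain \<rho> where \<rho>: "\<rho> > 0" and
    sm: "(\<lambda>(a, b, c). norm (lift u a b c) * \<rho> ^ (a + b + c)) summable_on UNIV"
    unfolding convergent3_def by blast
  have inj: "inj (\<lambda>(a, b). (a, b, 0 :: nat))" by (auto simp: inj_on_def)
  have "(\<lambda>(a, b, c). norm (lift u a b c) * \<rho> ^ (a + b + c)) summable_on range (\<lambda>(a :: nat, b :: nat). (a, b, 0 :: nat))"
    by (rule summable_on_subset_banach[OF sm]) simp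
  then have "((\<lambda>(a, b, c). norm (lift u a b c) * \<rho> ^ (a + b + c)) \<circ> (\<lambda>(a, b). (a, b, 0))) summable_on UNIV"
    using summable_on_reindex[OF inj] by blast
  moreover have "(\<lambda>(a, b, c). norm (lift u a b c) * \<rho> ^ (a + b + c)) \<circ> (\<lambda>(a, b). (a, b, 0)) =
      (\<lambda>(a, b). norm (u a b) * \<rho> ^ (a + b))"
    by (auto simp: fun_eq_iff lift_def)
  ultimately show ?thesis unfolding convergent2_def using \<rho> by auto
qed

lemma convergent2I:
  assumes K: "1 \<le> K" and u: "\<And>a b. norm (u a b) \<le> C * K ^ (a + b)"
  shows "convergent2 u"
proof (intro convergent2_lift convergent3I[OF K])
  have C: "0 \<le> C" using order_trans[OF norm_ge_zero u[of 0 0]] by simp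
  show "norm (lift u a b c) \<le> C * K ^ (a + b + c)" for a b c
    using u[of a b] C K by (simp add: lift_def)
qed

lemma convergent3_majorised:
  assumes "convergent3 P"
  obtains \<rho> M where "majorised P \<rho> M"
proof -
  from assms obtain \<rho>0 where \<rho>0: "\<rho>0 > 0" and
    sm: "(\<lambda>(a, b, c). norm (P a b c) * \<rho>0 ^ (a + b + c)) summable_on UNIV"
    unfolding convergent3_def by blast
  define \<rho> where "\<rho> = min \<rho>0 1"
  define M where "M = infsum (\<lambda>(a, b, c). norm (P a b c) * \<rho>0 ^ (a + b + c)) UNIV"
  have \<rho>: "0 < \<rho>" "\<rho> \<le> 1" "\<rho> \<le> \<rho>0" using \<rho>0 by (auto simp: \<rho>_def)
  have "(\<Sum>i\<le>n. \<Sum>j\<le>n. \<Sum>k\<le>n. norm (P i j k) * \<rho> ^ (i + j + k)) \<le> M" for n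
  proof -
    have "(\<Sum>i\<le>n. \<Sum>j\<le>n. \<Sum>k\<le>n. norm (P i j k) * \<rho> ^ (i + j + k)) \<le>
        (\<Sum>i\<le>n. \<Sum>j\<le>n. \<Sum>k\<le>n. norm (P i j k) * \<rho>0 ^ (i + j + k))"
      using \<rho> by (intro sum_mono mult_left_mono power_mono) auto
    also have "\<dots> = sum (\<lambda>(a, b, c). norm (P a b c) * \<rho>0 ^ (a + b + c)) ({..n} \<times> {..n} \<times> {..n})"
      by (simp add: sum.cartesian_product)
    also have "\<dots> \<le> M" unfolding M_def
      using \<rho>0 by (intro finite_sum_le_infsum sm) auto
    finally show ?thesis .
  qed
  then show ?thesis using that \<rho> unfolding majorised_def by blast
qed

context weights
begin

lemma wt2_le:
  assumes "\<And>b. e b \<le> 1" "2 * s \<le> K" "2 * r \<le> K"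
  shows "wt2 a b \<le> K ^ (a + b)"
proof -
  have "(a + b) choose a \<le> 2 ^ (a + b)" by (rule binomial_le_pow2)
  then have ch: "real ((a + b) choose a) \<le> 2 ^ (a + b)"
    by (metis of_nat_le_iff of_nat_numeral of_nat_power)
  have "wt2 a b \<le> 1 * 2 ^ (a + b) * s ^ a * r ^ b * 1"
    unfolding wt2_def using s r assms(1) e_pos[of b] tau_pos[of "a + b"]
    by (intro mult_mono tau_le_1 ch order_refl mult_nonneg_nonneg) auto
  also have "\<dots> = (2 * s) ^ a * (2 * r) ^ b" by (simp add: power_add power_mult_distrib)
  also have "\<dots> \<le> K ^ a * K ^ b" using s r assms by (intro mult_mono power_mono) auto
  finally show ?thesis by (simp add: power_add)
qed

lemma wt_le:
  assumes "\<And>b. e b \<le> 1" "2 * s \<le> K" "2 * r \<le> K" "t \<le> K"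
  shows "wt a b c \<le> K ^ (a + b + c)"
proof -
  have "tau c * t ^ c \<le> 1 * K ^ c" using t assms by (intro mult_mono tau_le_1 power_mono) auto
  then have "wt a b c \<le> K ^ (a + b) * K ^ c"
    unfolding wt_def using wt2_le[OF assms(1-3), of a b] t wt2_pos[of a b] tau_pos[of c] s assms(2)
    by (intro mult_mono) (auto simp: less_imp_le)
  then show ?thesis by (simp add: power_add)
qed

end

section \<open>Convergence and the main result\<close>

text \<open>Orders above k get the value 1, which dominates every product; estimates made with
  \<open>level\<close> are read at order k only. \<open>flat\<close> agrees with it below k and
  exceeds it by the factor 1/\<epsilon> at k.\<close>

definition level :: "real \<Rightarrow> nat \<Rightarrow> nat \<Rightarrow> real" where
  "level \<epsilon> k b = (if b = 0 then 1 else if b < k then \<epsilon> else if b = k then \<epsilon>\<^sup>2 else 1)"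
definition flat :: "real \<Rightarrow> nat \<Rightarrow> real" where
  "flat \<epsilon> b = (if b = 0 then 1 else \<epsilon>)"

text \<open>If i and j are positive and i + j \<le> k, both are below k, so the product of the
  values is \<epsilon>^2, which is at most the value at i + j.\<close>

lemma weights_level:
  assumes "0 < \<epsilon>" "\<epsilon> \<le> 1" "1 \<le> s" "0 < r" "256 \<le> t"
  shows "weights s r t (level \<epsilon> k)"
proof
  have \<epsilon>2: "\<epsilon> * \<epsilon> \<le> \<epsilon>" "\<epsilon> * \<epsilon> \<le> 1" "0 < \<epsilon> * \<epsilon>"
    using assms mult_left_mono[of \<epsilon> 1 \<epsilon>] mult_le_one[of \<epsilon> \<epsilon>] by auto
  have le1: "level \<epsilon> k b \<le> 1" "0 < level \<epsilon> k b" for b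
    using assms \<epsilon>2 by (auto simp: level_def power2_eq_square)
  show "0 < level \<epsilon> k b" for b by (rule le1)
  show "level \<epsilon> k i * level \<epsilon> k j \<le> level \<epsilon> k (i + j)" for i j
  proof (cases "i = 0 \<or> j = 0 \<or> k < i + j")
    case True
    moreover have "level \<epsilon> k i * level \<epsilon> k j \<le> 1"
      using le1 by (intro mult_le_one) (auto simp: less_imp_le)
    ultimately show ?thesis by (auto simp: level_def)
  next
    case False
    then show ?thesis using \<epsilon>2 by (auto simp: level_def power2_eq_square)
  qed
qed (use assms in \<open>auto simp: level_def\<close>)

lemma weights_flat:
  assumes "0 < \<epsilon>" "\<epsilon> \<le> 1" "1 \<le> s" "0 < r" "256 \<le> t"
  shows "weights s r t (flat \<epsilon>)"
proof
  show "flat \<epsilon> i * flat \<epsilon> j \<le> flat \<epsilon> (i + j)" for i j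
    using assms mult_left_mono[of \<epsilon> 1 \<epsilon>] by (auto simp: flat_def)
qed (use assms in \<open>auto simp: flat_def\<close>)

text \<open>The ideal conditions involve \<zeta>-degrees up to 3 only, so the \<zeta>-weight may be
  replaced by a constant.\<close>

lemma (in weights) wt_le_wt2:
  assumes "c \<le> 3"
  shows "wt a b c \<le> t ^ 3 * wt2 a b"
proof -
  have "tau c * t ^ c \<le> 1 * t ^ 3"
    using t assms by (intro mult_mono tau_le_1 power_increasing) auto
  then have "wt2 a b * (tau c * t ^ c) \<le> wt2 a b * t ^ 3"
    using wt2_pos[of a b] by (intro mult_left_mono) auto
  then show ?thesis by (simp add: wt_def mult.commute)
qed

text \<open>The induction hypothesis is stated with \<open>flat\<close>, the step at k is carried
  out with \<open>level\<close>. A bound at order k for \<open>level\<close> is a bound for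
  \<open>flat\<close> with an additional factor \<epsilon>, which compensates the constant
  B.\<close>

lemma solution_small:
  assumes \<Phi>: "in_E1 \<Phi>" "nonresonant \<Phi>" and P: "majorised \<Phi> \<rho> M" and sol: "solves \<Phi> F \<gamma>"
  obtains s r t \<epsilon> d where "weights s r t (flat \<epsilon>)" "0 \<le> d" "\<epsilon> \<le> 1"
    "weights.small s r (flat \<epsilon>) d (sub2 F id_z)" "weights.small s r (flat \<epsilon>) d (sub2 \<gamma> one2)"
    "512 \<le> s * \<rho>" "2196480 \<le> t * \<rho>" "8 * (d * s\<^sup>2) \<le> \<rho> / 200" "256 * 65 \<le> \<rho> * (r * flat \<epsilon> 1)"
proof -
  have \<rho>: "0 < \<rho>" "\<rho> \<le> 1" using P by (auto simp: majorised_def)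
  have M: "0 \<le> M" using majorised_nonneg[OF P] .
  define s where "s = 512 / \<rho>"
  define t where "t = 2196480 / \<rho>"
  define d where "d = \<rho> / (1600 * s\<^sup>2)"
  have s: "1 \<le> s" "512 \<le> s * \<rho>" using \<rho> by (auto simp: s_def field_simps)
  have t: "256 \<le> t" "2196480 \<le> t * \<rho>" using \<rho> by (auto simp: t_def field_simps)
  have d: "0 < d" "8 * (d * s\<^sup>2) \<le> \<rho> / 200" using \<rho> s by (auto simp: d_def)
  define C where "C = 66 ^ 3 * 65 * (64 ^ 3 * M) + 797 + 4291 * (64 * M)"
  have C: "0 \<le> C" using M by (simp add: C_def)
  define CA where "CA = 8 * M / \<rho>\<^sup>2"
  have CA: "0 \<le> CA" using M by (simp add: CA_def)
  obtain L where L: "0 \<le> L" and bound: "\<forall>k\<ge>1. \<forall>e f g. \<forall>D\<ge>0. \<forall>w :: nat \<Rightarrow> real.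
    in_ideal (e + lin_defect \<Phi> k f g) \<and> (\<forall>a. 0 < w a) \<and>
    (\<forall>a. real (a + 1) * w (a + 1) \<le> real (a + k + 1) * s * w a) \<and>
    (\<forall>a. real (a + k + 1) * w a \<le> 4 * real (a + 1) * w (a + 1)) \<and>
    (\<forall>a. (\<Sum>i\<le>a. norm (\<Phi> i 0 2) * w (a - i)) \<le> CA * w a) \<and>
    (\<forall>a. \<forall>c\<le>3. norm (e $ c $ a) \<le> D * w a) \<longrightarrow>
    (\<forall>a. norm (f $ a) \<le> L * D * w a / real (a + k + 1) ^ 2 \<and>
         norm (g $ a) \<le> L * D * w a / real (a + k + 1) ^ 2)"
    using solution_bound[OF \<Phi> s(1) CA] by (elim exE conjE)
  define B where "B = L * (C * t ^ 3)"
  have B: "0 \<le> B" using L C t by (simp add: B_def)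
  \<comment> \<open>Chosen for B \<epsilon> \<le> d, the inequality that closes the induction; B was
    fixed without reference to \<epsilon> and r.\<close>
  define \<epsilon> where "\<epsilon> = min 1 (d / (B + 1))"
  have \<epsilon>: "0 < \<epsilon>" "\<epsilon> \<le> 1" using d B by (auto simp: \<epsilon>_def)
  have B\<epsilon>: "B * \<epsilon> \<le> d"
  proof -
    have "B * \<epsilon> \<le> B * (d / (B + 1))" using B by (intro mult_left_mono) (auto simp: \<epsilon>_def)
    also have "\<dots> \<le> d" using B d by (simp add: field_simps)
    finally show ?thesis .
  qed
  \<comment> \<open>For k = 1 the value of \<open>level\<close> at order 1 is \<epsilon>^2, hence
    this power in the denominator.\<close>
  define r where "r = 256 * 65 / (\<rho> * \<epsilon>\<^sup>2)"
  have r: "0 < r" using \<rho> \<epsilon> by (simp add: r_def)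
  have r\<rho>: "256 * 65 \<le> \<rho> * (r * x)" if "\<epsilon>\<^sup>2 \<le> x" for x
  proof -
    have "256 * 65 = \<rho> * (r * \<epsilon>\<^sup>2)" using \<rho> \<epsilon> by (simp add: r_def)
    also have "\<dots> \<le> \<rho> * (r * x)" using \<rho> r that by (intro mult_left_mono) auto
    finally show ?thesis .
  qed
  have \<epsilon>2: "\<epsilon>\<^sup>2 \<le> \<epsilon>" "\<epsilon>\<^sup>2 \<le> 1" using \<epsilon> mult_left_mono[of \<epsilon> 1 \<epsilon>] mult_le_one[of \<epsilon> \<epsilon>] by (auto simp: power2_eq_square)
  interpret W: weights s r t "flat \<epsilon>" using weights_flat \<epsilon> s r t by blast
  have u: "unipotent F \<gamma>" and id: "\<And>k. in_ideal (defect \<Phi> F \<gamma> $ k)" using sol by (auto simp: solves_def)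
  have c: "F a 0 = (if a = 1 then 1 else 0)" "\<gamma> a 0 = (if a = 0 then 1 else 0)" for a
    using u col_nth[of F 0 a] col_nth[of \<gamma> 0 a] by (auto simp: unipotent_def)
  define ok where "ok b \<longleftrightarrow> (\<forall>a. norm (sub2 F id_z a b) \<le> d * W.wt2 a b / (real (a + b + 1))\<^sup>2 \<and>
      norm (sub2 \<gamma> one2 a b) \<le> d * W.wt2 a b / (real (a + b + 1))\<^sup>2)" for b
  have "ok k" for k
  proof (induction k rule: less_induct)
    case (less k)
    show ?case
    proof (cases "k = 0")
      case True
      have "0 \<le> d * W.wt2 a 0 / (real (a + 0 + 1))\<^sup>2" for a
        using d W.wt2_pos[of a 0] by (simp add: less_imp_le)
      then show ?thesis unfolding ok_def True by (auto simp: sub2_def id_z_def one2_def c)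
    next
      case False
      then have k: "1 \<le> k" by simp
      interpret K: weights s r t "level \<epsilon> k" using weights_level \<epsilon> s r t by blast
      have lt: "K.wt2 a b = W.wt2 a b" if "b < k" for a b
        using that by (simp add: K.wt2_def W.wt2_def level_def flat_def)
      have eq: "K.wt2 a k = \<epsilon> * W.wt2 a k" for a
        using False by (simp add: K.wt2_def W.wt2_def level_def flat_def power2_eq_square)
      \<comment> \<open>Lowering the weight at order k costs nothing here, because the truncations
        have no coefficients from order k on.\<close>
      have cs: "K.small d (sub2 (trunc_w k F) id_z) \<and> K.small d (sub2 (trunc_w k \<gamma>) one2)"
      proof -
        have "norm (sub2 (trunc_w k F) id_z a b) \<le> d * K.wt2 a b / (real (a + b + 1))\<^sup>2 \<and>
          norm (sub2 (trunc_w k \<gamma>) one2 a b) \<le> d * K.wt2 a b / (real (a + b + 1))\<^sup>2" for a b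
        proof (cases "b < k")
          case True
          then show ?thesis using less[OF True] lt[OF True]
            by (simp add: ok_def sub2_def trunc_w_def)
        next
          case False
          then have "sub2 (trunc_w k F) id_z a b = 0" "sub2 (trunc_w k \<gamma>) one2 a b = 0"
            using k by (auto simp: sub2_def trunc_w_def id_z_def one2_def)
          then show ?thesis using d K.wt2_pos[of a b] by (simp add: less_imp_le)
        qed
        then show ?thesis by (simp add: K.small_def)
      qed
      have ucut: "unipotent (trunc_w k F) (trunc_w k \<gamma>)"
        using u k by (simp add: unipotent_def col_trunc_w)
      have bd: "K.bnd C (defect \<Phi> (trunc_w k F) (trunc_w k \<gamma>))"
        unfolding C_def
        by (rule K.bnd_nonlinear(2)[OF ucut _ _ _ P s(2) t(2) d(2) r\<rho>])
          (use cs d \<epsilon>2 k in \<open>auto simp: level_def\<close>)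
      have b: "norm (defect \<Phi> (trunc_w k F) (trunc_w k \<gamma>) $ k $ c $ a) \<le> C * t ^ 3 * K.wt2 a k" if "c \<le> 3" for a c
      proof -
        have "norm (defect \<Phi> (trunc_w k F) (trunc_w k \<gamma>) $ k $ c $ a) \<le> C * K.wt a k c"
          using bd by (simp add: K.bnd_def)
        also have "\<dots> \<le> C * (t ^ 3 * K.wt2 a k)" by (intro mult_left_mono K.wt_le_wt2 that C)
        finally show ?thesis by (simp only: mult.assoc)
      qed
      have "in_ideal (defect \<Phi> (trunc_w k F) (trunc_w k \<gamma>) $ k + lin_defect \<Phi> k (col F k) (col \<gamma> k))"
        using id[of k] defect_nth[OF u, of k \<Phi>] k by simp
      moreover have "0 \<le> C * t ^ 3" using C t by simp
      ultimately have fin: "\<forall>a. norm (col F k $ a) \<le> B * K.wt2 a k / real (a + k + 1) ^ 2 \<and>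
         norm (col \<gamma> k $ a) \<le> B * K.wt2 a k / real (a + k + 1) ^ 2"
        unfolding B_def using K.wt2_pos K.wt2_Suc K.wt2_le_Suc K.conv_coeff[OF P s(2), of 2 _ k] b
        by (intro bound[THEN spec, THEN mp, OF k, THEN spec, THEN spec, THEN spec, THEN spec, THEN mp, THEN spec, THEN mp]
            conjI allI impI) (auto simp only: CA_def)
      have "B * K.wt2 a k / real (a + k + 1) ^ 2 \<le> d * W.wt2 a k / (real (a + k + 1))\<^sup>2" for a
      proof (rule divide_right_mono)
        have "B * \<epsilon> * W.wt2 a k \<le> d * W.wt2 a k"
          using W.wt2_pos[of a k] by (intro mult_right_mono B\<epsilon>) auto
        then show "B * K.wt2 a k \<le> d * W.wt2 a k" by (simp add: eq mult.assoc)
      qed simp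
      moreover have "sub2 F id_z a k = col F k $ a" "sub2 \<gamma> one2 a k = col \<gamma> k $ a" for a
        using k by (auto simp: sub2_def id_z_def one2_def)
      ultimately show ?thesis unfolding ok_def using fin by (auto intro: order_trans)
    qed
  qed
  then have "W.small d (sub2 F id_z)" "W.small d (sub2 \<gamma> one2)"
    by (auto simp: ok_def W.small_def)
  moreover have "256 * 65 \<le> \<rho> * (r * flat \<epsilon> 1)" by (rule r\<rho>) (simp add: flat_def \<epsilon>2)
  ultimately show ?thesis
    using that[OF W.weights_axioms, of d] d s t \<epsilon> by auto
qed

text \<open>With the coefficients bounded at all orders, \<open>bnd_nonlinear\<close> is applied
  once more, now to the full solution with the weight \<open>flat\<close>. It bounds both factors of
  the normal form.\<close>

lemma solution_convergent:
  assumes \<Phi>: "in_E1 \<Phi>" "nonresonant \<Phi>" and conv: "convergent3 \<Phi>" and sol: "solves \<Phi> F \<gamma>"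
  shows "convergent3 (normal_form \<Phi> F \<gamma>)" "convergent2 F" "convergent2 (times_w \<gamma>)"
proof -
  obtain \<rho> M where P: "majorised \<Phi> \<rho> M" using convergent3_majorised[OF conv] .
  obtain s r t \<epsilon> d where W: "weights s r t (flat \<epsilon>)" and d: "0 \<le> d" and \<epsilon>: "\<epsilon> \<le> 1"
    and sm: "weights.small s r (flat \<epsilon>) d (sub2 F id_z)" "weights.small s r (flat \<epsilon>) d (sub2 \<gamma> one2)"
    and par: "512 \<le> s * \<rho>" "2196480 \<le> t * \<rho>" "8 * (d * s\<^sup>2) \<le> \<rho> / 200" "256 * 65 \<le> \<rho> * (r * flat \<epsilon> 1)"
    using solution_small[OF \<Phi> P sol] .
  interpret W: weights s r t "flat \<epsilon>" by (rule W)
  have u: "unipotent F \<gamma>" using sol by (simp add: solves_def)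
  note N = W.bnd_nonlinear[OF u sm d P par]
  define K where "K = 2 * s + 2 * r + t"
  have K: "1 \<le> K" "2 * s \<le> K" "2 * r \<le> K" "t \<le> K" using W.s W.r W.t by (auto simp: K_def)
  have fl: "flat \<epsilon> b \<le> 1" for b using \<epsilon> by (simp add: flat_def)
  obtain C where C: "W.bnd C (inv3 (jac F \<gamma>) * pull \<Phi> F \<gamma>)"
    using W.bnd_mult[OF N(3) N(1)] by blast
  show "convergent3 (normal_form \<Phi> F \<gamma>)"
  proof (rule convergent3I[OF K(1)])
    fix a b c
    have "norm (normal_form \<Phi> F \<gamma> a b c) \<le> C * W.wt a b c"
      using C by (simp add: normal_form_def W.bnd_def)
    also have "\<dots> \<le> C * K ^ (a + b + c)"
      using W.bnd_nonneg[OF C] by (intro mult_left_mono W.wt_le fl K)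
    finally show "norm (normal_form \<Phi> F \<gamma> a b c) \<le> C * K ^ (a + b + c)" .
  qed
  have sub: "norm (sub2 v v' a b) \<le> d * K ^ (a + b)" if "W.small d (sub2 v v')" for v v' a b
  proof -
    have n: "1 \<le> (real (a + b + 1))\<^sup>2" by (rule one_le_power) simp
    have "norm (sub2 v v' a b) \<le> d * W.wt2 a b / (real (a + b + 1))\<^sup>2"
      using that by (simp add: W.small_def)
    also have "\<dots> \<le> d * W.wt2 a b / 1"
      using n d W.wt2_pos[of a b] by (intro divide_left_mono) (auto simp: less_imp_le)
    also have "\<dots> \<le> d * K ^ (a + b)"
      using d W.wt2_le[OF fl K(2,3), of a b] by (simp add: mult_left_mono)
    finally show ?thesis .
  qed
  have tot: "norm (v a b) \<le> (d + 1) * K ^ (a + b)"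
    if "W.small d (sub2 v v')" "norm (v' a b) \<le> 1" for v v' a b
  proof -
    have "norm (v a b) \<le> norm (sub2 v v' a b) + norm (v' a b)"
      using norm_triangle_sub[of "v a b" "v' a b"] by (simp add: sub2_def)
    also have "\<dots> \<le> d * K ^ (a + b) + 1" by (intro add_mono sub that)
    also have "\<dots> \<le> (d + 1) * K ^ (a + b)" using one_le_power[OF K(1), of "a + b"] by (simp add: distrib_right)
    finally show ?thesis .
  qed
  show "convergent2 F"
    by (rule convergent2I[OF K(1)], rule tot[OF sm(1)]) (simp add: id_z_def)
  show "convergent2 (times_w \<gamma>)"
  proof (rule convergent2I[OF K(1)])
    fix a b
    show "norm (times_w \<gamma> a b) \<le> (d + 1) * K ^ (a + b)"
    proof (cases b)
      case 0
      then show ?thesis using d K by (simp add: times_w_def)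
    next
      case (Suc m)
      have "norm (\<gamma> a m) \<le> (d + 1) * K ^ (a + m)" by (rule tot[OF sm(2)]) (simp add: one2_def)
      also have "\<dots> \<le> (d + 1) * K ^ (a + b)" using d K(1) Suc by (intro mult_left_mono power_increasing) auto
      finally show ?thesis by (simp add: times_w_def Suc)
    qed
  qed
qed

theorem theorem5p2:
  fixes \<Phi> :: ps3
  assumes "in_E1 \<Phi>" and "nonresonant \<Phi>"
  shows "(\<exists>!N. in_D1 N \<and> Hom N \<Phi> \<noteq> {})
    \<and> (\<forall>N. in_D1 N \<and> Hom N \<Phi> \<noteq> {} \<longrightarrow> card (Hom N \<Phi>) = 1)
    \<and> (convergent3 \<Phi> \<longrightarrow>
         (\<forall>N H. in_D1 N \<and> H \<in> Hom N \<Phi> \<longrightarrow>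
            convergent3 N \<and> convergent2 (fst H) \<and> convergent2 (snd H)))"
proof -
  obtain F \<gamma> where sol: "solves \<Phi> F \<gamma>"
    and H: "\<And>N. in_D1 N \<Longrightarrow> Hom N \<Phi> = (if N = normal_form \<Phi> F \<gamma> then {(F, times_w \<gamma>)} else {})"
    and D: "in_D1 (normal_form \<Phi> F \<gamma>)"
    using formal_normal_form[OF assms] by blast
  have H': "N = normal_form \<Phi> F \<gamma> \<and> H = (F, times_w \<gamma>)" if "in_D1 N" "H \<in> Hom N \<Phi>" for N H
    using that by (auto simp: H split: if_splits)
  show ?thesis
  proof (intro conjI allI impI)
    show "\<exists>!N. in_D1 N \<and> Hom N \<Phi> \<noteq> {}"
      by (rule ex1I[of _ "normal_form \<Phi> F \<gamma>"]) (use D H in \<open>auto split: if_splits\<close>)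
    show "card (Hom N \<Phi>) = 1" if "in_D1 N \<and> Hom N \<Phi> \<noteq> {}" for N
      using that by (auto simp: H split: if_splits)
    show "convergent3 N" "convergent2 (fst H)" "convergent2 (snd H)"
      if "convergent3 \<Phi>" "in_D1 N \<and> H \<in> Hom N \<Phi>" for N H
      using H'[of N H] that solution_convergent[OF assms that(1) sol] by auto
  qed
qed

end
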